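(* Let $x=x(q)$, $y=y(q)$, $z=z(q)$ be the septic theta quotients defined in the context, and let $E_4$, $E_6$ be the normalized Eisenstein series. Then \begin{align*} E_4(q)=\;& x^4-116x^3y+116xy^3+y^4-116x^3z+848xyz^2+848x^2yz\\ &-848xy^2z-116y^3z+116xz^3+116yz^3+z^4,\\ E_4(q^7)=\;& x^4+4x^3y-4xy^3+y^4+4x^3z+8xyz^2+8x^2yz\\ &-8xy^2z+4y^3z-4xz^3-4yz^3+z^4,\\ E_6(q)=\;& x^6+258x^5y-5904x^4y^2-5904x^2y^4-258xy^5+y^6+258x^5z\\ &+7310x^3y^2z+7310x^2y^3z+258y^5z-5904x^4z^2+7310x^3yz^2\\ &-8751x^2y^2z^2-7310xy^3z^2-5904y^4z^2-7310x^2yz^3\\ &-7310xy^2z^3-5904x^2z^4-5904y^2z^4-258xz^5-258yz^5+z^6,\\ E_6(q^7)=\;& x^6+6x^5y+18x^4y^2+18x^2y^4-6xy^5+y^6+6x^5z+2x^3y^2z\\ &+2x^2y^3z+6y^5z+18x^4z^2+2x^3yz^2-57x^2y^2z^2-2xy^3z^2\\ &+18y^4z^2-2x^2yz^3-2xy^2z^3+18x^2z^4+18y^2z^4-6xz^5-6yz^5+z^6. \end{align*}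
   Context: Let $0<|q|<1$, $q=e^{2\pi i\tau}$ with $\operatorname{Im}\tau>0$; fractional powers mean $q^r=e^{2\pi i r\tau}$. Write $(a;q)_\infty=\prod_{k=0}^{\infty}(1-aq^k)$. Define $$a(q)=-\sum_{n=-\infty}^{\infty}(-1)^nq^{(14n+5)^2/56},\quad b(q)=\sum_{n=-\infty}^{\infty}(-1)^nq^{(14n+3)^2/56},\quad c(q)=\sum_{n=-\infty}^{\infty}(-1)^nq^{(14n+1)^2/56},$$ $$x(q)=q^{7/8}(q^7;q^7)_\infty^3\frac{b(q)}{c^2(q)},\quad y(q)=-q^{7/8}(q^7;q^7)_\infty^3\frac{a(q)}{b^2(q)},\quad z(q)=q^{7/8}(q^7;q^7)_\infty^3\frac{c(q)}{a^2(q)}.$$ The Eisenstein series are $E_{2k}(q)=1+\frac{2}{\zeta(1-2k)}\sum_{n=1}^\infty\frac{n^{2k-1}q^n}{1-q^n}$, where $\zeta$ is the (analytically continued) Riemann zeta function; thus $E_4(q)=1+240\sum_{n\ge1}\frac{n^3q^n}{1-q^n}$ and $E_6(q)=1-504\sum_{n\ge1}\frac{n^5q^n}{1-q^n}$. *)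

theory Defs
  imports "HOL-Analysis.Analysis"
begin

text \<open>
  The nome is \<open>q = exp (2 \<pi> \<i> \<tau>)\<close> with \<open>Im \<tau> > 0\<close>. Fractional powers of \<open>q\<close> are not functions
  of \<open>q\<close> alone, so \<open>q\<^sup>r\<close> and everything built from it is written as a function of \<open>\<tau>\<close>.
\<close>

definition qpow :: "complex \<Rightarrow> real \<Rightarrow> complex" where
  "qpow \<tau> r = exp (2 * of_real pi * \<i> * of_real r * \<tau>)"

definition nome :: "complex \<Rightarrow> complex" where
  "nome \<tau> = exp (2 * of_real pi * \<i> * \<tau>)"

definition qpoch_inf :: "complex \<Rightarrow> complex \<Rightarrow> complex" where
  "qpoch_inf a q = (\<Prod>k. 1 - a * q ^ k)"

definition theta_a :: "complex \<Rightarrow> complex" where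
  "theta_a \<tau> = - (\<Sum>\<^sub>\<infinity>n::int. (-1) powi n * qpow \<tau> ((14 * of_int n + 5)\<^sup>2 / 56))"

definition theta_b :: "complex \<Rightarrow> complex" where
  "theta_b \<tau> = (\<Sum>\<^sub>\<infinity>n::int. (-1) powi n * qpow \<tau> ((14 * of_int n + 3)\<^sup>2 / 56))"

definition theta_c :: "complex \<Rightarrow> complex" where
  "theta_c \<tau> = (\<Sum>\<^sub>\<infinity>n::int. (-1) powi n * qpow \<tau> ((14 * of_int n + 1)\<^sup>2 / 56))"

definition septic_x :: "complex \<Rightarrow> complex" where
  "septic_x \<tau> = qpow \<tau> (7/8) * qpoch_inf (nome \<tau> ^ 7) (nome \<tau> ^ 7) ^ 3
                  * (theta_b \<tau> / (theta_c \<tau>)\<^sup>2)"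

definition septic_y :: "complex \<Rightarrow> complex" where
  "septic_y \<tau> = - qpow \<tau> (7/8) * qpoch_inf (nome \<tau> ^ 7) (nome \<tau> ^ 7) ^ 3
                  * (theta_a \<tau> / (theta_b \<tau>)\<^sup>2)"

definition septic_z :: "complex \<Rightarrow> complex" where
  "septic_z \<tau> = qpow \<tau> (7/8) * qpoch_inf (nome \<tau> ^ 7) (nome \<tau> ^ 7) ^ 3
                  * (theta_c \<tau> / (theta_a \<tau>)\<^sup>2)"

text \<open>
  The Riemann zeta function: the holomorphic function on \<open>\<complex> - {1}\<close> that extends the Dirichlet
  series. It is unique there by the identity theorem; its value at the pole \<open>1\<close> is left unspecified.
\<close>

definition riemann_zeta :: "complex \<Rightarrow> complex" where
  "riemann_zeta = (SOME f. f holomorphic_on (- {1}) \<and>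
      (\<forall>s. Re s > 1 \<longrightarrow> (\<lambda>n. of_nat (Suc n) powr (- s)) sums f s))"

text \<open>
  \<open>eisenstein_E w\<close> is the series of weight \<open>w\<close>, i.e. \<open>E\<^bsub>2k\<^esub>\<close> is \<open>eisenstein_E (2 * k)\<close>, for \<open>k \<ge> 1\<close>;
  the summation index is shifted to start at \<open>0\<close>.
\<close>

definition eisenstein_E :: "nat \<Rightarrow> complex \<Rightarrow> complex" where
  "eisenstein_E w q = 1 + 2 / riemann_zeta (1 - of_nat w) *
     (\<Sum>n. of_nat (Suc n) ^ (w - 1) * q ^ Suc n / (1 - q ^ Suc n))"

end

theory Submission
  imports Defs "HOL-Complex_Analysis.Complex_Analysis"
begin

text \<open>
  On the elliptic curve \<open>\<complex>\<^sup>* / q\<^sup>7\<^sup>\<int>\<close> the point \<open>q\<close> has order 7. Let \<open>P\<close> be the Weierstrass function of this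
  curve, with \<open>P'\<^sup>2 = 4 P\<^sup>3 - E\<^sub>4(q\<^sup>7) P / 12 + E\<^sub>6(q\<^sup>7) / 216\<close>, where \<open>P' = z dP/dz\<close>. The product formulas for
  \<open>P(u) - P(v)\<close> and \<open>P'(u)\<close> in terms of theta functions, together with the Jacobi triple product, give
  \<open>P(q) - P(q\<^sup>2) = y z\<close>, \<open>P(q) - P(q\<^sup>3) = x z\<close>, \<open>P(q\<^sup>2) - P(q\<^sup>3) = x y\<close> and \<open>P'(q) = x z\<^sup>2\<close>, \<open>P'(q\<^sup>2) = y\<^sup>2 z\<close>,
  \<open>P'(q\<^sup>3) = x\<^sup>2 y\<close>. Three points on the cubic with known differences determine the points and the
  coefficients, hence \<open>E\<^sub>4(q\<^sup>7)\<close> and \<open>E\<^sub>6(q\<^sup>7)\<close>. Splitting the Lambert series of \<open>E\<^sub>4(q)\<close> and \<open>E\<^sub>6(q)\<close> modulo 7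
  expresses them through \<open>E\<^sub>4(q\<^sup>7)\<close>, \<open>E\<^sub>6(q\<^sup>7)\<close> and the second and fourth derivatives of \<open>P\<close> at \<open>q\<close>, \<open>q\<^sup>2\<close>, \<open>q\<^sup>3\<close>,
  which are polynomials in \<open>P\<close>, \<open>P'\<close>, \<open>E\<^sub>4(q\<^sup>7)\<close>.
\<close>

section \<open>Values of the zeta function at negative odd integers\<close>

text \<open>The Lambert form of the Weierstrass function of nome q converges only for |q| < |z| <
  1/|q|. All elliptic arguments therefore live on this annulus, two periods wide with the pole 1 on
  its middle circle, and follow one scheme: a combination that is periodic and whose polar part
  cancels at 1 is constant. The nome q^7 comes from (14 n + m)^2 / 56 = m^2 / 56 + 7 n (n - 1) / 2 +
  k n with 2 k = 7 + m. By the triple product each of a, b, c is, up to sign, a power of q^(1/56)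
  times a theta value of nome q^7 at q, q^2 or q^3. The differences of P add up, which forces x z =
  x y + y z. The claimed formulas are checked modulo this relation: a rational parametrization of
  the conic turns them into polynomial identities in two free variables.\<close>

definition powr_rem :: "nat \<Rightarrow> nat \<Rightarrow> complex \<Rightarrow> complex" where
  "powr_rem J n s = of_nat (n + 2) powr (1 - s)
     - (\<Sum>j<J. ((1 - s) gchoose j) * of_nat (n + 1) powr (1 - s - of_nat j))"

lemma norm_gchoose_le:
  fixes a :: complex
  assumes "norm a \<le> B"
  shows "norm (a gchoose j) \<le> (B + j) ^ j"
proof -
  have "norm (\<Prod>i = 0..<j. a - of_nat i) \<le> (\<Prod>i = 0..<j. B + j)"
    unfolding prod_norm[symmetric]
  proof (rule prod_mono, safe)
    fix i assume "i \<in> {0..<j}"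
    then have "norm (a - of_nat i) \<le> norm a + i"
      using norm_triangle_ineq4[of a "of_nat i"] by simp
    with assms \<open>i \<in> {0..<j}\<close> show "norm (a - of_nat i) \<le> B + j" by simp
  qed simp
  also have "\<dots> = (B + j) ^ j" by simp
  finally have 1: "norm (\<Prod>i = 0..<j. a - of_nat i) \<le> (B + j) ^ j" .
  have "norm (a gchoose j) = norm (\<Prod>i = 0..<j. a - of_nat i) / fact j"
    unfolding gbinomial_prod_rev by (simp add: norm_divide)
  also have "\<dots> \<le> norm (\<Prod>i = 0..<j. a - of_nat i)"
    using fact_ge_1[of j, where ?'a = real]
    by (metis div_by_1 frac_le norm_ge_zero order_refl zero_less_one)
  finally show ?thesis using 1 by simp
qed

text \<open>The bound depends on \<open>a\<close> only through \<open>B\<close>, and this uniformity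
  is what later gives holomorphic sums. The constant is deliberately crude; only the order
  \<open>t ^ J\<close> matters.\<close>

lemma norm_one_plus_powr_taylor:
  fixes a :: complex
  assumes a: "norm a \<le> B" and t: "0 \<le> t" "t \<le> 1" and J: "J > 0"
  shows "norm ((1 + of_real t) powr a - (\<Sum>j<J. (a gchoose j) * of_real t ^ j))
           \<le> (B + J) ^ J * fact J * 2 powr (B + J) * t ^ J"
proof -
  \<comment> \<open>The i-th derivative of \<open>(1 + w) powr a\<close>; at \<open>w = 0\<close>,
    divided by \<open>fact i\<close>, it is the binomial coefficient. On the real segment from 0 to
    1 the base \<open>1 + w\<close> lies between 1 and 2, away from the branch cut.\<close>
  define f where "f = (\<lambda>i w. fact i * (a gchoose i) * (1 + w) powr (a - of_nat i))"
  define S where "S = closed_segment (0::complex) 1"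
  have S: "Re w \<ge> 0 \<and> Re w \<le> 1 \<and> Im w = 0" if "w \<in> S" for w
    using that by (auto simp: S_def in_segment)
  have gc: "fact (Suc i) * (a gchoose Suc i) = fact i * (a gchoose i) * (a - of_nat i)" for i
    using of_nat_neq_0[of i, where ?'a = complex] by (simp add: gbinomial_prod_rev)
  obtain n where n: "J = Suc n" using J by (cases J) auto
  have B0: "B \<ge> 0" using a norm_ge_zero order_trans by blast
  have d: "(f i has_field_derivative f (Suc i) x) (at x within S)" if "x \<in> S" for i x
  proof -
    have "1 + x \<notin> \<real>\<^sub>\<le>\<^sub>0" using S[OF that] by (auto simp: complex_nonpos_Reals_iff)
    then have "(f i has_field_derivative
        fact i * (a gchoose i) * ((a - of_nat i) * (1 + x) powr (a - of_nat i - 1))) (at x within S)"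
      unfolding f_def by (auto intro!: derivative_eq_intros)
    moreover have "fact i * (a gchoose i) * ((a - of_nat i) * (1 + x) powr (a - of_nat i - 1)) = f (Suc i) x"
      unfolding f_def gc by (simp add: algebra_simps)
    ultimately show ?thesis by simp
  qed
  have bd: "norm (f J x) \<le> (B + J) ^ J * fact J * 2 powr (B + J)" if "x \<in> S" for x
  proof -
    have x: "1 + x \<in> \<real>" "Re (1 + x) \<ge> 1" "Re (1+x) \<le> 2" using S[OF that] by (auto simp: complex_is_Real_iff)
    have ra: "\<bar>Re a\<bar> \<le> B" using a abs_Re_le_cmod order_trans by blast
    have "norm ((1 + x) powr (a - of_nat J)) = Re (1 + x) powr Re (a - of_nat J)"
      using x by (intro norm_powr_real_powr) auto
    also have "\<dots> \<le> Re (1 + x) powr (B + J)"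
      using x ra by (intro powr_mono) auto
    also have "\<dots> \<le> 2 powr (B + J)"
      using x B0 by (intro powr_mono2) auto
    finally show ?thesis
      unfolding f_def norm_mult mult.commute[of "(B + J) ^ J" "fact J"]
      using norm_gchoose_le[OF a, of J] B0
      by (intro mult_mono) auto
  qed
  have "cmod (f 0 (of_real t) - (\<Sum>i\<le>n. f i 0 * (of_real t - 0) ^ i / (fact i)))
          \<le> ((B + J) ^ J * fact J * 2 powr (B + J)) * cmod (of_real t - 0) ^ (Suc n) / fact n"
  proof (rule complex_Taylor[where S = S])
    show "convex S" by (simp add: S_def)
    show "of_real t \<in> S" using t by (auto simp: S_def in_segment scaleR_conv_of_real intro!: exI[of _ t])
  qed (use d bd n in \<open>auto simp: S_def\<close>)
  also have "\<dots> \<le> ((B + J) ^ J * fact J * 2 powr (B + J)) * cmod (of_real t - 0) ^ (Suc n)"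
  proof -
    have "0 \<le> ((B + J) ^ J * fact J * 2 powr (B + J)) * cmod (of_real t - 0) ^ (Suc n)" (is "0 \<le> ?A")
      using B0 t by simp
    then have "?A / fact n \<le> ?A / 1" by (intro divide_left_mono) (auto simp: fact_ge_1)
    then show ?thesis by simp
  qed
  finally show ?thesis
    using t by (simp add: f_def n lessThan_Suc_atMost)
qed

text \<open>Factoring out \<open>(n + 1) powr (1 - s)\<close> leaves the binomial remainder of order
  \<open>J\<close> at \<open>1 / (n + 1)\<close>. The decay is that of
  \<open>(n + 1) powr (1 - s - J)\<close>, which is summable for
  \<open>Re s > 2 - J\<close>.\<close>

lemma norm_powr_rem_le:
  assumes s: "norm (1 - s) \<le> B" "\<sigma> \<le> Re s" and J: "J > 0"
  shows "norm (powr_rem J n s) \<le> (B + J) ^ J * fact J * 2 powr (B + J) * real (n + 1) powr (1 - \<sigma> - J)"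
proof -
  define N where "N = real (n + 1)"
  have N: "N \<ge> 1" by (simp add: N_def)
  define a where "a = 1 - s"
  have e1: "of_nat (n + 2) powr a = of_real N powr a * (1 + of_real (1 / N)) powr a"
  proof -
    have "of_nat (n + 2) = (of_real N * of_real (1 + 1 / N) :: complex)"
    proof -
      have "real (n + 2) = N * (1 + 1 / N)" using N by (simp add: N_def field_simps)
      then show ?thesis by (metis of_real_mult of_real_of_nat_eq)
    qed
    then show ?thesis using N by (simp add: powr_times_real)
  qed
  have e2: "of_nat (n + 1) powr (a - of_nat j) = of_real N powr a * of_real (1 / N) ^ j" for j
    using N by (simp add: N_def powr_diff powr_nat' power_one_over divide_inverse power_inverse flip: of_nat_Suc del: of_nat_Suc)
  have "powr_rem J n s = of_real N powr a * ((1 + of_real (1 / N)) powr a - (\<Sum>j<J. (a gchoose j) * of_real (1 / N) ^ j))"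
    unfolding powr_rem_def a_def[symmetric] e1 e2 by (simp add: algebra_simps sum_distrib_left)
  also have "norm \<dots> \<le> N powr Re a * ((B + J) ^ J * fact J * 2 powr (B + J) * (1 / N) ^ J)"
    unfolding norm_mult using N s J a_def
    by (intro mult_mono norm_one_plus_powr_taylor) (auto simp: norm_powr_real_powr)
  also have "\<dots> = (B + J) ^ J * fact J * 2 powr (B + J) * N powr (Re a - J)"
    using N by (simp add: powr_diff powr_realpow power_one_over divide_inverse power_inverse)
  also have "\<dots> \<le> (B + J) ^ J * fact J * 2 powr (B + J) * N powr (1 - \<sigma> - J)"
  proof -
    have "B \<ge> 0" using s norm_ge_zero order_trans by blast
    then show ?thesis using N s by (intro mult_left_mono powr_mono) (auto simp: a_def)
  qed
  finally show ?thesis by (simp add: N_def)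
qed

lemma summable_real_Suc_powr: "summable (\<lambda>n. real (n + 1) powr e)" if "e < -1"
  using that summable_Suc_iff[of "\<lambda>n. real n powr e"] by (simp add: summable_real_powr_iff)

lemma summable_norm_powr_rem:
  assumes "J > 0" "Re s > 2 - real J"
  shows "summable (\<lambda>n. norm (powr_rem J n s))"
proof (rule summable_comparison_test')
  show "summable (\<lambda>n. (norm (1 - s) + J) ^ J * fact J * 2 powr (norm (1 - s) + J) * real (n + 1) powr (1 - Re s - J))"
    using assms by (intro summable_mult summable_real_Suc_powr) auto
qed (use norm_powr_rem_le[of s "norm (1 - s)" "Re s" J] assms in auto)

lemma holomorphic_gchoose [holomorphic_intros]:
  assumes "f holomorphic_on A"
  shows "(\<lambda>s. f s gchoose j :: complex) holomorphic_on A"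
  unfolding gbinomial_prod_rev by (intro holomorphic_intros assms) auto

lemma holomorphic_powr_rem: "powr_rem J n holomorphic_on A"
  unfolding powr_rem_def[abs_def] by (intro holomorphic_intros)

lemma holomorphic_suminf_powr_rem:
  assumes J: "J > 0"
  shows "(\<lambda>s. \<Sum>n. powr_rem J n s) holomorphic_on {s. Re s > 2 - real J}"
proof (rule holomorphic_uniform_sequence[where f = "\<lambda>N s. \<Sum>n<N. powr_rem J n s"])
  show o: "open {s. Re s > 2 - real J}" by (simp add: open_halfspace_Re_gt)
  fix s assume s: "s \<in> {s. Re s > 2 - real J}"
  \<comment> \<open>Half the distance to the boundary line: on the closed disc the exponent
    \<open>1 - Re x - J\<close> stays uniformly below -1.\<close>
  define d where "d = (Re s - (2 - real J)) / 2"
  have d: "d > 0" using s by (simp add: d_def)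
  define B where "B = norm (1 - s) + d"
  have *: "norm (1 - x) \<le> B \<and> Re s - d \<le> Re x" if "x \<in> cball s d" for x
    using that norm_triangle_ineq[of "1 - s" "s - x"] abs_Re_le_cmod[of "s - x"]
    by (auto simp: B_def dist_norm)
  have "uniform_limit (cball s d) (\<lambda>N s. \<Sum>n<N. powr_rem J n s) (\<lambda>s. \<Sum>n. powr_rem J n s) sequentially"
  proof (rule Weierstrass_m_test)
    show "norm (powr_rem J n x) \<le> (B + J) ^ J * fact J * 2 powr (B + J) * real (n + 1) powr (1 - (Re s - d) - J)"
      if "x \<in> cball s d" for n x
      using *[OF that] J by (intro norm_powr_rem_le) auto
    show "summable (\<lambda>n. (B + J) ^ J * fact J * 2 powr (B + J) * real (n + 1) powr (1 - (Re s - d) - J))"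
      using s by (intro summable_mult summable_real_Suc_powr) (auto simp: d_def field_simps)
  qed
  moreover have "cball s d \<subseteq> {s. Re s > 2 - real J}"
    using * d by (fastforce simp: d_def field_simps)
  ultimately show "\<exists>d>0. cball s d \<subseteq> {s. Re s > 2 - real J} \<and>
      uniform_limit (cball s d) (\<lambda>N s. \<Sum>n<N. powr_rem J n s) (\<lambda>s. \<Sum>n. powr_rem J n s) sequentially"
    using d by blast
qed (intro holomorphic_intros holomorphic_powr_rem)

section \<open>The Dirichlet series of zeta and its analytic continuation\<close>

definition dirichlet_zeta :: "complex \<Rightarrow> complex" where
  "dirichlet_zeta s = (\<Sum>n. of_nat (Suc n) powr (- s))"

lemma summable_dirichlet_zeta:
  assumes "Re s > 1"
  shows "summable (\<lambda>n. of_nat (Suc n) powr (- s) :: complex)"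
proof (rule summable_norm_cancel)
  have "norm (of_nat (Suc n) powr (- s) :: complex) = real (n + 1) powr (- Re s)" for n
    by (subst norm_powr_real_powr) auto
  then show "summable (\<lambda>n. norm (of_nat (Suc n) powr (- s) :: complex))"
    using assms summable_real_Suc_powr[of "- Re s"] by simp
qed

lemma holomorphic_dirichlet_zeta: "dirichlet_zeta holomorphic_on {s. Re s > 1}"
proof (rule holomorphic_uniform_sequence[where f = "\<lambda>N s. \<Sum>n<N. of_nat (Suc n) powr (- s)"])
  show o: "open {s. Re s > 1}" by (simp add: open_halfspace_Re_gt)
  fix s assume s: "s \<in> {s. Re s > 1}"
  define d where "d = (Re s - 1) / 2"
  have d: "d > 0" using s by (simp add: d_def)
  have *: "Re s - d \<le> Re x" if "x \<in> cball s d" for x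
    using that abs_Re_le_cmod[of "s - x"] by (auto simp: dist_norm)
  have "uniform_limit (cball s d) (\<lambda>N s. \<Sum>n<N. of_nat (Suc n) powr (- s)) dirichlet_zeta sequentially"
    unfolding dirichlet_zeta_def[abs_def]
  proof (rule Weierstrass_m_test)
    show "norm (of_nat (Suc n) powr (- x) :: complex) \<le> real (n + 1) powr (- (Re s - d))"
      if "x \<in> cball s d" for n x
    proof -
      have "norm (of_nat (Suc n) powr (- x) :: complex) = real (n + 1) powr (- Re x)"
        by (subst norm_powr_real_powr) auto
      then show ?thesis using *[OF that] by (simp add: powr_mono)
    qed
    show "summable (\<lambda>n. real (n + 1) powr (- (Re s - d)))"
      using s by (intro summable_real_Suc_powr) (auto simp: d_def field_simps)
  qed
  moreover have "cball s d \<subseteq> {s. Re s > 1}"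
    using * d by (fastforce simp: d_def field_simps)
  ultimately show "\<exists>d>0. cball s d \<subseteq> {s. Re s > 1} \<and>
      uniform_limit (cball s d) (\<lambda>N s. \<Sum>n<N. of_nat (Suc n) powr (- s)) dirichlet_zeta sequentially"
    using d by blast
qed (intro holomorphic_intros)

text \<open>\<open>Z s\<close> stands for \<open>(s - 1)\<close> times zeta, which has no pole. The
  binomial coefficient of index \<open>i + 1\<close> is the one of index \<open>i\<close> times
  \<open>(1 - s - i) / (i + 1)\<close>, and the factor \<open>1 - s - i\<close> is absorbed, up to
  sign, into \<open>Z (s + i)\<close>; this explains the shifted index and the denominator.\<close>

definition zeta_step :: "nat \<Rightarrow> (complex \<Rightarrow> complex) \<Rightarrow> complex \<Rightarrow> complex" where
  "zeta_step J Z s = 1 - (\<Sum>i = 1..<J - 1. ((1 - s) gchoose i) / of_nat (i + 1) * Z (s + of_nat i))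
     + (\<Sum>n. powr_rem J n s)"

text \<open>
  Summing the expansion of \<open>(n + 1) powr (1 - s)\<close> in powers of \<open>n\<close> telescopes on the left, which
  expresses \<open>(s - 1) \<zeta>(s)\<close> through the values of \<open>\<zeta>\<close> at \<open>s + i\<close> with \<open>i \<ge> 1\<close>. The remainder series
  converges further to the left than the Dirichlet series, so this both continues \<open>\<zeta>\<close> and, since
  the remainder vanishes at non-positive integers, evaluates it there.
\<close>

lemma dirichlet_zeta_step:
  assumes s: "Re s > 1" and J: "J \<ge> 2"
  shows "(s - 1) * dirichlet_zeta s = zeta_step J (\<lambda>s. (s - 1) * dirichlet_zeta s) s"
proof -
  have s1: "summable (\<lambda>n. powr_rem J n s)"
    using s J by (intro summable_norm_cancel[OF summable_norm_powr_rem]) auto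
  have tele: "(\<lambda>n. of_nat (Suc (Suc n)) powr (1 - s) - of_nat (Suc n) powr (1 - s)) sums (0 - (of_nat (Suc 0) powr (1 - s) :: complex))"
  proof (rule telescope_sums)
    have "(\<lambda>n. real (Suc n) powr (1 - Re s)) \<longlonglongrightarrow> 0"
      using s tendsto_neg_powr[of "1 - Re s" "\<lambda>n. real (Suc n)" sequentially] filterlim_compose[OF filterlim_real_sequentially filterlim_Suc] by simp
    then show "(\<lambda>n. of_nat (Suc n) powr (1 - s) :: complex) \<longlonglongrightarrow> 0"
      by (subst tendsto_norm_zero_iff[symmetric]) (simp add: norm_powr_real_powr flip: of_nat_Suc del: of_nat_Suc)
  qed
  have eq: "of_nat (Suc (Suc n)) powr (1 - s) - of_nat (Suc n) powr (1 - s) =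
     (\<Sum>j = 1..<J. ((1 - s) gchoose j) * of_nat (Suc n) powr (- (s + of_nat j - 1))) + powr_rem J n s" for n
  proof -
    have "{..<J} = insert 0 {1..<J}" using J by auto
    then have "(\<Sum>j<J. ((1 - s) gchoose j) * of_nat (n + 1) powr (1 - s - of_nat j))
      = of_nat (n + 1) powr (1 - s) + (\<Sum>j = 1..<J. ((1 - s) gchoose j) * of_nat (n + 1) powr (1 - s - of_nat j))"
      by simp
    note sum0 = this
    have "(\<Sum>j = 1..<J. ((1 - s) gchoose j) * of_nat (Suc n) powr (- (s + of_nat j - 1)))
        = (\<Sum>j = 1..<J. ((1 - s) gchoose j) * of_nat (n + 1) powr (1 - s - of_nat j))"
      by (intro sum.cong) (simp_all add: algebra_simps)
    then show ?thesis unfolding powr_rem_def sum0 by simp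
  qed
  have "(\<lambda>n. (\<Sum>j = 1..<J. ((1 - s) gchoose j) * of_nat (Suc n) powr (- (s + of_nat j - 1))) + powr_rem J n s)
    sums ((\<Sum>j = 1..<J. ((1 - s) gchoose j) * dirichlet_zeta (s + of_nat j - 1)) + (\<Sum>n. powr_rem J n s))"
    unfolding dirichlet_zeta_def using s s1
    by (intro sums_add sums_sum sums_mult summable_sums summable_dirichlet_zeta) auto
  with tele have "- 1 = (\<Sum>j = 1..<J. ((1 - s) gchoose j) * dirichlet_zeta (s + of_nat j - 1)) + (\<Sum>n. powr_rem J n s)"
    unfolding eq using sums_unique2 by fastforce
  \<comment> \<open>The term \<open>j = 1\<close> carries the unknown value at \<open>s\<close>
    itself; all others lie at least one unit to the right.\<close>
  also have "(\<Sum>j = 1..<J. ((1 - s) gchoose j) * dirichlet_zeta (s + of_nat j - 1))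
    = (1 - s) * dirichlet_zeta s + (\<Sum>j = 2..<J. ((1 - s) gchoose j) * dirichlet_zeta (s + of_nat j - 1))"
    using J by (subst sum.atLeast_Suc_lessThan) (simp_all add: numeral_2_eq_2)
  also have "(\<Sum>j = 2..<J. ((1 - s) gchoose j) * dirichlet_zeta (s + of_nat j - 1)) =
     (\<Sum>i = 1..<J - 1. ((1 - s) gchoose (Suc i)) * dirichlet_zeta (s + of_nat i))"
    using J by (intro sum.reindex_bij_witness[of _ Suc "\<lambda>i. i - 1"]) (auto simp: of_nat_diff add_diff_eq)
  also have "\<dots> = (\<Sum>i = 1..<J - 1. - (((1 - s) gchoose i) / of_nat (i + 1) * ((s + of_nat i - 1) * dirichlet_zeta (s + of_nat i))))"
  proof (rule sum.cong, goal_cases)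
    case (2 i)
    have "((1 - s) gchoose (Suc i)) = ((1 - s) gchoose i) / of_nat (i + 1) * (1 - s - of_nat i)"
      by (simp add: gbinomial_prod_rev)
    moreover have "a * (1 - s - of_nat i) * D = - (a * ((s + of_nat i - 1) * D))" for a D
      by (simp add: algebra_simps)
    ultimately show ?case by (simp only:)
  qed simp
  finally have *: "- 1 = (1 - s) * dirichlet_zeta s + - (\<Sum>i = 1..<J - 1. ((1 - s) gchoose i) / of_nat (i + 1)
      * ((s + of_nat i - 1) * dirichlet_zeta (s + of_nat i))) + (\<Sum>n. powr_rem J n s)"
    by (simp only: sum_negf)
  have "(s - 1) * z = 1 - S + R" if "- 1 = (1 - s) * z + - S + R" for z S R
    using that by (simp add: algebra_simps)
  from this[OF *] show ?thesis unfolding zeta_step_def .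
qed

text \<open>Only values of \<open>Z\<close> at \<open>s + i\<close> with \<open>i \<ge> 1\<close>
  occur, so \<open>s\<close> may lie one unit further left than the domain of \<open>Z\<close>; with
  \<open>J = m + 2\<close> the remainder series converges exactly on the enlarged
  half-plane.\<close>

lemma holomorphic_zeta_step:
  assumes Z: "Z holomorphic_on {s. Re s > 1 - real m}" and m: "m > 0"
  shows "zeta_step (m + 2) Z holomorphic_on {s. Re s > 1 - real (Suc m)}"
proof -
  have "(\<lambda>s. Z (s + of_nat i)) holomorphic_on {s. Re s > 1 - real (Suc m)}" if "i \<ge> 1" for i
    using that by (intro holomorphic_on_compose_gen[OF _ Z, unfolded o_def] holomorphic_intros) auto
  moreover have "(\<lambda>s. \<Sum>n. powr_rem (m + 2) n s) holomorphic_on {s. Re s > 1 - real (Suc m)}"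
    by (rule holomorphic_on_subset[OF holomorphic_suminf_powr_rem]) auto
  ultimately show ?thesis
    unfolding zeta_step_def[abs_def] by (intro holomorphic_intros) auto
qed

lemma zeta_continuation_half_plane:
  "\<exists>Z. Z holomorphic_on {s. Re s > 1 - real m} \<and> (\<forall>s. Re s > 1 \<longrightarrow> Z s = (s - 1) * dirichlet_zeta s)"
proof (induction m)
  case 0
  show ?case
    by (intro exI[of _ "\<lambda>s. (s - 1) * dirichlet_zeta s"])
       (auto intro!: holomorphic_intros holomorphic_on_subset[OF holomorphic_dirichlet_zeta])
next
  case (Suc m)
  then obtain Z where Z: "Z holomorphic_on {s. Re s > 1 - real m}"
    "\<And>s. Re s > 1 \<Longrightarrow> Z s = (s - 1) * dirichlet_zeta s" by blast
  have "zeta_step (m + 2) Z s = (s - 1) * dirichlet_zeta s" if "Re s > 1" for s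
    using dirichlet_zeta_step[OF that, of "m + 2"] that Z(2) by (simp add: zeta_step_def)
  moreover have "zeta_step (m + 2) Z holomorphic_on {s. Re s > 1 - real (Suc m)}"
  proof (cases "m = 0")
    case False
    then show ?thesis using holomorphic_zeta_step[OF Z(1)] by simp
  next
    case True
    \<comment> \<open>For \<open>J = 2\<close> the finite sum in \<open>zeta_step\<close> is empty,
      so only the remainder has to be holomorphic.\<close>
    have "(\<lambda>s. \<Sum>n. powr_rem 2 n s) holomorphic_on {s. Re s > 0}"
      using holomorphic_suminf_powr_rem[of 2] by simp
    then show ?thesis
      unfolding zeta_step_def[abs_def] using True by (auto intro!: holomorphic_intros simp flip: numeral_2_eq_2)
  qed
  ultimately show ?case by blast
qed

lemma holomorphic_eq_half_plane:
  assumes "f holomorphic_on {s. Re s > c}" "g holomorphic_on {s. Re s > c}"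
    and eq: "\<And>s. Re s > b \<Longrightarrow> f s = g s" and "c \<le> b" "Re s > c"
  shows "f s = g s"
proof (rule analytic_continuation_open[where s = "{s. Re s > b}" and s' = "{s. Re s > c}" and f = f and g = g])
  show "connected {s. Re s > c}" by (intro convex_connected convex_halfspace_Re_gt)
  have "of_real (b + 1) \<in> {s. Re s > b}" by simp
  then show "{s. Re s > b} \<noteq> {}" by blast
qed (use assms in \<open>auto simp: open_halfspace_Re_gt\<close>)

text \<open>The continuations to nested half-planes agree by the identity theorem and glue to an
  entire function; \<open>k s\<close> merely selects some half-plane that contains
  \<open>s\<close>.\<close>

lemma zeta_continuation:
  "\<exists>Z. Z holomorphic_on UNIV \<and> (\<forall>s. Re s > 1 \<longrightarrow> Z s = (s - 1) * dirichlet_zeta s)"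
proof -
  obtain W where W: "\<And>m. W m holomorphic_on {s. Re s > 1 - real m}"
      "\<And>m s. Re s > 1 \<Longrightarrow> W m s = (s - 1) * dirichlet_zeta s"
    using zeta_continuation_half_plane by metis
  define k where "k = (\<lambda>s. nat (\<lceil>1 - Re s\<rceil> + 1))"
  have k: "Re s > 1 - real (k s)" for s unfolding k_def by linarith
  define Z where "Z = (\<lambda>s. W (k s) s)"
  have agree: "W m s = W n s" if "m \<le> n" "Re s > 1 - real m" for m n s
    by (rule holomorphic_eq_half_plane[where f = "W m" and g = "W n" and b = 1 and c = "1 - real m"])
       (use that W in \<open>auto intro: holomorphic_on_subset[OF W(1)[of n]]\<close>)
  have ZW: "Z s = W m s" if "Re s > 1 - real m" for m s
  proof (cases "m \<le> k s")
    case True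
    then show ?thesis unfolding Z_def using agree[OF True that] by metis
  next
    case False
    then show ?thesis unfolding Z_def using agree[of "k s" m s] k[of s] by simp
  qed
  have "Z holomorphic_on {s. Re s > 1 - real m}" for m
    by (rule holomorphic_transform[OF W(1)]) (simp add: ZW)
  then have "Z field_differentiable (at s)" for s
    using k[of s] by (auto simp: holomorphic_on_open open_halfspace_Re_gt field_differentiable_def)
  then have "Z holomorphic_on UNIV" by (simp add: holomorphic_on_def)
  with W(2) show ?thesis unfolding Z_def by blast
qed

text \<open>A property of the \<open>SOME\<close> term needs a witness, here
  \<open>Z s / (s - 1)\<close> with the entire \<open>Z\<close> of
  \<open>zeta_continuation\<close>.\<close>

lemma riemann_zeta_props:
  shows holomorphic_riemann_zeta: "riemann_zeta holomorphic_on (- {1})"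
    and riemann_zeta_eq_dirichlet: "Re s > 1 \<Longrightarrow> riemann_zeta s = dirichlet_zeta s"
proof -
  obtain Z where Z: "Z holomorphic_on UNIV" "\<And>s. Re s > 1 \<Longrightarrow> Z s = (s - 1) * dirichlet_zeta s"
    using zeta_continuation by blast
  have "(\<lambda>s. Z s / (s - 1)) holomorphic_on (- {1})"
    by (intro holomorphic_intros holomorphic_on_subset[OF Z(1)]) auto
  moreover have "(\<lambda>n. of_nat (Suc n) powr (- s)) sums (Z s / (s - 1))" if "Re s > 1" for s
  proof -
    have "s \<noteq> 1" using that by auto
    then have "Z s / (s - 1) = dirichlet_zeta s" using Z(2)[OF that] by simp
    then show ?thesis
      using summable_sums[OF summable_dirichlet_zeta[OF that]] by (simp add: dirichlet_zeta_def)
  qed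
  ultimately have "\<exists>f. f holomorphic_on (- {1}) \<and> (\<forall>s. Re s > 1 \<longrightarrow> (\<lambda>n. of_nat (Suc n) powr (- s)) sums f s)"
    by (intro exI[of _ "\<lambda>s. Z s / (s - 1)"]) blast
  from someI_ex[OF this, folded riemann_zeta_def]
  have *: "riemann_zeta holomorphic_on (- {1})" "\<And>s. Re s > 1 \<Longrightarrow> (\<lambda>n. of_nat (Suc n) powr (- s)) sums riemann_zeta s"
    by auto
  show "riemann_zeta holomorphic_on (- {1})" by (rule *)
  show "riemann_zeta s = dirichlet_zeta s" if "Re s > 1"
    using sums_unique[OF *(2)[OF that]] by (simp add: dirichlet_zeta_def)
qed

section \<open>Zeta at non-positive integers\<close>

lemma powr_rem_neg_int:
  assumes "J \<ge> m + 2"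
  shows "powr_rem J n (- of_nat m) = 0"
proof -
  \<comment> \<open>At \<open>s = -m\<close> the exponent \<open>1 - s\<close> is the natural number
    \<open>m + 1\<close>, so the binomial series terminates, and \<open>J \<ge> m + 2\<close> covers
    all of its terms.\<close>
  have "(\<Sum>j<J. ((1 - (- of_nat m)) gchoose j) * of_nat (n + 1) powr (1 - (- of_nat m) - of_nat j))
    = (\<Sum>j\<le>m + 1. of_nat ((m + 1) choose j) * 1 ^ j * of_nat (n + 1) ^ (m + 1 - j) :: complex)"
  proof (rule sum.mono_neutral_cong_right)
    have c: "1 - (- of_nat m) = (of_nat (m + 1) :: complex)" by simp
    show "\<forall>j\<in>{..<J} - {..m + 1}. ((1 - (- of_nat m)) gchoose j) * of_nat (n + 1) powr (1 - (- of_nat m) - of_nat j) = (0::complex)"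
      unfolding c by (auto simp: binomial_eq_0 simp flip: binomial_gbinomial simp del: of_nat_Suc of_nat_add)
    fix j assume j: "j \<in> {..m + 1}"
    then have d: "(of_nat (m + 1) - of_nat j :: complex) = of_nat (m + 1 - j)" by (simp add: of_nat_diff)
    have "of_nat (n + 1) powr of_nat (m + 1 - j) = (of_nat (n + 1) :: complex) ^ (m + 1 - j)"
      by (rule powr_nat') (simp del: of_nat_Suc)
    then show "((1 - (- of_nat m)) gchoose j) * of_nat (n + 1) powr (1 - (- of_nat m) - of_nat j)
       = (of_nat ((m + 1) choose j) * 1 ^ j * of_nat (n + 1) ^ (m + 1 - j) :: complex)"
      unfolding c d by (simp only: binomial_gbinomial power_one mult_1_right)
  qed (use assms in auto)
  also have "\<dots> = (1 + of_nat (n + 1)) ^ (m + 1)"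
    by (rule binomial_ring[symmetric])
  also have "\<dots> = of_nat (n + 2) powr (1 - (- of_nat m))"
    using powr_nat'[of "of_nat (n + 2) :: complex" "m + 1"] by (simp add: add_ac)
  finally show ?thesis by (simp add: powr_rem_def)
qed

text \<open>Both sides of the step identity continue to \<open>Re s > 2 - J\<close>. The choice
  \<open>J = m + 3\<close> puts \<open>-m\<close> inside this half-plane, and there the remainder
  vanishes, which leaves a finite recurrence.\<close>

lemma zeta_neg_int_recurrence:
  obtains Z where "\<And>s. s \<noteq> 1 \<Longrightarrow> riemann_zeta s = Z s / (s - 1)" "Z 1 = 1"
    "\<And>m. Z (- of_nat m) = 1 - (\<Sum>i = 1..m + 1. of_nat ((m + 1) choose i) / of_nat (i + 1) * Z (of_nat i - of_nat m))"
proof -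
  obtain Z where Z: "Z holomorphic_on UNIV" "\<And>s. Re s > 1 \<Longrightarrow> Z s = (s - 1) * dirichlet_zeta s"
    using zeta_continuation by blast
  have 1: "riemann_zeta w = Z w / (w - 1)" if "w \<noteq> 1" for w
  proof (rule analytic_continuation_open[where s = "{s. Re s > 1}" and s' = "- {1}"
      and f = riemann_zeta and g = "\<lambda>s. Z s / (s - 1)"])
    show "connected (- {1 :: complex})" by (rule connected_punctured_universe) simp
    have "2 \<in> {s. Re s > 1}" by simp
    then show "{s. Re s > 1} \<noteq> {}" by blast
    show "(\<lambda>s. Z s / (s - 1)) holomorphic_on (- {1})"
      by (intro holomorphic_intros holomorphic_on_subset[OF Z(1)]) auto
    show "riemann_zeta s = Z s / (s - 1)" if "s \<in> {s. Re s > 1}" for s :: complex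
      using that Z(2)[of s] riemann_zeta_eq_dirichlet[of s] by auto
  qed (use that in \<open>auto simp: open_halfspace_Re_gt holomorphic_riemann_zeta\<close>)
  have step: "Z s = zeta_step J Z s" if "Re s > 2 - real J" "J \<ge> 2" for J s
  proof (rule holomorphic_eq_half_plane[where f = Z and g = "zeta_step J Z"
      and c = "2 - real J" and b = "max 1 (2 - real J)"])
    have "(\<lambda>s. Z (s + of_nat i)) holomorphic_on A" for i A
      by (intro holomorphic_on_compose_gen[OF _ Z(1), unfolded o_def] holomorphic_intros) auto
    then show "zeta_step J Z holomorphic_on {s. Re s > 2 - real J}"
      unfolding zeta_step_def[abs_def]
      using holomorphic_suminf_powr_rem[of J] that by (intro holomorphic_intros) auto
    show "Z s = zeta_step J Z s" if "Re s > max 1 (2 - real J)" for s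
      using dirichlet_zeta_step[of s J] that \<open>J \<ge> 2\<close> Z(2) by (simp add: zeta_step_def)
  qed (use that in \<open>auto intro: holomorphic_on_subset[OF Z(1)]\<close>)
  \<comment> \<open>The starting value, the residue of zeta at 1: the finite sum is empty, and each
    remainder is the difference of two zeroth powers.\<close>
  have "Z 1 = zeta_step 2 Z 1" by (rule step) auto
  also have "\<dots> = 1"
  proof -
    have "(of_nat (n + 2) :: complex) \<noteq> 0" "(of_nat (n + 1) :: complex) \<noteq> 0" for n
      by (simp_all only: of_nat_eq_0_iff)
    then have "powr_rem 2 n 1 = 0" for n
      unfolding powr_rem_def by (simp add: numeral_2_eq_2 del: of_nat_add of_nat_Suc)
    then show ?thesis by (simp add: zeta_step_def)
  qed
  finally have "Z 1 = 1" .
  moreover have "Z (- of_nat m) = 1 - (\<Sum>i = 1..m + 1. of_nat ((m + 1) choose i) / of_nat (i + 1) * Z (of_nat i - of_nat m))" for m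
  proof -
    have c: "1 - (- of_nat m) = (of_nat (m + 1) :: complex)" by simp
    have r: "powr_rem (m + 3) n (- of_nat m) = 0" for n by (rule powr_rem_neg_int) simp
    have "Z (- of_nat m) = zeta_step (m + 3) Z (- of_nat m)" by (rule step) auto
    also have "\<dots> = 1 - (\<Sum>i = 1..<m + 2. of_nat ((m + 1) choose i) / of_nat (i + 1) * Z (of_nat i - of_nat m))"
      unfolding zeta_step_def c r by (simp flip: binomial_gbinomial del: of_nat_Suc of_nat_add)
    also have "{1..<m + 2} = {1..m + 1}" by auto
    finally show ?thesis .
  qed
  ultimately show ?thesis using 1 that by blast
qed

text \<open>The values computed below are Bernoulli numbers: \<open>Z (-m)\<close> is B_(m+1) with
  the convention B_1 = 1/2.\<close>

lemma riemann_zeta_neg_3: "riemann_zeta (- 3) = 1 / 120"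
  and riemann_zeta_neg_5: "riemann_zeta (- 5) = - 1 / 252"
proof -
  obtain Z where Z: "\<And>s. s \<noteq> 1 \<Longrightarrow> riemann_zeta s = Z s / (s - 1)" "Z 1 = 1"
    "\<And>m. Z (- of_nat m) = 1 - (\<Sum>i = 1..m + 1. of_nat ((m + 1) choose i) / of_nat (i + 1) * Z (of_nat i - of_nat m))"
    using zeta_neg_int_recurrence by blast
  have "Z 0 = 1 / 2" using Z(3)[of 0] Z(2) by simp
  note Z' = Z(2) this
  have "Z (- 1) = 1 / 6" using Z(3)[of 1] Z' by (simp add: numeral_eq_Suc)
  note Z' = Z' this
  have "Z (- 2) = 0" using Z(3)[of 2] Z' by (simp add: numeral_eq_Suc)
  note Z' = Z' this
  have "Z (- 3) = - 1 / 30" using Z(3)[of 3] Z' by (simp add: numeral_eq_Suc)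
  note Z' = Z' this
  have "Z (- 4) = 0" using Z(3)[of 4] Z' by (simp add: numeral_eq_Suc)
  note Z' = Z' this
  have "Z (- 5) = 1 / 42" using Z(3)[of 5] Z' by (simp add: numeral_eq_Suc)
  note Z' = Z' this
  show "riemann_zeta (- 3) = 1 / 120" "riemann_zeta (- 5) = - 1 / 252"
    by (simp_all add: Z(1) Z')
qed

section \<open>Periodic functions on an annulus\<close>

text \<open>In logarithmic radius this has twice the width of the period \<open>z\<close> to
  \<open>q * z\<close>, so the functional equation relates its outer half to its inner half. Both
  Lambert series in \<open>wp0\<close> converge here.\<close>

definition annulus :: "complex \<Rightarrow> complex set" where
  "annulus q = {z. norm q < norm z \<and> norm (q * z) < 1}"

lemma open_annulus: "open (annulus q)"
  unfolding annulus_def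
  by (intro open_Collect_conj open_Collect_less continuous_intros)

lemma exp_ne_1_small:
  fixes u :: complex
  assumes "norm u < 1" "u \<noteq> 0"
  shows "exp u \<noteq> 1"
proof
  assume "exp u = 1"
  then obtain n where n: "Re u = 0" "Im u = of_int (2 * n) * pi"
    unfolding exp_eq_1 by blast
  have "\<bar>Im u\<bar> < 1" using abs_Im_le_cmod[of u] assms by simp
  then have "\<bar>of_int (2 * n)\<bar> * pi < 1" using n by (simp add: abs_mult)
  moreover have "n \<noteq> 0 \<Longrightarrow> \<bar>of_int (2 * n)\<bar> * pi \<ge> 2 * pi"
    by (intro mult_right_mono) auto
  ultimately have "n = 0" using pi_gt3 by (cases "n = 0") linarith+
  then have "u = 0" using n by (simp add: complex_eq_iff)
  then show False using assms by simp
qed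

lemma exp_in_annulus_iff:
  assumes "q \<noteq> 0"
  shows "exp u \<in> annulus q \<longleftrightarrow> \<bar>Re u\<bar> < - ln (norm q)"
proof -
  define l where "l = ln (norm q)"
  have q: "norm q = exp l" using assms by (simp add: l_def)
  show ?thesis unfolding l_def[symmetric] annulus_def
    by (auto simp: q norm_mult simp flip: exp_add)
qed

text \<open>
  Liouville's theorem for the torus: pulled back along \<open>exp\<close>, the function lives on a strip and, by
  periodicity, attains its maximum modulus there.
\<close>

lemma annulus_periodic_constant:
  assumes q: "q \<noteq> 0" "norm q < 1"
    and hol: "f holomorphic_on (annulus q - {1})"
    and per: "\<And>z. 1 < norm z \<Longrightarrow> norm (q * z) < 1 \<Longrightarrow> f (q * z) = f z"
    and lim: "((\<lambda>u. f (exp u)) \<longlongrightarrow> L) (at 0)"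
    and z: "z \<in> annulus q" "z \<noteq> 1"
  shows "f z = L"
proof -
  define l where "l = - ln (norm q)"
  have l: "l > 0" using q by (simp add: l_def)
  define S where "S = {u. \<bar>Re u\<bar> < l}"
  have expS: "exp u \<in> annulus q \<longleftrightarrow> u \<in> S" for u
    using exp_in_annulus_iff[OF q(1)] by (simp add: S_def l_def)
  \<comment> \<open>The pullback along \<open>exp\<close>, with the value \<open>L\<close> filled in
    at all preimages of 1; these turn out to be removable singularities.\<close>
  define g where "g = (\<lambda>u. if exp u = 1 then L else f (exp u))"
  have S_alt: "S = {u. Re u > - l} \<inter> {u. Re u < l}" by (auto simp: S_def)
  have oS: "open S" unfolding S_alt by (intro open_Int open_halfspace_Re_gt open_halfspace_Re_lt)
  have cS: "connected S" unfolding S_alt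
    by (intro convex_connected convex_Int convex_halfspace_Re_gt convex_halfspace_Re_lt)
  have away: "g holomorphic_on {u \<in> S. exp u \<noteq> 1}"
  proof (rule holomorphic_transform)
    show "(\<lambda>u. f (exp u)) holomorphic_on {u \<in> S. exp u \<noteq> 1}"
      by (intro holomorphic_on_compose_gen[OF _ hol, unfolded o_def] holomorphic_intros) (auto simp: expS)
  qed (auto simp: g_def)
  have o1: "open {u \<in> S. exp u \<noteq> 1}"
    using oS by (intro open_Collect_conj open_Collect_neq continuous_intros) auto
  have "g field_differentiable (at u0)" if u0: "u0 \<in> S" for u0
  proof (cases "exp u0 = 1")
    case False
    then show ?thesis
      using away o1 u0 by (auto simp: holomorphic_on_open field_differentiable_def)
  next
    case True
    obtain e0 where e0: "e0 > 0" "ball u0 e0 \<subseteq> S" using oS u0 open_contains_ball by blast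
    define e where "e = min e0 1"
    have e: "e > 0" "ball u0 e \<subseteq> S" "e \<le> 1" using e0 by (auto simp: e_def)
    have expd: "exp u = exp (u - u0)" for u using True by (simp add: exp_diff)
    have ne: "exp u \<noteq> 1" if "u \<in> ball u0 e - {u0}" for u
      unfolding expd[of u] using that e by (intro exp_ne_1_small) (auto simp: dist_norm norm_minus_commute)
    have "g holomorphic_on ball u0 e"
    proof (rule no_isolated_singularity'[where K = "{u0}"])
      show "g holomorphic_on ball u0 e - {u0}"
        by (rule holomorphic_on_subset[OF away]) (use ne e in auto)
      have "((\<lambda>u. f (exp u)) \<longlongrightarrow> L) (at u0)"
        by (rule LIM_offset_zero_cancel) (use lim True in \<open>simp add: exp_add\<close>)
      moreover have "eventually (\<lambda>u. u \<in> ball u0 e - {u0}) (at u0)"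
        using e by (intro eventually_at_in_open) auto
      then have "eventually (\<lambda>u. f (exp u) = g u) (at u0)"
        by eventually_elim (use ne in \<open>auto simp: g_def\<close>)
      ultimately have "(g \<longlongrightarrow> L) (at u0)" by (rule Lim_transform_eventually)
      then show "(g \<longlongrightarrow> g z) (at z within ball u0 e)" if "z \<in> {u0}" for z
        using that True e by (auto simp: g_def at_within_open[of _ "ball u0 e"])
    qed auto
    then show ?thesis using e by (auto simp: holomorphic_on_open field_differentiable_def)
  qed
  then have holg: "g holomorphic_on S" by (simp add: holomorphic_on_def field_differentiable_at_within)
  define \<kappa> where "\<kappa> = Ln q"
  have \<kappa>: "exp \<kappa> = q" "Re \<kappa> = - l" using q by (simp_all add: \<kappa>_def l_def)
  \<comment> \<open>Periodicity is available only from the right half of the strip to the left one;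
    the opposite move uses the same equation at \<open>u - \<kappa>\<close>.\<close>
  have gshift: "g (u + \<kappa>) = g u" if "0 < Re u" "Re u < l" for u
  proof -
    have "exp u \<noteq> 1" "exp (u + \<kappa>) \<noteq> 1" using that \<kappa> by (auto simp: exp_eq_1)
    moreover have "f (q * exp u) = f (exp u)"
    proof (rule per)
      have "norm q = exp (- l)" using q by (simp add: l_def)
      then show "norm (q * exp u) < 1" using that by (simp add: norm_mult flip: exp_add)
    qed (use that in simp)
    ultimately show ?thesis by (simp add: g_def exp_add \<kappa> mult.commute)
  qed
  \<comment> \<open>A compact fundamental rectangle for the periods \<open>\<kappa>\<close> and 2 pi
    i: a maximum of \<open>norm g\<close> on it is a maximum on the whole strip, attained at an
    interior point.\<close>
  define K where "K = cbox (Complex (- l / 2) 0) (Complex (l / 2) (2 * pi))"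
  have KS: "K \<subseteq> S" using l by (auto simp: K_def S_def in_cbox_complex_iff)
  have red: "\<exists>u'\<in>K. g u' = g u" if u: "u \<in> S" for u
  proof -
    obtain v where v: "\<bar>Re v\<bar> \<le> l / 2" "g v = g u"
    proof (cases "\<bar>Re u\<bar> \<le> l / 2")
      case False
      show ?thesis
      proof (cases "Re u > 0")
        case True
        then show ?thesis using that[of "u + \<kappa>"] gshift[of u] u False \<kappa> by (auto simp: S_def)
      next
        case neg: False
        then show ?thesis using that[of "u - \<kappa>"] gshift[of "u - \<kappa>"] u False \<kappa> by (auto simp: S_def)
      qed
    qed (use that in blast)
    define u' where "u' = v + of_int (2 * (- \<lfloor>Im v / (2 * pi)\<rfloor>)) * pi * \<i>"
    have "exp u' = exp v" unfolding u'_def exp_eq by (intro exI) (rule refl)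
    moreover have "Im u' = 2 * pi * frac (Im v / (2 * pi))"
      by (simp add: u'_def frac_def field_simps)
    moreover have "0 \<le> frac (Im v / (2 * pi))" "frac (Im v / (2 * pi)) \<le> 1"
      using frac_lt_1[of "Im v / (2 * pi)"] by auto
    moreover have "Re u' = Re v" by (simp add: u'_def)
    ultimately have "u' \<in> K" "g u' = g v" using v by (auto simp: K_def in_cbox_complex_iff g_def)
    then show ?thesis using v by auto
  qed
  have "Complex 0 0 \<in> K" using l by (simp add: K_def in_cbox_complex_iff)
  then obtain \<xi> where \<xi>: "\<xi> \<in> K" "\<And>u. u \<in> K \<Longrightarrow> norm (g u) \<le> norm (g \<xi>)"
    using continuous_attains_sup[of K "\<lambda>u. norm (g u)"] holomorphic_on_imp_continuous_on[OF holg] KS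
    by (metis K_def compact_cbox continuous_on_norm continuous_on_subset empty_iff)
  have "g constant_on S"
    by (rule maximum_modulus_principle[where U = S and \<xi> = \<xi>]) (use holg oS cS \<xi> KS red in \<open>auto, metis\<close>)
  moreover have "z \<noteq> 0" using z by (auto simp: annulus_def)
  then have "Ln z \<in> S" "exp (Ln z) = z" "0 \<in> S" using z l expS[of "Ln z"] by (auto simp: S_def)
  ultimately have "g (Ln z) = g 0" by (auto simp: constant_on_def)
  then show ?thesis using z \<open>exp (Ln z) = z\<close> by (simp add: g_def)
qed

section \<open>The Weierstrass function as a Lambert series\<close>

text \<open>Each application of z d/dz to the power series contributes one factor \<open>n\<close>
  and keeps the radius of convergence.\<close>

lemma summable_power_times_geometric:
  fixes z :: complex
  assumes "norm z < 1"
  shows "summable (\<lambda>n. of_nat n ^ k * z ^ n)"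
  using assms
proof (induction k arbitrary: z)
  case 0
  then show ?case by (simp add: summable_geometric)
next
  case (Suc k)
  obtain r where r: "norm z < r" "r < 1" using Suc.prems dense by blast
  have "summable (\<lambda>n. diffs (\<lambda>n. of_nat n ^ k) n * z ^ n)"
    by (rule termdiff_converges[of _ r]) (use r Suc.IH in auto)
  then have "summable (\<lambda>n. z * (diffs (\<lambda>n. of_nat n ^ k) n * z ^ n))" by (rule summable_mult)
  then have "summable (\<lambda>n. of_nat (Suc n) ^ Suc k * z ^ Suc n)"
    by (simp add: diffs_def mult_ac)
  then show ?case by (subst (asm) summable_Suc_iff)
qed

text \<open>
  The term of index \<open>0\<close> is \<open>0\<close>, because the denominator \<open>1 - q ^ 0\<close> vanishes.
\<close>

definition lambert :: "complex \<Rightarrow> nat \<Rightarrow> complex \<Rightarrow> complex" where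
  "lambert q k z = (\<Sum>n. of_nat n ^ k / (1 - q ^ n) * z ^ n)"

text \<open>
  For \<open>norm q < norm z < 1 / norm q\<close> this is the sum of \<open>q\<^sup>n z / (1 - q\<^sup>n z)\<^sup>2\<close> over all integers \<open>n\<close>, so up to
  an additive constant \<open>wp0\<close> is the Weierstrass function of \<open>\<complex>\<^sup>* / q\<^sup>\<int>\<close>; \<open>wp1\<close> and \<open>wp2\<close> are its
  derivatives for \<open>z d/dz\<close>.
\<close>

definition wp0 :: "complex \<Rightarrow> complex \<Rightarrow> complex" where
  "wp0 q z = z / (1 - z)\<^sup>2 + lambert q 1 (q * z) + lambert q 1 (q / z)"

definition wp1 :: "complex \<Rightarrow> complex \<Rightarrow> complex" where
  "wp1 q z = z * (1 + z) / (1 - z) ^ 3 + lambert q 2 (q * z) - lambert q 2 (q / z)"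

definition wp2 :: "complex \<Rightarrow> complex \<Rightarrow> complex" where
  "wp2 q z = z * (1 + 4 * z + z\<^sup>2) / (1 - z) ^ 4 + lambert q 3 (q * z) + lambert q 3 (q / z)"

locale punctured_disc =
  fixes q :: complex
  assumes q0: "q \<noteq> 0" and q1: "norm q < 1"
begin

lemma one_minus_power_ne_0: "n > 0 \<Longrightarrow> 1 - q ^ n \<noteq> 0"
proof
  assume n: "n > 0" and "1 - q ^ n = 0"
  then have "norm q ^ n = 1" by (metis eq_iff_diff_eq_0 norm_one norm_power)
  moreover have "norm q ^ n < 1" using n q1 by (simp add: power_less_one_iff)
  ultimately show False by simp
qed

lemma norm_one_minus_power_ge: "n > 0 \<Longrightarrow> norm (1 - q ^ n) \<ge> 1 - norm q"
proof -
  assume n: "n > 0"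
  have "norm q ^ n \<le> norm q" using n q1 by (metis One_nat_def Suc_leI less_imp_le norm_ge_zero power_decreasing power_one_right)
  then show ?thesis using norm_triangle_ineq2[of 1 "q ^ n"] by (simp add: norm_power)
qed

lemma summable_lambert:
  assumes "norm z < 1"
  shows "summable (\<lambda>n. of_nat n ^ k / (1 - q ^ n) * z ^ n)"
proof (rule summable_norm_cancel, rule summable_comparison_test')
  have nz: "norm (of_real (norm z) :: complex) < 1" using assms by simp
  have "summable (\<lambda>n. of_real (of_nat n ^ k * norm z ^ n) :: complex)"
    using summable_power_times_geometric[OF nz, of k] by simp
  then have "summable (\<lambda>n. real n ^ k * norm z ^ n)" unfolding summable_of_real_iff by simp
  then show "summable (\<lambda>n. 1 / (1 - norm q) * (real n ^ k * norm z ^ n))" by (rule summable_mult)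
  show "norm (norm (of_nat n ^ k / (1 - q ^ n) * z ^ n)) \<le> 1 / (1 - norm q) * (real n ^ k * norm z ^ n)" for n
  proof (cases "n = 0")
    case False
    then have "norm (of_nat n ^ k / (1 - q ^ n) * z ^ n) = 1 / norm (1 - q ^ n) * (real n ^ k * norm z ^ n)"
      by (simp add: norm_mult norm_divide norm_power)
    also have "\<dots> \<le> 1 / (1 - norm q) * (real n ^ k * norm z ^ n)"
      using norm_one_minus_power_ge[of n] False q1 by (intro mult_right_mono divide_left_mono mult_pos_pos) auto
    finally show ?thesis by simp
  qed (use q1 in auto)
qed

lemma DERIV_lambert:
  assumes "norm z < 1" "z \<noteq> 0"
  shows "(lambert q k has_field_derivative lambert q (Suc k) z / z) (at z)"
proof -
  define c where "c = (\<lambda>n. of_nat n ^ k / (1 - q ^ n))"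
  have "((\<lambda>z. \<Sum>n. c n * z ^ n) has_field_derivative (\<Sum>n. diffs c n * z ^ n)) (at z)"
  proof -
    obtain r where r: "norm z < r" "r < 1" using assms(1) dense by blast
    then show ?thesis
      using summable_lambert[of "of_real r" k] norm_ge_zero[of z]
      by (intro termdiffs_strong[of _ "of_real r"]) (auto simp: c_def simp del: norm_ge_zero)
  qed
  moreover have "z * (\<Sum>n. diffs c n * z ^ n) = lambert q (Suc k) z"
  proof -
    have s: "summable (\<lambda>n. diffs c n * z ^ n)"
    proof -
      obtain r where r: "norm z < r" "r < 1" using assms(1) dense by blast
      show ?thesis
        by (rule termdiff_converges[of _ r]) (use r summable_lambert in \<open>auto simp: c_def\<close>)
    qed
    have "z * (\<Sum>n. diffs c n * z ^ n) = (\<Sum>n. z * (diffs c n * z ^ n))"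
      by (rule suminf_mult[OF s, symmetric])
    also have "\<dots> = (\<Sum>n. of_nat (Suc n) ^ Suc k / (1 - q ^ Suc n) * z ^ Suc n)"
      by (simp add: diffs_def c_def mult_ac del: of_nat_Suc)
    also have "\<dots> = lambert q (Suc k) z - of_nat 0 ^ Suc k / (1 - q ^ 0) * z ^ 0"
      unfolding lambert_def by (rule suminf_split_head) (rule summable_lambert[OF assms(1)])
    finally show ?thesis by simp
  qed
  then have "(\<Sum>n. diffs c n * z ^ n) = lambert q (Suc k) z / z"
    using assms(2) by (metis nonzero_mult_div_cancel_left)
  ultimately show ?thesis
    by (simp add: lambert_def[abs_def] c_def)
qed

lemma DERIV_lambert' [derivative_intros]:
  assumes "(f has_field_derivative f') (at z within A)" "norm (f z) < 1" "f z \<noteq> 0"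
  shows "((\<lambda>x. lambert q k (f x)) has_field_derivative lambert q (Suc k) (f z) / f z * f') (at z within A)"
  using DERIV_chain2[OF DERIV_lambert[OF assms(2,3)] assms(1)] .

text \<open>Subtraction multiplies the n-th term by \<open>1 - q ^ n\<close> and so cancels the
  Lambert denominator, leaving the series of \<open>n * z ^ n\<close>.\<close>

lemma lambert_minus_lambert_mult:
  assumes "norm z < 1"
  shows "lambert q 1 z - lambert q 1 (q * z) = z / (1 - z)\<^sup>2"
proof -
  have "norm q * norm z \<le> 1 * norm z" using q1 by (intro mult_right_mono) auto
  then have qz: "norm (q * z) < 1" using assms by (simp add: norm_mult)
  have "(\<lambda>n. of_nat n / (1 - q ^ n) * z ^ n - of_nat n / (1 - q ^ n) * (q * z) ^ n) sums (lambert q 1 z - lambert q 1 (q * z))"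
    unfolding lambert_def power_one_right using summable_lambert[OF assms, of 1] summable_lambert[OF qz, of 1]
    by (intro sums_diff summable_sums) auto
  also have "(\<lambda>n. of_nat n / (1 - q ^ n) * z ^ n - of_nat n / (1 - q ^ n) * (q * z) ^ n) = (\<lambda>n. of_nat n * z ^ n)"
  proof
    fix n :: nat
    have "c * x - c * (y * x) = c * (1 - y) * x" for c x y :: complex by (simp add: algebra_simps)
    then have "of_nat n / (1 - q ^ n) * z ^ n - of_nat n / (1 - q ^ n) * (q * z) ^ n = of_nat n / (1 - q ^ n) * (1 - q ^ n) * z ^ n"
      unfolding power_mult_distrib .
    then show "of_nat n / (1 - q ^ n) * z ^ n - of_nat n / (1 - q ^ n) * (q * z) ^ n = of_nat n * z ^ n"
      using one_minus_power_ne_0[of n] by (cases "n = 0") auto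
  qed
  finally have 1: "(\<lambda>n. of_nat n * z ^ n) sums (lambert q 1 z - lambert q 1 (q * z))" .
  have "(\<lambda>n. z * (of_nat (Suc n) * z ^ n)) sums (z * (1 / (1 - z)\<^sup>2))"
    by (intro sums_mult geometric_deriv_sums assms)
  then have "(\<lambda>n. of_nat (Suc n) * z ^ Suc n) sums (z / (1 - z)\<^sup>2)" by (simp add: mult_ac)
  then have "(\<lambda>n. of_nat n * z ^ n) sums (z / (1 - z)\<^sup>2)" by (subst (asm) sums_Suc_iff) simp
  then show ?thesis using 1 sums_unique2 by blast
qed

lemma annulusD: "z \<in> annulus q \<Longrightarrow> z \<noteq> 0 \<and> norm (q * z) < 1 \<and> norm (q / z) < 1"
  using norm_ge_zero[of q] by (auto simp: annulus_def norm_divide divide_less_eq)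

lemma inner_annulusD:
  assumes "norm q < norm z" "norm z < 1"
  shows "z \<in> annulus q" "z \<noteq> 1" "z \<noteq> 0" "norm z < 1" "norm (q / z) < 1"
proof -
  show "z \<noteq> 1" "z \<noteq> 0" "norm z < 1" using assms by auto
  have "norm q * norm z \<le> 1 * norm z" using q1 by (intro mult_right_mono) auto
  then show "z \<in> annulus q" using assms by (auto simp: annulus_def norm_mult)
  then show "norm (q / z) < 1" using annulusD by blast
qed

lemma DERIV_wp0:
  assumes z: "z \<in> annulus q" "z \<noteq> 1"
  shows "(wp0 q has_field_derivative wp1 q z / z) (at z)"
proof -
  have "((\<lambda>z. z / (1 - z)\<^sup>2) has_field_derivative (1 + z) / (1 - z) ^ 3) (at z)"
  proof -
    have "((\<lambda>z. z / (1 - z)\<^sup>2) has_field_derivative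
        (1 * (1 - z)\<^sup>2 - z * (of_nat 2 * ((0 - 1) * (1 - z) ^ (2 - Suc 0)))) / ((1 - z)\<^sup>2 * (1 - z)\<^sup>2)) (at z)"
      using z by (intro DERIV_divide DERIV_power DERIV_diff DERIV_ident DERIV_const) auto
    moreover have "(1 * (1 - z)\<^sup>2 - z * (of_nat 2 * ((0 - 1) * (1 - z) ^ (2 - Suc 0)))) = (1 - z) * (1 + z)"
      by (simp add: algebra_simps power2_eq_square)
    moreover have "(1 - z)\<^sup>2 * (1 - z)\<^sup>2 = (1 - z) * (1 - z) ^ 3" by (simp add: numeral_eq_Suc)
    ultimately show ?thesis using z by simp
  qed
  moreover have "((\<lambda>z. lambert q 1 (q * z) + lambert q 1 (q / z)) has_field_derivative
      (lambert q 2 (q * z) - lambert q 2 (q / z)) / z) (at z)"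
    using annulusD[OF z(1)] q0
    by (auto intro!: derivative_eq_intros simp: numeral_2_eq_2 field_simps)
  ultimately have "((\<lambda>z. z / (1 - z)\<^sup>2 + (lambert q 1 (q * z) + lambert q 1 (q / z))) has_field_derivative
     (1 + z) / (1 - z) ^ 3 + (lambert q 2 (q * z) - lambert q 2 (q / z)) / z) (at z)"
    by (rule DERIV_add)
  moreover have "(1 + z) / (1 - z) ^ 3 + (lambert q 2 (q * z) - lambert q 2 (q / z)) / z = wp1 q z / z"
    using annulusD[OF z(1)] by (simp add: wp1_def add_divide_distrib diff_divide_distrib)
  ultimately show ?thesis by (simp add: wp0_def[abs_def] add.assoc)
qed

lemma DERIV_wp1:
  assumes z: "z \<in> annulus q" "z \<noteq> 1"
  shows "(wp1 q has_field_derivative wp2 q z / z) (at z)"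
proof -
  have "((\<lambda>z. z * (1 + z) / (1 - z) ^ 3) has_field_derivative (1 + 4 * z + z\<^sup>2) / (1 - z) ^ 4) (at z)"
  proof -
    have "((\<lambda>z. z * (1 + z) / (1 - z) ^ 3) has_field_derivative
      ((1 * (1 + z) + (0 + 1) * z) * (1 - z) ^ 3 - z * (1 + z) * (of_nat 3 * ((0 - 1) * (1 - z) ^ (3 - Suc 0))))
        / ((1 - z) ^ 3 * (1 - z) ^ 3)) (at z)"
      using z by (intro DERIV_divide DERIV_mult DERIV_add DERIV_power DERIV_diff DERIV_ident DERIV_const) auto
    moreover have "(1 * (1 + z) + (0 + 1) * z) * (1 - z) ^ 3 - z * (1 + z) * (of_nat 3 * ((0 - 1) * (1 - z) ^ (3 - Suc 0)))
       = (1 - z)\<^sup>2 * (1 + 4 * z + z\<^sup>2)"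
      by (simp add: algebra_simps power2_eq_square power3_eq_cube)
    moreover have "(1 - z) ^ 3 * (1 - z) ^ 3 = (1 - z)\<^sup>2 * (1 - z) ^ 4"
      by (simp only: power_add[symmetric]) simp
    moreover have "((1 - z)\<^sup>2 * (1 + 4 * z + z\<^sup>2)) / ((1 - z)\<^sup>2 * (1 - z) ^ 4) = (1 + 4 * z + z\<^sup>2) / (1 - z) ^ 4"
      by (rule mult_divide_mult_cancel_left) (use z in simp)
    ultimately show ?thesis by (simp only:)
  qed
  moreover have "((\<lambda>z. lambert q 2 (q * z) - lambert q 2 (q / z)) has_field_derivative
      (lambert q 3 (q * z) + lambert q 3 (q / z)) / z) (at z)"
    using annulusD[OF z(1)] q0
    by (auto intro!: derivative_eq_intros simp: numeral_3_eq_3 numeral_2_eq_2 field_simps)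
  ultimately have "((\<lambda>z. z * (1 + z) / (1 - z) ^ 3 + (lambert q 2 (q * z) - lambert q 2 (q / z))) has_field_derivative
     (1 + 4 * z + z\<^sup>2) / (1 - z) ^ 4 + (lambert q 3 (q * z) + lambert q 3 (q / z)) / z) (at z)"
    by (rule DERIV_add)
  moreover have "(1 + 4 * z + z\<^sup>2) / (1 - z) ^ 4 + (lambert q 3 (q * z) + lambert q 3 (q / z)) / z = wp2 q z / z"
    using annulusD[OF z(1)] by (simp add: wp2_def add_divide_distrib)
  ultimately show ?thesis by (simp add: wp1_def[abs_def] add_diff_eq)
qed

text \<open>Inside the unit disc the rational term is absorbed into the first Lambert series. For
  \<open>wp0\<close> this is \<open>lambert_minus_lambert_mult\<close>; the other two follow because
  the derivatives of equal functions agree.\<close>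

lemma wp_eq_lambert:
  assumes "norm q < norm z" "norm z < 1"
  shows "wp0 q z = lambert q 1 z + lambert q 1 (q / z)"
    and "wp1 q z = lambert q 2 z - lambert q 2 (q / z)"
    and "wp2 q z = lambert q 3 z + lambert q 3 (q / z)"
proof -
  define R where "R = {z :: complex. norm q < norm z \<and> norm z < 1}"
  have oR: "open R" unfolding R_def
    by (intro open_Collect_conj open_Collect_less continuous_intros)
  have RA: "z \<in> annulus q" "z \<noteq> 1" "z \<noteq> 0" "norm z < 1" "norm (q / z) < 1" if "z \<in> R" for z :: complex
    using inner_annulusD[of z] that by (auto simp: R_def)
  have 0: "wp0 q z = lambert q 1 z + lambert q 1 (q / z)" if "z \<in> R" for z :: complex
    using lambert_minus_lambert_mult[of z] RA[OF that] by (simp add: wp0_def algebra_simps)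
  have 1: "wp1 q z = lambert q 2 z - lambert q 2 (q / z)" if z: "z \<in> R" for z :: complex
  proof -
    have "(wp0 q has_field_derivative (lambert q 2 z - lambert q 2 (q / z)) / z) (at z)"
    proof (rule has_field_derivative_transform_within_open[OF _ oR z])
      show "((\<lambda>z. lambert q 1 z + lambert q 1 (q / z)) has_field_derivative (lambert q 2 z - lambert q 2 (q / z)) / z) (at z)"
        using RA[OF z] q0 by (auto intro!: derivative_eq_intros simp: numeral_2_eq_2 field_simps)
    qed (simp add: 0)
    from DERIV_unique[OF this DERIV_wp0] show ?thesis using RA[OF z] by simp
  qed
  have 2: "wp2 q z = lambert q 3 z + lambert q 3 (q / z)" if z: "z \<in> R" for z :: complex
  proof -
    have "(wp1 q has_field_derivative (lambert q 3 z + lambert q 3 (q / z)) / z) (at z)"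
    proof (rule has_field_derivative_transform_within_open[OF _ oR z])
      show "((\<lambda>z. lambert q 2 z - lambert q 2 (q / z)) has_field_derivative (lambert q 3 z + lambert q 3 (q / z)) / z) (at z)"
        using RA[OF z] q0 by (auto intro!: derivative_eq_intros simp: numeral_3_eq_3 numeral_2_eq_2 field_simps)
    qed (simp add: 1)
    from DERIV_unique[OF this DERIV_wp1] show ?thesis using RA[OF z] by simp
  qed
  have "z \<in> R" using assms by (simp add: R_def)
  then show "wp0 q z = lambert q 1 z + lambert q 1 (q / z)" "wp1 q z = lambert q 2 z - lambert q 2 (q / z)"
     "wp2 q z = lambert q 3 z + lambert q 3 (q / z)" using 0 1 2 by auto
qed

lemma wp_inverse:
  assumes "z \<noteq> 0"
  shows "wp0 q (1 / z) = wp0 q z" "wp1 q (1 / z) = - wp1 q z" "wp2 q (1 / z) = wp2 q z"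
proof -
  have e: "1 - 1 / z = - (1 - z) / z" using assms by (simp add: field_simps)
  \<comment> \<open>\<open>D\<close> stands for \<open>1 - z\<close>. The case \<open>D = 0\<close>
    is the pole itself, where division by zero makes both sides 0.\<close>
  have r2: "1 / z / (- D / z)\<^sup>2 = z / D\<^sup>2" for D
    using assms by (cases "D = 0") (simp_all add: field_simps power2_eq_square)
  have r3: "1 / z * (1 + 1 / z) / (- D / z) ^ 3 = - (z * (1 + z) / D ^ 3)" for D
    using assms by (cases "D = 0") (simp_all add: field_simps power3_eq_cube)
  have r4: "1 / z * (1 + 4 * (1 / z) + (1 / z)\<^sup>2) / (- D / z) ^ 4 = z * (1 + 4 * z + z\<^sup>2) / D ^ 4" for D
    using assms by (cases "D = 0") (simp_all add: field_simps power2_eq_square power4_eq_xxxx)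
  have "1 / z / (1 - 1 / z)\<^sup>2 = z / (1 - z)\<^sup>2"
    unfolding e by (rule r2)
  then show "wp0 q (1 / z) = wp0 q z" by (simp add: wp0_def)
  have "1 / z * (1 + 1 / z) / (1 - 1 / z) ^ 3 = - (z * (1 + z) / (1 - z) ^ 3)"
    unfolding e by (rule r3)
  then show "wp1 q (1 / z) = - wp1 q z" by (simp add: wp1_def)
  have "1 / z * (1 + 4 * (1 / z) + (1 / z)\<^sup>2) / (1 - 1 / z) ^ 4 = z * (1 + 4 * z + z\<^sup>2) / (1 - z) ^ 4"
    unfolding e by (rule r4)
  then show "wp2 q (1 / z) = wp2 q z" by (simp add: wp2_def)
qed

text \<open>Both \<open>q * z\<close> and \<open>1 / z\<close> lie in the inner half of the annulus,
  where the Lambert forms of the two values consist of the same two series in exchanged roles;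
  \<open>wp_inverse\<close> then returns from \<open>1 / z\<close> to \<open>z\<close>.\<close>

lemma wp_periodic:
  assumes z: "1 < norm z" "norm (q * z) < 1"
  shows "wp0 q (q * z) = wp0 q z" "wp1 q (q * z) = wp1 q z" "wp2 q (q * z) = wp2 q z"
proof -
  have z0: "z \<noteq> 0" using z by auto
  have 1: "norm q < norm (q * z)" using z q0 by (simp add: norm_mult)
  have 2: "norm q < norm (1 / z)" "norm (1 / z) < 1" using z by (auto simp: norm_divide norm_mult less_divide_eq divide_less_eq)
  show "wp0 q (q * z) = wp0 q z" "wp2 q (q * z) = wp2 q z"
    using wp_eq_lambert[OF 1 z(2)] wp_eq_lambert[OF 2] wp_inverse[OF z0] z0 q0 by auto
  have "wp1 q z = - (lambert q 2 (1 / z) - lambert q 2 (q / (1 / z)))"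
    using wp_eq_lambert(2)[OF 2] wp_inverse(2)[OF z0] by (metis minus_minus)
  then show "wp1 q (q * z) = wp1 q z"
    using wp_eq_lambert(2)[OF 1 z(2)] z0 q0 by simp
qed

end

section \<open>Laurent expansions at the pole\<close>

lemma taylor_remainder_holomorphic:
  fixes F :: "nat \<Rightarrow> complex \<Rightarrow> complex"
  assumes r: "r > 0"
    and der: "\<And>k u. u \<in> ball 0 r \<Longrightarrow> (F k has_field_derivative F (Suc k) u) (at u)"
  obtains g where "g holomorphic_on ball 0 r"
    "\<And>u. u \<in> ball 0 r \<Longrightarrow> F 0 u = (\<Sum>k<n. F k 0 / fact k * u ^ k) + u ^ n * g u"
proof -
  have hd: "(deriv ^^ k) (F 0) u = F k u" if "u \<in> ball 0 r" for k u
    using that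
  proof (induction k arbitrary: u)
    case (Suc k)
    have "((deriv ^^ k) (F 0) has_field_derivative F (Suc k) u) (at u)"
      by (rule has_field_derivative_transform_within_open[OF der[OF Suc.prems] open_ball Suc.prems])
         (simp add: Suc.IH)
    then show ?case by (simp add: DERIV_imp_deriv)
  qed simp
  define c where "c = (\<lambda>k. F k 0 / fact k)"
  have hol: "F 0 holomorphic_on ball 0 r"
    using der unfolding holomorphic_on_open[OF open_ball] by blast
  have s: "(\<lambda>k. c k * u ^ k) sums F 0 u" if "u \<in> ball 0 r" for u
    using holomorphic_power_series[OF hol that] r by (simp add: hd c_def)
  \<comment> \<open>The tail of the power series divided by \<open>u ^ n\<close>. As a power series
    it is holomorphic at 0 as well, so remainders can be differentiated and evaluated there.\<close>
  define g where "g = (\<lambda>u. \<Sum>k. c (k + n) * u ^ k)"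
  have sg: "(\<lambda>k. c (k + n) * u ^ k) sums g u" if u: "u \<in> ball 0 r" for u
  proof (cases "u = 0")
    case True
    then show ?thesis unfolding g_def using summable_sums[OF sums_summable[OF powser_sums_zero]] by simp
  next
    case False
    have "(\<lambda>k. c (k + n) * u ^ (k + n)) sums (F 0 u - (\<Sum>k<n. c k * u ^ k))"
      using s[OF u] by (rule sums_split_initial_segment)
    from sums_divide[OF this, of "u ^ n"] have "summable (\<lambda>k. c (k + n) * u ^ k)"
      using False by (simp add: power_add sums_iff)
    then show ?thesis unfolding g_def by (rule summable_sums)
  qed
  have "F 0 u = (\<Sum>k<n. F k 0 / fact k * u ^ k) + u ^ n * g u" if u: "u \<in> ball 0 r" for u
  proof -
    have "(\<lambda>k. c (k + n) * u ^ (k + n)) sums (u ^ n * g u)"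
      using sums_mult[OF sg[OF u], of "u ^ n"] by (simp add: power_add mult_ac)
    moreover have "(\<lambda>k. c (k + n) * u ^ (k + n)) sums (F 0 u - (\<Sum>k<n. c k * u ^ k))"
      using s[OF u] by (rule sums_split_initial_segment)
    ultimately have "u ^ n * g u = F 0 u - (\<Sum>k<n. c k * u ^ k)" by (rule sums_unique2)
    then show ?thesis by (simp add: c_def)
  qed
  moreover have "g holomorphic_on ball 0 r"
    by (rule power_series_holomorphic[where a = "\<lambda>k. c (k + n)"]) (use sg in simp)
  ultimately show ?thesis using that by blast
qed

lemma even_quadratic_remainder:
  fixes f :: "complex \<Rightarrow> complex"
  assumes "r > 0" "f holomorphic_on ball 0 r" and ev: "\<And>u. u \<in> ball 0 r \<Longrightarrow> f (- u) = f u"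
  obtains g where "g holomorphic_on ball 0 r" "\<And>u. u \<in> ball 0 r \<Longrightarrow> f u = f 0 + u\<^sup>2 * g u"
proof -
  have hk: "(deriv ^^ k) f holomorphic_on ball 0 r" for k
    by (rule holomorphic_higher_deriv[OF assms(2)]) simp
  obtain g where g: "g holomorphic_on ball 0 r"
    "\<And>u. u \<in> ball 0 r \<Longrightarrow> (deriv ^^ 0) f u = (\<Sum>k<2. (deriv ^^ k) f 0 / fact k * u ^ k) + u ^ 2 * g u"
    by (rule taylor_remainder_holomorphic[OF assms(1), of "\<lambda>k. (deriv ^^ k) f" 2])
       (use holomorphic_derivI[OF hk open_ball] in auto)
  have d: "(f has_field_derivative deriv f 0) (at 0)"
    using holomorphic_derivI[OF assms(2) open_ball] assms(1) by simp
  then have "((\<lambda>u. f (- u)) has_field_derivative deriv f 0 * (- 1)) (at 0)"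
    by (intro DERIV_chain2[of f _ uminus]) (auto intro!: derivative_eq_intros)
  then have "(f has_field_derivative deriv f 0 * (- 1)) (at 0)"
    by (rule has_field_derivative_transform_within_open[where S = "ball 0 r"]) (use ev assms(1) in auto)
  with d have "deriv f 0 = deriv f 0 * (- 1)" by (rule DERIV_unique)
  then have "deriv f 0 = 0" by simp
  then have "f u = f 0 + u\<^sup>2 * g u" if "u \<in> ball 0 r" for u
    using g(2)[OF that] by (simp add: numeral_2_eq_2)
  with g(1) show ?thesis using that by blast
qed

lemma tendsto_at_0_if_eq_near:
  fixes f g :: "complex \<Rightarrow> complex"
  assumes "\<delta> > 0" "\<And>u. u \<in> ball 0 \<delta> \<Longrightarrow> u \<noteq> 0 \<Longrightarrow> f u = g u" "isCont g 0" "g 0 = L"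
  shows "(f \<longlongrightarrow> L) (at 0)"
proof -
  have "eventually (\<lambda>u. u \<in> ball 0 \<delta> - {0}) (at (0::complex))"
    using assms(1) by (intro eventually_at_in_open) auto
  then have "eventually (\<lambda>u. g u = f u) (at 0)"
    by eventually_elim (use assms(2) in auto)
  moreover have "(g \<longlongrightarrow> L) (at 0)" using assms(3,4) by (simp add: isCont_def)
  ultimately show ?thesis using Lim_transform_eventually by blast
qed

lemma exp_div_square_laurent:
  obtains s where "s holomorphic_on ball 0 1"
    "\<And>u. u \<in> ball 0 1 \<Longrightarrow> u \<noteq> 0 \<Longrightarrow>
       exp u / (1 - exp u)\<^sup>2 = 1 / u\<^sup>2 - 1 / 12 + u\<^sup>2 / 240 - u ^ 4 / 6048 + u ^ 5 * s u"
proof -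
  \<comment> \<open>The k-th derivative of exp u + exp (-u) - 2, whose reciprocal is the function to
    be expanded.\<close>
  define G :: "nat \<Rightarrow> complex \<Rightarrow> complex" where
    "G = (\<lambda>k u. exp u + (- 1) ^ k * exp (- u) - (if k = 0 then 2 else 0))"
  have der: "(G k has_field_derivative G (Suc k) u) (at u)" for k u
    unfolding G_def by (auto intro!: derivative_eq_intros)
  obtain g where g: "g holomorphic_on ball 0 1"
    "\<And>u. u \<in> ball 0 1 \<Longrightarrow> G 0 u = (\<Sum>k<9. G k 0 / fact k * u ^ k) + u ^ 9 * g u"
    using taylor_remainder_holomorphic[of 1 G 9] der by auto
  \<comment> \<open>The coefficients are 2/4!, 2/6! and 2/8!. \<open>T\<close> in the next line is
    the reciprocal power series of \<open>E\<close>, truncated after the sixth power.\<close>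
  define E where "E = (\<lambda>u. 1 + u\<^sup>2 / 12 + u ^ 4 / 360 + u ^ 6 / 20160 + u ^ 7 * g u)"
  define T :: "complex \<Rightarrow> complex" where "T = (\<lambda>u. 1 - u\<^sup>2 / 12 + u ^ 4 / 240 - u ^ 6 / 6048)"
  have D: "exp u + exp (- u) - 2 = u\<^sup>2 * E u" if "u \<in> ball 0 1" for u
  proof -
    have "(\<Sum>k<9. G k 0 / fact k * u ^ k) = u\<^sup>2 + u ^ 4 / 12 + u ^ 6 / 360 + u ^ 8 / 20160"
      by (simp add: G_def eval_nat_numeral fact_numeral)
    then show ?thesis using g(2)[OF that] unfolding E_def G_def
      by (simp add: algebra_simps flip: power_add)
  qed
  have sq: "(1 - exp u)\<^sup>2 = exp u * (exp u + exp (- u) - 2)" for u :: complex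
    by (simp add: algebra_simps power2_eq_square exp_minus_inverse)
  have E0: "E u \<noteq> 0" if "u \<in> ball 0 1" for u
  proof (cases "u = 0")
    case False
    then have "(1 - exp u)\<^sup>2 \<noteq> 0" using exp_ne_1_small[of u] that by auto
    then show ?thesis unfolding sq D[OF that] by auto
  qed (simp add: E_def)
  \<comment> \<open>By the choice of \<open>T\<close>, the powers below the seventh cancel in
    \<open>1 - E u * T u\<close>; \<open>h\<close> collects what remains.\<close>
  define h where "h = (\<lambda>u. - ((1/12 * (-1/6048) + 1/360 * (1/240) + 1/20160 * (-1/12)) * u
      + (1/360 * (-1/6048) + 1/20160 * (1/240)) * u ^ 3 + (1/20160 * (-1/6048)) * u ^ 5) - g u * T u)"
  have h: "1 - E u * T u = u ^ 7 * h u" for u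
    unfolding E_def T_def h_def by (simp add: field_simps power_numeral_reduce)
  show ?thesis
  proof
    show "(\<lambda>u. h u / E u) holomorphic_on ball 0 1"
      using E0 g(1) unfolding h_def E_def T_def by (intro holomorphic_intros) auto
    fix u :: complex assume u: "u \<in> ball 0 1" "u \<noteq> 0"
    have "exp u / (1 - exp u)\<^sup>2 = 1 / (u\<^sup>2 * E u)"
      unfolding sq D[OF u(1)] by simp
    also have "\<dots> = (T u + u ^ 7 * (h u / E u)) / u\<^sup>2"
    proof -
      have "T u + u ^ 7 * (h u / E u) = T u + (1 - E u * T u) / E u" unfolding h by simp
      also have "\<dots> = 1 / E u" using E0[OF u(1)] by (simp add: field_simps)
      finally show ?thesis by simp
    qed
    also have "\<dots> = 1 / u\<^sup>2 - 1 / 12 + u\<^sup>2 / 240 - u ^ 4 / 6048 + u ^ 5 * (h u / E u)"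
    proof -
      have "(T u + u ^ 7 * x) / u\<^sup>2 = 1 / u\<^sup>2 - 1 / 12 + u\<^sup>2 / 240 - u ^ 4 / 6048 + u ^ 5 * x" for x
        unfolding T_def using u by (simp add: field_simps power_numeral_reduce)
      then show ?thesis .
    qed
    finally show "exp u / (1 - exp u)\<^sup>2 = 1 / u\<^sup>2 - 1 / 12 + u\<^sup>2 / 240 - u ^ 4 / 6048 + u ^ 5 * (h u / E u)" .
  qed
qed

context punctured_disc
begin

lemma wp0_laurent:
  obtains \<delta> r where "0 < \<delta>" "\<delta> \<le> 1" "\<And>u :: complex. u \<in> ball 0 \<delta> \<Longrightarrow> exp u \<in> annulus q"
    "r holomorphic_on ball 0 \<delta>"
    "\<And>u :: complex. u \<in> ball 0 \<delta> \<Longrightarrow> u \<noteq> 0 \<Longrightarrow> wp0 q (exp u) = 1 / u\<^sup>2 + (2 * lambert q 1 q - 1 / 12)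
        + (1 / 240 + lambert q 3 q) * u\<^sup>2 + (lambert q 5 q / 12 - 1 / 6048) * u ^ 4 + u ^ 5 * r u"
proof -
  define \<delta> where "\<delta> = min 1 (- ln (norm q))"
  have d: "0 < \<delta>" "\<delta> \<le> 1" using q0 q1 by (auto simp: \<delta>_def)
  have ann: "exp u \<in> annulus q" if "u \<in> ball 0 \<delta>" for u
    unfolding exp_in_annulus_iff[OF q0] using that abs_Re_le_cmod[of u] by (auto simp: \<delta>_def)
  have n: "norm (q * exp u) < 1" if "u \<in> ball 0 \<delta>" for u
    using annulusD[OF ann[OF that]] by simp
  \<comment> \<open>The k-th derivative in \<open>u\<close> of the two Lambert series of
    \<open>wp0\<close> along \<open>exp\<close>. At 0 the odd ones cancel and the even ones
    double.\<close>
  define F where "F = (\<lambda>k u. lambert q (Suc k) (q * exp u) + (- 1) ^ k * lambert q (Suc k) (q * exp (- u)))"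
  have "(F k has_field_derivative F (Suc k) u) (at u)" if "u \<in> ball 0 \<delta>" for k u
    unfolding F_def using n[OF that] n[of "- u"] that q0
    by (auto intro!: derivative_eq_intros)
  then obtain g where g: "g holomorphic_on ball 0 \<delta>"
    "\<And>u. u \<in> ball 0 \<delta> \<Longrightarrow> F 0 u = (\<Sum>k<5. F k 0 / fact k * u ^ k) + u ^ 5 * g u"
    using taylor_remainder_holomorphic[of \<delta> F 5] d by auto
  obtain s where s: "s holomorphic_on ball 0 1"
    "\<And>u. u \<in> ball 0 1 \<Longrightarrow> u \<noteq> 0 \<Longrightarrow>
       exp u / (1 - exp u)\<^sup>2 = 1 / u\<^sup>2 - 1 / 12 + u\<^sup>2 / 240 - u ^ 4 / 6048 + u ^ 5 * s u"
    using exp_div_square_laurent by blast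
  show ?thesis
  proof (rule that[of \<delta> "\<lambda>u. s u + g u"])
    show "(\<lambda>u. s u + g u) holomorphic_on ball 0 \<delta>"
      using d by (intro holomorphic_intros g(1) holomorphic_on_subset[OF s(1)]) auto
    fix u :: complex assume u: "u \<in> ball 0 \<delta>" "u \<noteq> 0"
    have "(\<Sum>k<5. F k 0 / fact k * u ^ k) = 2 * lambert q 1 q + lambert q 3 q * u\<^sup>2 + lambert q 5 q / 12 * u ^ 4"
      by (simp add: F_def eval_nat_numeral fact_numeral)
    then have "F 0 u = 2 * lambert q 1 q + lambert q 3 q * u\<^sup>2 + lambert q 5 q / 12 * u ^ 4 + u ^ 5 * g u"
      using g(2)[OF u(1)] by simp
    moreover have "wp0 q (exp u) = exp u / (1 - exp u)\<^sup>2 + F 0 u"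
      by (simp add: wp0_def F_def exp_minus divide_inverse)
    moreover have "u \<in> ball 0 1" using u d by auto
    ultimately show "wp0 q (exp u) = 1 / u\<^sup>2 + (2 * lambert q 1 q - 1 / 12)
        + (1 / 240 + lambert q 3 q) * u\<^sup>2 + (lambert q 5 q / 12 - 1 / 6048) * u ^ 4 + u ^ 5 * (s u + g u)"
      using s(2)[of u] u by (simp add: algebra_simps)
  qed (use d ann in auto)
qed

text \<open>These are the series that appear in the Laurent coefficients of
  \<open>wp0_laurent\<close>: \<open>1 / 240 + lambert q 3 q\<close> is \<open>E4 / 240\<close> and
  \<open>lambert q 5 q / 12 - 1 / 6048\<close> is \<open>- E6 / 6048\<close>. The link to
  \<open>eisenstein_E\<close> through zeta values is made separately.\<close>

definition E4 :: complex where "E4 = 1 + 240 * lambert q 3 q"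
definition E6 :: complex where "E6 = 1 - 504 * lambert q 5 q"
text \<open>The additive constant removes the constant Laurent coefficient in \<open>u\<close> = log
  z, the usual normalization of the Weierstrass function.\<close>

definition P :: "complex \<Rightarrow> complex" where "P z = wp0 q z + 1 / 12 - 2 * lambert q 1 q"

lemma DERIV_P: "z \<in> annulus q \<Longrightarrow> z \<noteq> 1 \<Longrightarrow> (P has_field_derivative wp1 q z / z) (at z)"
  unfolding P_def[abs_def] by (auto intro!: derivative_eq_intros DERIV_wp0)

lemma holomorphic_P: "P holomorphic_on annulus q - {1}"
  and holomorphic_wp1: "wp1 q holomorphic_on annulus q - {1}"
  and holomorphic_wp2: "wp2 q holomorphic_on annulus q - {1}"
proof -
  have o: "open (annulus q - {1})" using open_annulus by (intro open_Diff) auto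
  show "P holomorphic_on annulus q - {1}" "wp1 q holomorphic_on annulus q - {1}"
    using DERIV_P DERIV_wp1 by (auto simp: holomorphic_on_open[OF o])
  have "(\<lambda>z. lambert q 3 (q * z)) field_differentiable (at z)" "(\<lambda>z. lambert q 3 (q / z)) field_differentiable (at z)"
    if "z \<in> annulus q" for z
    unfolding field_differentiable_def using annulusD[OF that] q0
    by (auto intro!: derivative_eq_intros exI)
  then show "wp2 q holomorphic_on annulus q - {1}"
    unfolding wp2_def[abs_def]
    by (intro holomorphic_intros) (auto simp: holomorphic_on_def field_differentiable_at_within)
qed

text \<open>The second and third expansions are the first one differentiated in \<open>u\<close>,
  with \<open>r'\<close> and \<open>r''\<close> the derivatives of \<open>r\<close>. Continuity of
  the three at 0 is all that the limits below ask for.\<close>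

lemma P_laurent:
  obtains \<delta> r r' r'' where "0 < \<delta>"
    "isCont r 0" "isCont r' 0" "isCont r'' 0"
    "\<And>u. u \<in> ball 0 \<delta> \<Longrightarrow> u \<noteq> 0 \<Longrightarrow> P (exp u) = 1 / u\<^sup>2 + E4 / 240 * u\<^sup>2 - E6 / 6048 * u ^ 4 + u ^ 5 * r u"
    "\<And>u. u \<in> ball 0 \<delta> \<Longrightarrow> u \<noteq> 0 \<Longrightarrow> wp1 q (exp u) =
        - 2 / u ^ 3 + E4 / 120 * u - E6 / 1512 * u ^ 3 + 5 * u ^ 4 * r u + u ^ 5 * r' u"
    "\<And>u. u \<in> ball 0 \<delta> \<Longrightarrow> u \<noteq> 0 \<Longrightarrow> wp2 q (exp u) =
        6 / u ^ 4 + E4 / 120 - E6 / 504 * u\<^sup>2 + 20 * u ^ 3 * r u + 10 * u ^ 4 * r' u + u ^ 5 * r'' u"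
proof -
  obtain \<delta> r where d: "0 < \<delta>" "\<delta> \<le> 1" and ann: "\<And>u. u \<in> ball 0 \<delta> \<Longrightarrow> exp u \<in> annulus q"
    and r: "r holomorphic_on ball 0 \<delta>"
    and e: "\<And>u. u \<in> ball 0 \<delta> \<Longrightarrow> u \<noteq> 0 \<Longrightarrow> wp0 q (exp u) = 1 / u\<^sup>2 + (2 * lambert q 1 q - 1 / 12)
        + (1 / 240 + lambert q 3 q) * u\<^sup>2 + (lambert q 5 q / 12 - 1 / 6048) * u ^ 4 + u ^ 5 * r u"
    using wp0_laurent by metis
  define B where "B = ball (0::complex) \<delta> - {0}"
  have oB: "open B" unfolding B_def by (intro open_Diff) auto
  have ne: "exp u \<noteq> 1" if "u \<in> B" for u using exp_ne_1_small[of u] that d by (auto simp: B_def)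
  have annB: "exp u \<in> annulus q" if "u \<in> B" for u using ann that by (auto simp: B_def)
  have r': "deriv r holomorphic_on ball 0 \<delta>" by (rule holomorphic_deriv[OF r]) simp
  have r'': "deriv (deriv r) holomorphic_on ball 0 \<delta>" by (rule holomorphic_deriv[OF r']) simp
  have dr: "(r has_field_derivative deriv r u) (at u)" "(deriv r has_field_derivative deriv (deriv r) u) (at u)"
    if "u \<in> B" for u
    using that holomorphic_derivI[OF r] holomorphic_derivI[OF r'] by (auto simp: B_def)
  have 0: "P (exp u) = 1 / u\<^sup>2 + E4 / 240 * u\<^sup>2 - E6 / 6048 * u ^ 4 + u ^ 5 * r u" if "u \<in> B" for u
    using e[of u] that by (simp add: P_def E4_def E6_def B_def field_simps)
  have 1: "wp1 q (exp u) = - 2 / u ^ 3 + E4 / 120 * u - E6 / 1512 * u ^ 3 + 5 * u ^ 4 * r u + u ^ 5 * deriv r u"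
    if u: "u \<in> B" for u
  proof -
    have u0: "u \<noteq> 0" using u by (simp add: B_def)
    have i: "((\<lambda>u. 1 / u\<^sup>2) has_field_derivative - 2 / u ^ 3) (at u)"
      using u0 by (auto intro!: derivative_eq_intros simp: field_simps power_numeral_reduce)
    have "((\<lambda>u. P (exp u)) has_field_derivative (- 2 / u ^ 3 + E4 / 240 * (2 * u) - E6 / 6048 * (4 * u ^ 3)
        + (5 * u ^ 4 * r u + u ^ 5 * deriv r u))) (at u)"
    proof (rule has_field_derivative_transform_within_open[OF _ oB u])
      show "((\<lambda>u. 1 / u\<^sup>2 + E4 / 240 * u\<^sup>2 - E6 / 6048 * u ^ 4 + u ^ 5 * r u) has_field_derivative
         (- 2 / u ^ 3 + E4 / 240 * (2 * u) - E6 / 6048 * (4 * u ^ 3) + (5 * u ^ 4 * r u + u ^ 5 * deriv r u))) (at u)"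
        by (rule derivative_eq_intros i dr(1)[OF u] refl)+ simp
    qed (simp add: 0)
    moreover have "((\<lambda>u. P (exp u)) has_field_derivative wp1 q (exp u) / exp u * exp u) (at u)"
      by (rule DERIV_chain2[OF DERIV_P[OF annB[OF u] ne[OF u]] DERIV_exp])
    ultimately show ?thesis using DERIV_unique by fastforce
  qed
  have 2: "wp2 q (exp u) = 6 / u ^ 4 + E4 / 120 - E6 / 504 * u\<^sup>2 + 20 * u ^ 3 * r u + 10 * u ^ 4 * deriv r u
      + u ^ 5 * deriv (deriv r) u"
    if u: "u \<in> B" for u
  proof -
    have u0: "u \<noteq> 0" using u by (simp add: B_def)
    have i: "((\<lambda>u. - 2 / u ^ 3) has_field_derivative 6 / u ^ 4) (at u)"
      using u0 by (auto intro!: derivative_eq_intros simp: field_simps power_numeral_reduce)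
    have "((\<lambda>u. wp1 q (exp u)) has_field_derivative (6 / u ^ 4 + E4 / 120 - E6 / 1512 * (3 * u\<^sup>2)
        + (20 * u ^ 3 * r u + 5 * u ^ 4 * deriv r u) + (5 * u ^ 4 * deriv r u + u ^ 5 * deriv (deriv r) u))) (at u)"
    proof (rule has_field_derivative_transform_within_open[OF _ oB u])
      show "((\<lambda>u. - 2 / u ^ 3 + E4 / 120 * u - E6 / 1512 * u ^ 3 + 5 * u ^ 4 * r u + u ^ 5 * deriv r u) has_field_derivative
         (6 / u ^ 4 + E4 / 120 - E6 / 1512 * (3 * u\<^sup>2)
        + (20 * u ^ 3 * r u + 5 * u ^ 4 * deriv r u) + (5 * u ^ 4 * deriv r u + u ^ 5 * deriv (deriv r) u))) (at u)"
        by (rule derivative_eq_intros i dr[OF u] refl)+ simp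
    qed (simp add: 1)
    moreover have "((\<lambda>u. wp1 q (exp u)) has_field_derivative wp2 q (exp u) / exp u * exp u) (at u)"
      by (rule DERIV_chain2[OF DERIV_wp1[OF annB[OF u] ne[OF u]] DERIV_exp])
    ultimately show ?thesis using DERIV_unique by fastforce
  qed
  have c: "isCont f 0" if "f holomorphic_on ball 0 \<delta>" for f
    using holomorphic_on_imp_continuous_on[OF that] d by (simp add: continuous_on_eq_continuous_at)
  show ?thesis
    by (rule that[OF d(1) c[OF r] c[OF r'] c[OF r'']]) (use 0 1 2 in \<open>auto simp: B_def\<close>)
qed

section \<open>The differential equations of the Weierstrass function\<close>

lemma wp2_eq:
  assumes z: "z \<in> annulus q" "z \<noteq> 1"
  shows "wp2 q z = 6 * (P z)\<^sup>2 - E4 / 24"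
proof -
  have "wp2 q z - 6 * (P z)\<^sup>2 = - E4 / 24"
  proof (rule annulus_periodic_constant[where f = "\<lambda>z. wp2 q z - 6 * (P z)\<^sup>2", OF q0 q1 _ _ _ z])
    show "(\<lambda>z. wp2 q z - 6 * (P z)\<^sup>2) holomorphic_on annulus q - {1}"
      by (intro holomorphic_intros holomorphic_P holomorphic_wp2)
    show "wp2 q (q * z) - 6 * (P (q * z))\<^sup>2 = wp2 q z - 6 * (P z)\<^sup>2" if "1 < norm z" "norm (q * z) < 1" for z
      using wp_periodic[OF that] by (simp add: P_def)
    obtain \<delta> r r' r'' where d: "0 < \<delta>" and c: "isCont r 0" "isCont r' 0" "isCont r'' 0"
      and L: "\<And>u. u \<in> ball 0 \<delta> \<Longrightarrow> u \<noteq> 0 \<Longrightarrow> P (exp u) = 1 / u\<^sup>2 + E4 / 240 * u\<^sup>2 - E6 / 6048 * u ^ 4 + u ^ 5 * r u"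
        "\<And>u. u \<in> ball 0 \<delta> \<Longrightarrow> u \<noteq> 0 \<Longrightarrow> wp1 q (exp u) =
          - 2 / u ^ 3 + E4 / 120 * u - E6 / 1512 * u ^ 3 + 5 * u ^ 4 * r u + u ^ 5 * r' u"
        "\<And>u. u \<in> ball 0 \<delta> \<Longrightarrow> u \<noteq> 0 \<Longrightarrow> wp2 q (exp u) =
          6 / u ^ 4 + E4 / 120 - E6 / 504 * u\<^sup>2 + 20 * u ^ 3 * r u + 10 * u ^ 4 * r' u + u ^ 5 * r'' u"
      by (rule P_laurent) (rule that)
    show "((\<lambda>u. wp2 q (exp u) - 6 * (P (exp u))\<^sup>2) \<longlongrightarrow> - E4 / 24) (at 0)"
    proof (rule tendsto_at_0_if_eq_near[OF d])
      \<comment> \<open>What is left once \<open>6 / u ^ 4\<close> has cancelled against six times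
        the square of \<open>1 / u\<^sup>2\<close>. The constant is E4/120 from \<open>wp2\<close>
        minus 12 E4/240 from the cross term.\<close>
      let ?g = "\<lambda>u. - E4 / 24 - E6 / 504 * u\<^sup>2 + 20 * u ^ 3 * r u + 10 * u ^ 4 * r' u + u ^ 5 * r'' u
        - 12 * (- E6 / 6048 * u\<^sup>2 + u ^ 3 * r u) - 6 * (E4 / 240 * u\<^sup>2 - E6 / 6048 * u ^ 4 + u ^ 5 * r u)\<^sup>2"
      show "isCont ?g 0" by (intro continuous_intros c)
      fix u :: complex assume u: "u \<in> ball 0 \<delta>" "u \<noteq> 0"
      have "6 / u ^ 4 + A - 6 * (1 / u\<^sup>2 + u\<^sup>2 * B)\<^sup>2 = A - 12 * B - 6 * (u\<^sup>2 * B)\<^sup>2" for A B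
        using u(2) by (simp add: power2_sum power_mult_distrib field_simps power_numeral_reduce)
      note this[of "E4 / 120 - E6 / 504 * u\<^sup>2 + 20 * u ^ 3 * r u + 10 * u ^ 4 * r' u + u ^ 5 * r'' u"
         "E4 / 240 - E6 / 6048 * u\<^sup>2 + u ^ 3 * r u"]
      then show "wp2 q (exp u) - 6 * (P (exp u))\<^sup>2 = ?g u"
        unfolding L(1)[OF u] L(3)[OF u] by (simp add: algebra_simps power_numeral_reduce)
    qed simp
  qed
  then show ?thesis by (simp add: algebra_simps)
qed

lemma wp1_square_eq:
  assumes z: "z \<in> annulus q" "z \<noteq> 1"
  shows "(wp1 q z)\<^sup>2 = 4 * P z ^ 3 - E4 / 12 * P z + E6 / 216"
proof -
  have "(wp1 q z)\<^sup>2 - 4 * P z ^ 3 + E4 / 12 * P z = E6 / 216"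
  proof (rule annulus_periodic_constant[where f = "\<lambda>z. (wp1 q z)\<^sup>2 - 4 * P z ^ 3 + E4 / 12 * P z", OF q0 q1 _ _ _ z])
    show "(\<lambda>z. (wp1 q z)\<^sup>2 - 4 * P z ^ 3 + E4 / 12 * P z) holomorphic_on annulus q - {1}"
      by (intro holomorphic_intros holomorphic_P holomorphic_wp1)
    show "(wp1 q (q * z))\<^sup>2 - 4 * P (q * z) ^ 3 + E4 / 12 * P (q * z) = (wp1 q z)\<^sup>2 - 4 * P z ^ 3 + E4 / 12 * P z"
      if "1 < norm z" "norm (q * z) < 1" for z
      using wp_periodic[OF that] by (simp add: P_def)
    obtain \<delta> r r' r'' where d: "0 < \<delta>" and c: "isCont r 0" "isCont r' 0" "isCont r'' 0"
      and L: "\<And>u. u \<in> ball 0 \<delta> \<Longrightarrow> u \<noteq> 0 \<Longrightarrow> P (exp u) = 1 / u\<^sup>2 + E4 / 240 * u\<^sup>2 - E6 / 6048 * u ^ 4 + u ^ 5 * r u"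
        "\<And>u. u \<in> ball 0 \<delta> \<Longrightarrow> u \<noteq> 0 \<Longrightarrow> wp1 q (exp u) =
          - 2 / u ^ 3 + E4 / 120 * u - E6 / 1512 * u ^ 3 + 5 * u ^ 4 * r u + u ^ 5 * r' u"
        "\<And>u. u \<in> ball 0 \<delta> \<Longrightarrow> u \<noteq> 0 \<Longrightarrow> wp2 q (exp u) =
          6 / u ^ 4 + E4 / 120 - E6 / 504 * u\<^sup>2 + 20 * u ^ 3 * r u + 10 * u ^ 4 * r' u + u ^ 5 * r'' u"
      by (rule P_laurent) (rule that)
    show "((\<lambda>u. (wp1 q (exp u))\<^sup>2 - 4 * P (exp u) ^ 3 + E4 / 12 * P (exp u)) \<longlongrightarrow> E6 / 216) (at 0)"
    proof (rule tendsto_at_0_if_eq_near[OF d])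
      \<comment> \<open>\<open>a\<close> and \<open>b\<close> are the Laurent coefficients of
        \<open>P\<close> at the second and fourth power. The limit is \<open>- 28 * b\<close>, that
        is, E6/216.\<close>
      define a where "a = E4 / 240"
      define b where "b = - E6 / 6048"
      have ab: "E4 = 240 * a" "E6 = - 6048 * b" by (auto simp: a_def b_def)
      let ?e = "\<lambda>u. a * u\<^sup>2 + b * u ^ 4 + u ^ 5 * r u"
      let ?g = "\<lambda>u. - 28 * b - 32 * u * r u - 4 * u\<^sup>2 * r' u
        + (2 * a * u + 4 * b * u ^ 3 + 5 * u ^ 4 * r u + u ^ 5 * r' u)\<^sup>2
        - 12 * ?e u * (a + b * u\<^sup>2 + u ^ 3 * r u) - 4 * ?e u ^ 3 + 20 * a * ?e u"
      show "isCont ?g 0" by (intro continuous_intros c)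
      show "?g 0 = E6 / 216" by (simp add: b_def)
      fix u :: complex assume u: "u \<in> ball 0 \<delta>" "u \<noteq> 0"
      have "(- 2 / u ^ 3 + (2 * a * u + 4 * b * u ^ 3 + 5 * u ^ 4 * R + u ^ 5 * R'))\<^sup>2
          - 4 * (1 / u\<^sup>2 + (a * u\<^sup>2 + b * u ^ 4 + u ^ 5 * R)) ^ 3
          + 20 * a * (1 / u\<^sup>2 + (a * u\<^sup>2 + b * u ^ 4 + u ^ 5 * R)) =
          - 28 * b - 32 * u * R - 4 * u\<^sup>2 * R'
        + (2 * a * u + 4 * b * u ^ 3 + 5 * u ^ 4 * R + u ^ 5 * R')\<^sup>2
        - 12 * (a * u\<^sup>2 + b * u ^ 4 + u ^ 5 * R) * (a + b * u\<^sup>2 + u ^ 3 * R)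
        - 4 * (a * u\<^sup>2 + b * u ^ 4 + u ^ 5 * R) ^ 3 + 20 * a * (a * u\<^sup>2 + b * u ^ 4 + u ^ 5 * R)" for R R'
      proof -
        \<comment> \<open>Replacing \<open>1 / u\<close> by \<open>v\<close> turns the claim into a
          polynomial identity modulo \<open>u * v = 1\<close>.\<close>
        define v where "v = 1 / u"
        have v: "u * v = 1" using u by (simp add: v_def)
        then have v2: "v\<^sup>2 * u\<^sup>2 = 1" by (metis mult.commute one_power2 power_mult_distrib)
        have uv: "- 2 / u ^ 3 = - 2 * v ^ 3" "1 / u\<^sup>2 = v\<^sup>2" by (simp_all add: v_def power_one_over)
        have gen: "(- 2 * v ^ 3 + u * h)\<^sup>2 - 4 * (v\<^sup>2 + u\<^sup>2 * f) ^ 3 =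
            v\<^sup>2 * (- 4 * h - 12 * f) + (u * h)\<^sup>2 - 12 * (u\<^sup>2 * f) * f - 4 * (u\<^sup>2 * f) ^ 3" for h f
        proof -
          have "(- 2 * v ^ 3 + u * h)\<^sup>2 - 4 * (v\<^sup>2 + u\<^sup>2 * f) ^ 3 =
            - 4 * v\<^sup>2 * (u * v) * h + (u * h)\<^sup>2 - 12 * v\<^sup>2 * (u * v)\<^sup>2 * f - 12 * (u * v)\<^sup>2 * (u\<^sup>2 * f) * f
            - 4 * (u\<^sup>2 * f) ^ 3"
            by (simp add: algebra_simps power2_eq_square power3_eq_cube)
          then show ?thesis unfolding v by (simp add: algebra_simps)
        qed
        define h where "h = 2 * a + 4 * b * u\<^sup>2 + 5 * u ^ 3 * R + u ^ 4 * R'"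
        define f where "f = a + b * u\<^sup>2 + u ^ 3 * R"
        have h: "2 * a * u + 4 * b * u ^ 3 + 5 * u ^ 4 * R + u ^ 5 * R' = u * h"
          by (simp add: h_def algebra_simps power_numeral_reduce)
        have f: "a * u\<^sup>2 + b * u ^ 4 + u ^ 5 * R = u\<^sup>2 * f"
          by (simp add: f_def algebra_simps power_numeral_reduce)
        \<comment> \<open>The cancellation of the remaining double pole: the constant terms in
          \<open>a\<close> are -8, -12 and +20, so a factor \<open>u\<^sup>2\<close> splits
          off.\<close>
        have hf: "- 4 * h - 12 * f + 20 * a = u\<^sup>2 * (- 28 * b - 32 * u * R - 4 * u\<^sup>2 * R')"
          by (simp add: f_def h_def algebra_simps power_numeral_reduce)
        have "v\<^sup>2 * (- 4 * h - 12 * f) + 20 * a * v\<^sup>2 = v\<^sup>2 * (- 4 * h - 12 * f + 20 * a)"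
          by (simp add: algebra_simps)
        also have "\<dots> = v\<^sup>2 * u\<^sup>2 * (- 28 * b - 32 * u * R - 4 * u\<^sup>2 * R')"
          unfolding hf by (rule mult.assoc[symmetric])
        finally have "v\<^sup>2 * (- 4 * h - 12 * f) = - 28 * b - 32 * u * R - 4 * u\<^sup>2 * R' - 20 * a * v\<^sup>2"
          unfolding v2 by (simp add: algebra_simps)
        then show ?thesis unfolding uv h f gen unfolding f_def[symmetric] by (simp add: algebra_simps)
      qed
      from this[of "r u" "r' u"]
      show "(wp1 q (exp u))\<^sup>2 - 4 * P (exp u) ^ 3 + E4 / 12 * P (exp u) = ?g u"
        unfolding L(1)[OF u] L(2)[OF u] ab by (simp add: algebra_simps)
    qed
  qed
  moreover have "x = 4 * y - w + e" if "x - 4 * y + w = e" for x y w e :: complex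
    using that by (auto simp: algebra_simps)
  ultimately show ?thesis by blast
qed

end

section \<open>Theta functions\<close>

definition theta :: "complex \<Rightarrow> complex \<Rightarrow> complex" where
  "theta q z = qpoch_inf z q * qpoch_inf (q / z) q"

context punctured_disc
begin

lemma convergent_prod_qpoch: "convergent_prod (\<lambda>k. 1 - a * q ^ k)"
proof -
  have "summable (\<lambda>k. norm (a * q ^ k))"
    using q1 by (simp add: norm_mult norm_power summable_mult summable_geometric)
  then have "abs_convergent_prod (\<lambda>k. 1 - a * q ^ k)"
    by (simp add: abs_convergent_prod_conv_summable)
  then show ?thesis by (rule abs_convergent_prod_imp_convergent_prod)
qed

lemma qpoch_LIMSEQ: "(\<lambda>n. \<Prod>k<n. 1 - a * q ^ k) \<longlonglongrightarrow> qpoch_inf a q"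
proof -
  have "(\<lambda>n. \<Prod>k<Suc n. 1 - a * q ^ k) \<longlonglongrightarrow> qpoch_inf a q"
    using convergent_prod_LIMSEQ[OF convergent_prod_qpoch[of a]]
    by (simp add: qpoch_inf_def lessThan_Suc_atMost)
  then show ?thesis by (rule LIMSEQ_imp_Suc)
qed

lemma qpoch_rec: "qpoch_inf a q = (1 - a) * qpoch_inf (a * q) q"
proof -
  have "(\<lambda>n. (1 - a) * (\<Prod>k<n. 1 - a * q * q ^ k)) \<longlonglongrightarrow> (1 - a) * qpoch_inf (a * q) q"
    by (intro tendsto_intros qpoch_LIMSEQ)
  also have "(\<lambda>n. (1 - a) * (\<Prod>k<n. 1 - a * q * q ^ k)) = (\<lambda>n. \<Prod>k<Suc n. 1 - a * q ^ k)"
    unfolding prod.lessThan_Suc_shift by (simp add: mult_ac)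
  finally have "(\<lambda>n. \<Prod>k<Suc n. 1 - a * q ^ k) \<longlonglongrightarrow> (1 - a) * qpoch_inf (a * q) q" .
  then have "(\<lambda>n. \<Prod>k<n. 1 - a * q ^ k) \<longlonglongrightarrow> (1 - a) * qpoch_inf (a * q) q"
    by (rule LIMSEQ_imp_Suc)
  then show ?thesis using qpoch_LIMSEQ LIMSEQ_unique by blast
qed

lemma qpoch_nonzero:
  assumes "norm a < 1"
  shows "qpoch_inf a q \<noteq> 0"
  unfolding qpoch_inf_def
proof (rule prodinf_nonzero[OF convergent_prod_qpoch])
  fix k
  have "norm (a * q ^ k) \<le> norm a * 1"
    unfolding norm_mult norm_power using q1 by (intro mult_left_mono power_le_one) auto
  then show "1 - a * q ^ k \<noteq> 0" using assms by auto
qed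

lemma holomorphic_qpoch: "(\<lambda>a. qpoch_inf a q) holomorphic_on A"
proof (rule holomorphic_on_subset)
  show "(\<lambda>a. qpoch_inf a q) holomorphic_on UNIV"
  proof (rule holomorphic_uniform_sequence[where f = "\<lambda>n a. \<Prod>k<n. 1 - a * q ^ k"])
    fix x :: complex
    have "uniformly_convergent_on (cball x 1) (\<lambda>N a. \<Prod>k<N. 1 - a * q ^ k)"
    proof (rule uniformly_convergent_on_prod')
      have "uniformly_convergent_on (cball x 1) (\<lambda>N a. \<Sum>k<N. norm a * norm q ^ k)"
      proof (rule Weierstrass_m_test')
        show "norm (norm a * norm q ^ k) \<le> (norm x + 1) * norm q ^ k" if "a \<in> cball x 1" for k a
        proof -
          have "norm a \<le> norm x + 1"
            using that norm_triangle_ineq2[of a x] by (simp add: dist_norm norm_minus_commute)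
          then show ?thesis by (simp add: mult_right_mono)
        qed
        show "summable (\<lambda>k. (norm x + 1) * norm q ^ k)"
          using q1 by (intro summable_mult summable_geometric) auto
      qed
      then show "uniformly_convergent_on (cball x 1) (\<lambda>N a. \<Sum>k<N. norm (1 - a * q ^ k - 1))"
        by (simp add: norm_mult norm_power)
    qed (auto intro!: continuous_intros)
    then obtain g where g: "uniform_limit (cball x 1) (\<lambda>N a. \<Prod>k<N. 1 - a * q ^ k) g sequentially"
      by (auto simp: uniformly_convergent_on_def)
    have "g a = qpoch_inf a q" if "a \<in> cball x 1" for a
      using tendsto_uniform_limitI[OF g that] qpoch_LIMSEQ[of a] LIMSEQ_unique by blast
    then have "uniform_limit (cball x 1) (\<lambda>N a. \<Prod>k<N. 1 - a * q ^ k) g sequentially \<longleftrightarrow>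
        uniform_limit (cball x 1) (\<lambda>N a. \<Prod>k<N. 1 - a * q ^ k) (\<lambda>a. qpoch_inf a q) sequentially"
      by (intro uniform_limit_cong') auto
    with g show "\<exists>d>0. cball x d \<subseteq> UNIV \<and> uniform_limit (cball x d) (\<lambda>N a. \<Prod>k<N. 1 - a * q ^ k) (\<lambda>a. qpoch_inf a q) sequentially"
      by (intro exI[of _ 1]) auto
  qed (auto intro!: holomorphic_intros)
qed simp

lemma holomorphic_qpoch' [holomorphic_intros]:
  "f holomorphic_on A \<Longrightarrow> (\<lambda>z. qpoch_inf (f z) q) holomorphic_on A"
  using holomorphic_on_compose_gen[of f A "\<lambda>a. qpoch_inf a q" UNIV] holomorphic_qpoch by (simp add: o_def)

lemma holomorphic_theta [holomorphic_intros]: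
  "f holomorphic_on A \<Longrightarrow> (\<And>z. z \<in> A \<Longrightarrow> f z \<noteq> 0) \<Longrightarrow> (\<lambda>z. theta q (f z)) holomorphic_on A"
  unfolding theta_def by (intro holomorphic_intros) auto

text \<open>The theta function with its zero at 1 divided out, so that its behaviour at 1 can be
  read off; it is invariant under inversion of \<open>z\<close>.\<close>

definition theta_reg :: "complex \<Rightarrow> complex" where
  "theta_reg z = qpoch_inf (q * z) q * qpoch_inf (q / z) q"

lemma theta_eq_reg: "theta q z = (1 - z) * theta_reg z"
  unfolding theta_def theta_reg_def by (subst qpoch_rec) (simp add: mult_ac)

lemma theta_1: "theta q 1 = 0"
  by (simp add: theta_eq_reg)

lemma theta_reflect: "z \<noteq> 0 \<Longrightarrow> theta q (q / z) = theta q z"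
  using q0 by (simp add: theta_def mult.commute)

lemma theta_inverse:
  assumes "z \<noteq> 0"
  shows "theta q (1 / z) = - theta q z / z"
proof -
  have "theta_reg (1 / z) = theta_reg z" by (simp add: theta_reg_def mult.commute)
  moreover have "1 - 1 / z = - (1 - z) / z" using assms by (simp add: field_simps)
  ultimately show ?thesis
    unfolding theta_eq_reg by (simp only: times_divide_eq_left mult_minus_left)
qed

lemma theta_shift:
  assumes "z \<noteq> 0"
  shows "theta q (q * z) = - theta q z / z"
  using theta_reflect[of "1 / z"] theta_inverse[OF assms] assms by simp

lemma theta_reg_nonzero: "z \<in> annulus q \<Longrightarrow> theta_reg z \<noteq> 0"
  unfolding theta_reg_def using annulusD[of z] qpoch_nonzero by auto

lemma theta_nonzero: "z \<in> annulus q \<Longrightarrow> z \<noteq> 1 \<Longrightarrow> theta q z \<noteq> 0"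
  by (simp add: theta_eq_reg theta_reg_nonzero)

lemma theta_reg_1: "theta_reg 1 = qpoch_inf q q ^ 2"
  by (simp add: theta_reg_def power2_eq_square)

text \<open>As functions of \<open>z\<close>, the right-hand side and \<open>wp0 q z\<close> have
  the same double pole at 1 and the same periodicity, so they differ by a constant. It never has to
  be computed: at \<open>z = v\<close> the right-hand side vanishes.\<close>

lemma wp0_diff_eq:
  assumes z: "z \<in> annulus q" "z \<noteq> 1" and v: "v \<in> annulus q" "v \<noteq> 1"
  shows "wp0 q z - wp0 q v = - v * qpoch_inf q q ^ 4 * theta q (z * v) * theta q (z / v)
           / ((theta q z)\<^sup>2 * (theta q v)\<^sup>2)"
proof -
  have v0: "v \<noteq> 0" and tv: "theta q v \<noteq> 0"
    using annulusD[OF v(1)] theta_nonzero[OF v] by auto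
  have pq: "qpoch_inf q q \<noteq> 0" using qpoch_nonzero q1 by blast
  define R where "R = (\<lambda>z. - v * qpoch_inf q q ^ 4 * theta q (z * v) * theta q (z / v)
           / ((theta q z)\<^sup>2 * (theta q v)\<^sup>2))"
  define f where "f = (\<lambda>z. R z - wp0 q z)"
  have ann0: "z \<noteq> 0" if "z \<in> annulus q" for z using annulusD[OF that] by simp
  have hol_wp0: "wp0 q holomorphic_on annulus q - {1}"
  proof -
    have "(\<lambda>z. P z - 1 / 12 + 2 * lambert q 1 q) holomorphic_on annulus q - {1}"
      by (intro holomorphic_intros holomorphic_P)
    then show ?thesis by (simp add: P_def)
  qed
  have hol: "f holomorphic_on annulus q - {1}"
    unfolding f_def R_def using ann0 v0 tv theta_nonzero by (intro holomorphic_intros hol_wp0) auto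
  have per: "f (q * z) = f z" if "1 < norm z" "norm (q * z) < 1" for z
  proof -
    have z0: "z \<noteq> 0" using that by auto
    \<comment> \<open>The two numerator shifts together give the factor 1/z^2, the same as the
      squared theta function in the denominator.\<close>
    have 1: "theta q (q * z * v) = - theta q (z * v) / (z * v)"
      using theta_shift[of "z * v"] z0 v0 by (simp add: mult.assoc)
    have 2: "theta q (q * z / v) = - theta q (z / v) / (z / v)"
      using theta_shift[of "z / v"] z0 v0 by simp
    have "- theta q (z * v) / (z * v) * (- theta q (z / v) / (z / v)) = theta q (z * v) * theta q (z / v) / z\<^sup>2"
      using z0 v0 by (simp add: power2_eq_square)
    moreover have "(- theta q z / z)\<^sup>2 = (theta q z)\<^sup>2 / z\<^sup>2" by (simp add: power_divide)
    ultimately have "R (q * z) = - v * qpoch_inf q q ^ 4 * (theta q (z * v) * theta q (z / v) / z\<^sup>2)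
           / ((theta q z)\<^sup>2 / z\<^sup>2 * (theta q v)\<^sup>2)"
      unfolding R_def 1 2 theta_shift[OF z0] by (metis mult.assoc)
    also have "\<dots> = R z" unfolding R_def using z0 by simp
    finally show ?thesis using wp_periodic[OF that] by (simp add: f_def)
  qed
  \<comment> \<open>The cofactor of \<open>z / (1 - z)\<^sup>2\<close> in \<open>R\<close>. Writing
    it with \<open>v / z\<close> instead of \<open>z / v\<close> makes it symmetric under
    \<open>z\<close> to \<open>1 / z\<close>, so \<open>Gu\<close> is even and 1 + O(u^2): the
    double poles agree and no simple pole survives.\<close>
  define G where "G = (\<lambda>z. theta q (v * z) * theta q (v / z) / ((theta_reg z)\<^sup>2 * ((theta q v)\<^sup>2 / qpoch_inf q q ^ 4)))"
  have G1: "G 1 = 1" using tv pq unfolding G_def theta_reg_1 by (simp add: field_simps power2_eq_square power4_eq_xxxx)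
  have RG: "R z = z / (1 - z)\<^sup>2 * G z" if "z \<in> annulus q" for z
  proof -
    have z0: "z \<noteq> 0" using ann0 that by auto
    have "theta q (z / v) = - theta q (v / z) / (v / z)"
      using theta_inverse[of "v / z"] z0 v0 by simp
    then show ?thesis
      unfolding R_def G_def theta_eq_reg[of z] using v0 by (simp add: power_mult_distrib mult_ac)
  qed
  obtain \<delta> where d: "0 < \<delta>" "\<delta> \<le> 1" and ann: "\<And>u :: complex. u \<in> ball 0 \<delta> \<Longrightarrow> exp u \<in> annulus q"
    by (rule wp0_laurent) (rule that)
  define Gu where "Gu = (\<lambda>u. G (exp u))"
  have "Gu holomorphic_on ball 0 \<delta>"
  proof -
    have "theta_reg holomorphic_on annulus q"
      unfolding theta_reg_def[abs_def] using ann0 by (intro holomorphic_intros) auto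
    then have "G holomorphic_on annulus q"
      unfolding G_def using ann0 v0 tv pq theta_reg_nonzero by (intro holomorphic_intros) auto
    then show ?thesis
      unfolding Gu_def using ann by (intro holomorphic_on_compose_gen[of exp _ G, unfolded o_def] holomorphic_intros) auto
  qed
  moreover have "Gu (- u) = Gu u" for u
  proof -
    have "theta_reg (1 / z) = theta_reg z" for z by (simp add: theta_reg_def mult.commute)
    from this[of "exp u"] show ?thesis
      by (simp add: Gu_def G_def exp_minus divide_inverse mult_ac)
  qed
  ultimately obtain g where g: "g holomorphic_on ball 0 \<delta>" "\<And>u. u \<in> ball 0 \<delta> \<Longrightarrow> Gu u = Gu 0 + u\<^sup>2 * g u"
    using even_quadratic_remainder[OF d(1)] by metis
  obtain s where s: "s holomorphic_on ball 0 1"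
    "\<And>u. u \<in> ball 0 1 \<Longrightarrow> u \<noteq> 0 \<Longrightarrow>
       exp u / (1 - exp u)\<^sup>2 = 1 / u\<^sup>2 - 1 / 12 + u\<^sup>2 / 240 - u ^ 4 / 6048 + u ^ 5 * s u"
    by (rule exp_div_square_laurent) (rule that)
  define h where "h = (\<lambda>u. (1 - u\<^sup>2 / 12 + u ^ 4 / 240 - u ^ 6 / 6048 + u ^ 7 * s u) * g u
       - lambert q 1 (q * exp u) - lambert q 1 (q / exp u))"
  have fh: "f (exp u) = h u" if u: "u \<in> ball 0 \<delta>" "u \<noteq> 0" for u
  proof -
    have "f (exp u) = exp u / (1 - exp u)\<^sup>2 * (G (exp u) - 1) - lambert q 1 (q * exp u) - lambert q 1 (q / exp u)"
    proof -
      have "y * t - (y + a + b) = y * (t - 1) - a - b" for y t a b :: complex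
        by (simp add: algebra_simps)
      then show ?thesis unfolding f_def RG[OF ann[OF u(1)]] wp0_def .
    qed
    also have "G (exp u) - 1 = u\<^sup>2 * g u"
      using g(2)[OF u(1)] G1 by (simp add: Gu_def)
    also have "exp u / (1 - exp u)\<^sup>2 * (u\<^sup>2 * g u) = (1 - u\<^sup>2 / 12 + u ^ 4 / 240 - u ^ 6 / 6048 + u ^ 7 * s u) * g u"
    proof -
      have "u \<in> ball 0 1" using u d by auto
      then have "exp u / (1 - exp u)\<^sup>2 * u\<^sup>2 = 1 - u\<^sup>2 / 12 + u ^ 4 / 240 - u ^ 6 / 6048 + u ^ 7 * s u"
        unfolding s(2)[OF \<open>u \<in> ball 0 1\<close> u(2)]
        using u(2) by (simp add: field_simps power_numeral_reduce)
      then show ?thesis by (metis mult.assoc)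
    qed
    finally show ?thesis by (simp add: h_def)
  qed
  have "isCont g 0"
    using holomorphic_on_imp_continuous_on[OF g(1)] d by (simp add: continuous_on_eq_continuous_at)
  moreover have "isCont s 0"
    using holomorphic_on_imp_continuous_on[OF s(1)] by (simp add: continuous_on_eq_continuous_at)
  moreover have "isCont (\<lambda>u. lambert q 1 (q * exp u)) 0" "isCont (\<lambda>u. lambert q 1 (q / exp u)) 0"
    using q0 q1 by (auto intro!: DERIV_isCont derivative_eq_intros)
  ultimately have cont: "isCont h 0" unfolding h_def by (intro continuous_intros) auto
  have lim: "((\<lambda>u. f (exp u)) \<longlongrightarrow> h 0) (at 0)"
    by (rule tendsto_at_0_if_eq_near[OF d(1) fh cont]) simp_all
  have const: "f w = h 0" if "w \<in> annulus q" "w \<noteq> 1" for w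
    by (rule annulus_periodic_constant[OF q0 q1 hol _ lim that]) (rule per)
  have "f z = f v" using const[OF z] const[OF v] by simp
  moreover have "R v = 0" using v0 by (simp add: R_def theta_1)
  ultimately have "wp0 q z - wp0 q v = R z" unfolding f_def by (simp add: algebra_simps)
  then show ?thesis unfolding R_def .
qed

text \<open>Differentiate \<open>wp0_diff_eq\<close> in \<open>z\<close> at \<open>z = v\<close>.
  The factor \<open>theta q (z / v)\<close> vanishes there, so only its derivative counts, and the
  slope of \<open>theta q\<close> at 1 is minus the square of \<open>qpoch_inf q q\<close>.\<close>

lemma wp1_eq:
  assumes v: "v \<in> annulus q" "v \<noteq> 1"
  shows "wp1 q v = v * qpoch_inf q q ^ 6 * theta q (v\<^sup>2) / theta q v ^ 4"
proof -
  have v0: "v \<noteq> 0" and tv: "theta q v \<noteq> 0"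
    using annulusD[OF v(1)] theta_nonzero[OF v] by auto
  define K where "K = (\<lambda>z. - v * qpoch_inf q q ^ 4 * theta q (z * v) / ((theta q z)\<^sup>2 * (theta q v)\<^sup>2))"
  define A where "A = annulus q - {1}"
  have oA: "open A" unfolding A_def using open_annulus by (intro open_Diff) auto
  have vA: "v \<in> A" using v by (simp add: A_def)
  have A: "z \<noteq> 0" "theta q z \<noteq> 0" if "z \<in> A" for z
    using that annulusD[of z] theta_nonzero[of z] by (auto simp: A_def)
  have "K holomorphic_on A"
    unfolding K_def using A v0 tv by (intro holomorphic_intros) auto
  then obtain K' where K': "(K has_field_derivative K') (at v)"
    using vA oA by (auto simp: holomorphic_on_open)
  have "theta_reg holomorphic_on - {0}"
    unfolding theta_reg_def[abs_def] by (intro holomorphic_intros) auto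
  then obtain t' where t': "(theta_reg has_field_derivative t') (at 1)"
    using holomorphic_derivI[of theta_reg "- {0}" 1] by auto
  have "((\<lambda>z. (1 - z) * theta_reg z) has_field_derivative (0 - 1) * theta_reg 1 + t' * (1 - 1)) (at 1)"
    by (intro DERIV_mult DERIV_diff DERIV_const DERIV_ident t')
  then have th: "(theta q has_field_derivative - (qpoch_inf q q)\<^sup>2) (at 1)"
    by (simp add: theta_eq_reg[abs_def] theta_reg_1)
  have "((\<lambda>z. theta q (z / v)) has_field_derivative - (qpoch_inf q q)\<^sup>2 * (1 / v)) (at v)"
    by (rule DERIV_chain2[of "theta q"]) (use th v0 in \<open>auto intro!: derivative_eq_intros\<close>)
  from DERIV_mult[OF K' this]
  have "((\<lambda>z. K z * theta q (z / v)) has_field_derivative - K v * (qpoch_inf q q)\<^sup>2 / v) (at v)"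
    using v0 by (simp add: theta_1 mult_ac)
  moreover have "((\<lambda>z. K z * theta q (z / v)) has_field_derivative wp1 q v / v) (at v)"
  proof (rule has_field_derivative_transform_within_open[OF _ oA vA])
    show "((\<lambda>z. wp0 q z - wp0 q v) has_field_derivative wp1 q v / v) (at v)"
      using DERIV_wp0[OF v] by (auto intro!: derivative_eq_intros)
    show "wp0 q z - wp0 q v = K z * theta q (z / v)" if "z \<in> A" for z
      using wp0_diff_eq[of z v] that v by (simp add: K_def A_def)
  qed
  ultimately have "wp1 q v / v = - K v * (qpoch_inf q q)\<^sup>2 / v" using DERIV_unique by blast
  then have "wp1 q v = - K v * (qpoch_inf q q)\<^sup>2" using v0 divide_cancel_right by blast
  also have "\<dots> = v * qpoch_inf q q ^ 6 * theta q (v\<^sup>2) / theta q v ^ 4"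
    unfolding K_def by (simp add: mult_ac flip: power2_eq_square power_add)
  finally show ?thesis .
qed

end

section \<open>The Jacobi triple product\<close>

definition tri :: "int \<Rightarrow> int" where "tri n = n * (n - 1) div 2"

lemma two_tri: "2 * tri n = n * (n - 1)"
  unfolding tri_def by (subst dvd_mult_div_cancel) auto

lemma tri_minus_1: "tri (n - 1) = tri n - (n - 1)"
  using two_tri[of n] two_tri[of "n - 1"] by (simp add: algebra_simps)

lemma tri_plus_1: "tri (n + 1) = tri n + n"
  using two_tri[of n] two_tri[of "n + 1"] by (simp add: algebra_simps)

lemma summable_theta_nat:
  fixes r t :: real
  assumes r: "0 < r" "r < 1" and t: "t > 0"
  shows "summable (\<lambda>m. r powi tri (int m) * t ^ m)"
proof -
  have "(\<lambda>m. r ^ m * t) \<longlonglongrightarrow> 0 * t"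
    using r by (intro tendsto_intros LIMSEQ_power_zero) auto
  then have "eventually (\<lambda>m. r ^ m * t < 1 / 2) sequentially"
    by (rule order_tendstoD) simp
  then obtain N where N: "\<And>m. m \<ge> N \<Longrightarrow> r ^ m * t < 1 / 2" by (auto simp: eventually_sequentially)
  show ?thesis
  proof (rule summable_ratio_test[where c = "1 / 2" and N = N])
    fix m assume m: "m \<ge> N"
    have "int (Suc m) = int m + 1" by simp
    then have "r powi tri (int (Suc m)) = r powi tri (int m) * r ^ m"
      using r by (simp only: tri_plus_1) (simp add: power_int_add)
    then have "norm (r powi tri (int (Suc m)) * t ^ Suc m) = (r ^ m * t) * (r powi tri (int m) * t ^ m)"
      using r t by (simp add: abs_mult)
    also have "\<dots> \<le> 1 / 2 * (r powi tri (int m) * t ^ m)"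
      using N[OF m] r t by (intro mult_right_mono) auto
    finally show "norm (r powi tri (int (Suc m)) * t ^ Suc m) \<le> 1 / 2 * norm (r powi tri (int m) * t ^ m)"
      using r t by simp
  qed simp
qed

lemma summable_on_theta_int:
  fixes r t :: real
  assumes r: "0 < r" "r < 1" and t: "t > 0"
  shows "(\<lambda>n::int. r powi tri n * t powi n) summable_on UNIV"
proof -
  have nat: "f summable_on UNIV" if "summable f" "\<And>n. f n \<ge> 0" for f :: "nat \<Rightarrow> real"
    using that by (intro norm_summable_imp_summable_on) simp
  have "(\<lambda>m. r powi tri (int m) * t powi (int m)) summable_on UNIV"
    using summable_theta_nat[OF r t] r t by (intro nat) auto
  then have 1: "(\<lambda>n::int. r powi tri n * t powi n) summable_on range int"
    by (subst summable_on_reindex) (auto simp: o_def)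
  \<comment> \<open>The negative half of the sum is again one of the natural-number type, with
    \<open>t\<close> replaced by \<open>r / t\<close>.\<close>
  have "tri (- int m) = tri (int m) + int m" for m
    using two_tri[of "- int m"] two_tri[of "int m"] by (simp add: algebra_simps)
  then have "(\<lambda>m. r powi tri (- int m) * t powi (- int m)) = (\<lambda>m. r powi tri (int m) * (r / t) ^ m)"
    using r t by (intro ext) (simp add: power_int_add power_int_minus power_divide divide_inverse power_mult_distrib power_inverse)
  moreover have "(\<lambda>m. r powi tri (int m) * (r / t) ^ m) summable_on UNIV"
    using summable_theta_nat[OF r, of "r / t"] r t by (intro nat) auto
  ultimately have "(\<lambda>m. r powi tri (- int m) * t powi (- int m)) summable_on UNIV" by simp
  then have 2: "(\<lambda>n::int. r powi tri n * t powi n) summable_on range (\<lambda>m. - int m)"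
    by (subst summable_on_reindex) (auto simp: o_def inj_def)
  have "(UNIV :: int set) = range int \<union> range (\<lambda>m. - int m)"
    by (auto simp: image_iff) (metis int_cases2)
  then show ?thesis using summable_on_union[OF 1 2] by simp
qed

context punctured_disc
begin

definition qfac :: "nat \<Rightarrow> complex" where "qfac n = (\<Prod>k<n. 1 - q ^ Suc k)"

text \<open>
  Extending \<open>1 / qfac\<close> by \<open>0\<close> to negative integers keeps its recurrence valid on all of \<open>\<int>\<close>.
\<close>

definition inv_qfac :: "int \<Rightarrow> complex" where
  "inv_qfac n = (if n < 0 then 0 else 1 / qfac (nat n))"

lemma inv_qfac_rec: "inv_qfac (n - 1) = (1 - q powi n) * inv_qfac n"
proof (cases "n > 0")
  case True
  then obtain m where m: "n = int (Suc m)" by (metis gr0_implies_Suc zero_less_imp_eq_int)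
  have "1 - q ^ Suc m \<noteq> 0" by (rule one_minus_power_ne_0) simp
  moreover have "nat (int (Suc m) - 1) = m" by simp
  ultimately show ?thesis by (simp add: inv_qfac_def m qfac_def del: power_Suc of_nat_Suc flip: of_nat_Suc)
next
  case False
  then show ?thesis by (cases "n = 0") (auto simp: inv_qfac_def)
qed

text \<open>Up to the sign and the power of \<open>q\<close>, this is the Gaussian binomial
  coefficient of 2N over N + n; \<open>inv_qfac\<close> makes it 0 for |n| > N.\<close>

definition jtp_coeff :: "nat \<Rightarrow> int \<Rightarrow> complex" where
  "jtp_coeff N n = (-1) powi n * q powi tri n * qfac (2 * N) * inv_qfac (int N + n) * inv_qfac (int N - n)"

text \<open>Comparison of coefficients when the finite product is multiplied by its next two
  factors, whose product is 1 + q^(2N+1) - q^N z - q^(N+1)/z.\<close>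

lemma jtp_coeff_rec:
  "jtp_coeff (Suc N) n = (1 + q ^ (2 * N + 1)) * jtp_coeff N n - q ^ N * jtp_coeff N (n - 1)
      - q ^ (N + 1) * jtp_coeff N (n + 1)"
proof -
  define x where "x = q powi n"
  define y where "y = q ^ N"
  define A where "A = inv_qfac (int N + 1 + n)"
  define B where "B = inv_qfac (int N + 1 - n)"
  define s where "s = (-1) powi n * q powi tri n * qfac (2 * N)"
  have x0: "x \<noteq> 0" using q0 by (simp add: x_def)
  have xy: "q powi (int N + 1 + n) = q * y * x" "q powi (int N + n) = y * x"
    "q powi (int N + 1 - n) = q * y / x" "q powi (int N - n) = y / x"
    using q0 by (simp_all add: power_int_add power_int_diff x_def y_def)
  have i1: "inv_qfac (int N + n) = (1 - q * y * x) * A"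
    using inv_qfac_rec[of "int N + 1 + n"] by (simp add: A_def xy)
  have i2: "inv_qfac (int N - n) = (1 - q * y / x) * B"
    using inv_qfac_rec[of "int N + 1 - n"] by (simp add: B_def xy)
  have i3: "inv_qfac (int N + (n - 1)) = (1 - y * x) * ((1 - q * y * x) * A)"
    using inv_qfac_rec[of "int N + n"] i1 by (simp add: xy add_diff_eq)
  have i4: "inv_qfac (int N - (n + 1)) = (1 - y / x) * ((1 - q * y / x) * B)"
    using inv_qfac_rec[of "int N - n"] i2 by (simp add: xy diff_diff_eq)
  have i5: "inv_qfac (int N - (n - 1)) = B" "inv_qfac (int N + (n + 1)) = A"
    by (simp_all add: A_def B_def algebra_simps)
  have i6: "inv_qfac (int (Suc N) + n) = A" "inv_qfac (int (Suc N) - n) = B"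
    by (simp_all add: A_def B_def algebra_simps)
  have s1: "(-1) powi (n - 1) * q powi tri (n - 1) * qfac (2 * N) = - s * (q / x)"
    using q0 by (simp add: tri_minus_1 s_def x_def power_int_diff power_int_add power_int_minus_one_diff_commute field_simps)
  have s2: "(-1) powi (n + 1) * q powi tri (n + 1) * qfac (2 * N) = - s * x"
    using q0 by (simp add: tri_plus_1 s_def x_def power_int_add)
  have s3: "(-1) powi n * q powi tri n * qfac (2 * Suc N) = s * ((1 - q * y\<^sup>2) * (1 - q\<^sup>2 * y\<^sup>2))"
  proof -
    have y2: "y\<^sup>2 = q ^ (2 * N)" by (simp add: y_def mult.commute flip: power_mult)
    show ?thesis unfolding y2 by (simp add: s_def qfac_def power2_eq_square mult_ac)
  qed
  \<comment> \<open>The recurrence after removal of the common factors \<open>s\<close>,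
    \<open>A\<close> and \<open>B\<close>, with \<open>x\<close> for q^n and \<open>y\<close> for
    q^N.\<close>
  have poly: "(1 - q * y\<^sup>2) * (1 - q\<^sup>2 * y\<^sup>2) = (1 + q * y\<^sup>2) * (1 - q * y * x) * (1 - q * y / x)
     + y * (q / x) * ((1 - y * x) * (1 - q * y * x)) + q * y * x * ((1 - y / x) * (1 - q * y / x))"
    using x0 by (simp add: field_simps power2_eq_square)
  have gen: "s * ((1 + p) * e1 * e2 + y * w * (e3 * e1) + q * y * x * (e4 * e2)) * A * B =
      (1 + p) * (s * (e1 * A) * (e2 * B)) - y * (- s * w * (e3 * (e1 * A)) * B)
        - q * y * (- s * x * A * (e4 * (e2 * B)))" for p e1 e2 e3 e4 w
    by (simp add: algebra_simps)
  have j1: "jtp_coeff (Suc N) n = s * ((1 - q * y\<^sup>2) * (1 - q\<^sup>2 * y\<^sup>2)) * A * B"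
    unfolding jtp_coeff_def s3 i6 ..
  have j2: "jtp_coeff N n = s * ((1 - q * y * x) * A) * ((1 - q * y / x) * B)"
    unfolding jtp_coeff_def i1 i2 s_def ..
  have j3: "jtp_coeff N (n - 1) = - s * (q / x) * ((1 - y * x) * ((1 - q * y * x) * A)) * B"
    unfolding jtp_coeff_def s1 i3 i5 ..
  have j4: "jtp_coeff N (n + 1) = - s * x * A * ((1 - y / x) * ((1 - q * y / x) * B))"
    unfolding jtp_coeff_def s2 i4 i5 ..
  have ys: "q ^ (2 * N + 1) = q * y\<^sup>2" "q ^ N = y" "q ^ (N + 1) = q * y"
    by (simp_all add: y_def mult.commute flip: power_mult)
  show ?thesis unfolding j1 j2 j3 j4 ys poly by (rule gen)
qed

text \<open>As a sum over all integers, although finitely supported, the identity admits index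
  shifts without boundary terms.\<close>

lemma finite_jacobi_triple:
  assumes z: "z \<noteq> 0"
  shows "((\<lambda>n. jtp_coeff N n * z powi n) has_sum ((\<Prod>k<N. 1 - z * q ^ k) * (\<Prod>k<N. 1 - q / z * q ^ k))) UNIV"
proof (induction N)
  case 0
  have "((\<lambda>n. jtp_coeff 0 n * z powi n) has_sum (\<Sum>n\<in>{0}. jtp_coeff 0 n * z powi n)) UNIV"
    by (rule has_sum_finite_neutralI[where B = "{0}"]) (auto simp: jtp_coeff_def inv_qfac_def)
  also have "(\<Sum>n\<in>{0}. jtp_coeff 0 n * z powi n) = 1"
    by (simp add: jtp_coeff_def inv_qfac_def qfac_def tri_def)
  finally show ?case by simp
next
  case (Suc N)
  define S where "S = (\<Prod>k<N. 1 - z * q ^ k) * (\<Prod>k<N. 1 - q / z * q ^ k)"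
  have b: "bij_betw (\<lambda>n::int. n - 1) UNIV UNIV" "bij_betw (\<lambda>n::int. n + 1) UNIV UNIV"
    by (rule bij_betwI[where g = "\<lambda>n. n + 1"]; simp) (rule bij_betwI[where g = "\<lambda>n. n - 1"]; simp)
  note 0 = Suc.IH[folded S_def]
  have 1: "((\<lambda>n. jtp_coeff N (n - 1) * z powi (n - 1)) has_sum S) UNIV"
    using has_sum_reindex_bij_betw[OF b(1), of "\<lambda>n. jtp_coeff N n * z powi n" S] 0 by simp
  have 2: "((\<lambda>n. jtp_coeff N (n + 1) * z powi (n + 1)) has_sum S) UNIV"
    using has_sum_reindex_bij_betw[OF b(2), of "\<lambda>n. jtp_coeff N n * z powi n" S] 0 by simp
  have "((\<lambda>n. (1 + q ^ (2 * N + 1)) * (jtp_coeff N n * z powi n)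
      + (- (q ^ N * z)) * (jtp_coeff N (n - 1) * z powi (n - 1))
      + (- (q ^ (N + 1) / z)) * (jtp_coeff N (n + 1) * z powi (n + 1))) has_sum
      ((1 + q ^ (2 * N + 1)) * S + (- (q ^ N * z)) * S + (- (q ^ (N + 1) / z)) * S)) UNIV"
    by (intro has_sum_add has_sum_cmult_right 0 1 2)
  also have "(\<lambda>n. (1 + q ^ (2 * N + 1)) * (jtp_coeff N n * z powi n)
      + (- (q ^ N * z)) * (jtp_coeff N (n - 1) * z powi (n - 1))
      + (- (q ^ (N + 1) / z)) * (jtp_coeff N (n + 1) * z powi (n + 1))) = (\<lambda>n. jtp_coeff (Suc N) n * z powi n)"
  proof
    fix n :: int
    define w where "w = z powi n"
    have w: "z powi (n - 1) = w / z" "z powi (n + 1) = w * z"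
      using z by (simp_all add: w_def power_int_diff power_int_add)
    show "(1 + q ^ (2 * N + 1)) * (jtp_coeff N n * z powi n)
      + (- (q ^ N * z)) * (jtp_coeff N (n - 1) * z powi (n - 1))
      + (- (q ^ (N + 1) / z)) * (jtp_coeff N (n + 1) * z powi (n + 1)) = jtp_coeff (Suc N) n * z powi n"
      unfolding jtp_coeff_rec w w_def[symmetric] using z by (simp add: algebra_simps)
  qed
  also have "(1 + q ^ (2 * N + 1)) * S + (- (q ^ N * z)) * S + (- (q ^ (N + 1) / z)) * S
      = S * ((1 - z * q ^ N) * (1 - q / z * q ^ N))"
    using z by (simp add: field_simps power_mult power2_eq_square mult_2 power_add)
  finally show ?case by (simp add: S_def mult_ac)
qed

text \<open>Let N tend to infinity in the finite identity. Each Gaussian binomial coefficient tends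
  to \<open>1 / \<phi>\<close>, and dominated convergence permits the termwise limit.\<close>

lemma jacobi_triple_product:
  assumes z: "z \<noteq> 0"
  shows "((\<lambda>n::int. (-1) powi n * q powi tri n * z powi n) has_sum (qpoch_inf q q * theta q z)) UNIV"
proof -
  define \<phi> where "\<phi> = qpoch_inf q q"
  have \<phi>0: "\<phi> \<noteq> 0" using qpoch_nonzero q1 by (simp add: \<phi>_def)
  have qf: "qfac \<longlonglongrightarrow> \<phi>"
    using qpoch_LIMSEQ[of q] by (simp add: qfac_def[abs_def] \<phi>_def)
  have iqf: "(\<lambda>n. 1 / qfac n) \<longlonglongrightarrow> 1 / \<phi>"
    using qf \<phi>0 by (intro tendsto_intros)
  obtain C1 where C1: "\<And>n. norm (qfac n) \<le> C1"
    using convergent_imp_Bseq[OF convergentI[OF qf]] by (auto simp: Bseq_def)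
  obtain C2 where C2: "C2 > 0" "\<And>n. norm (1 / qfac n) \<le> C2"
    using convergent_imp_Bseq[OF convergentI[OF iqf]] unfolding Bseq_def by blast
  have C1': "C1 \<ge> 0" using C1[of 0] norm_ge_zero order_trans by blast
  have C2': "norm (inv_qfac n) \<le> C2" for n using C2 by (auto simp: inv_qfac_def)
  \<comment> \<open>An enumeration of the integers, which gives the sum the form of a series over
    \<open>nat\<close> as in \<open>tannerys_theorem\<close>.\<close>
  define d where "d = int_decode"
  have bd: "bij_betw d UNIV UNIV" using bij_int_decode by (simp add: d_def)
  define a where "a = (\<lambda>k N. jtp_coeff N (d k) * z powi (d k))"
  define b where "b = (\<lambda>k. (-1) powi (d k) * q powi tri (d k) * z powi (d k) / \<phi>)"
  define M where "M = (\<lambda>k. C1 * C2 * C2 * (norm q powi tri (d k) * norm z powi (d k)))"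
  have M: "summable M"
  proof -
    have "(\<lambda>n. norm q powi tri n * norm z powi n) summable_on (UNIV :: int set)"
      using q0 q1 z by (intro summable_on_theta_int) auto
    then have "(\<lambda>k. norm q powi tri (d k) * norm z powi (d k)) summable_on UNIV"
      using summable_on_reindex_bij_betw[OF bd, of "\<lambda>n. norm q powi tri n * norm z powi n"] by simp
    then show ?thesis unfolding M_def by (intro summable_mult summable_on_imp_summable)
  qed
  have lim: "(\<lambda>N. a k N) \<longlonglongrightarrow> b k" for k
  proof -
    have 1: "(\<lambda>N. qfac (2 * N)) \<longlonglongrightarrow> \<phi>"
      using LIMSEQ_subseq_LIMSEQ[OF qf, of "\<lambda>N. 2 * N"] by (simp add: strict_mono_def o_def)
    have 2: "(\<lambda>N. inv_qfac (int N + m)) \<longlonglongrightarrow> 1 / \<phi>" for m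
    proof -
      have "filterlim (\<lambda>N. nat (int N + m)) at_top sequentially"
        unfolding filterlim_at_top eventually_sequentially
      proof
        fix Z
        show "\<exists>N. \<forall>n\<ge>N. Z \<le> nat (int n + m)"
          by (rule exI[of _ "nat (int Z - m)"]) auto
      qed
      then have "(\<lambda>N. 1 / qfac (nat (int N + m))) \<longlonglongrightarrow> 1 / \<phi>"
        by (rule filterlim_compose[OF iqf])
      moreover have "eventually (\<lambda>N. 1 / qfac (nat (int N + m)) = inv_qfac (int N + m)) sequentially"
        unfolding eventually_sequentially by (intro exI[of _ "nat (- m)"]) (auto simp: inv_qfac_def)
      ultimately show ?thesis by (rule Lim_transform_eventually)
    qed
    have "(\<lambda>N. a k N) \<longlonglongrightarrow> (-1) powi (d k) * q powi tri (d k) * \<phi> * (1 / \<phi>) * (1 / \<phi>) * z powi (d k)"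
      unfolding a_def jtp_coeff_def using 2[of "- d k"] by (intro tendsto_intros 1 2) simp
    then show ?thesis using \<phi>0 by (simp add: b_def)
  qed
  have bound: "norm (a k N) \<le> M k" for k N
  proof -
    have "norm (a k N) = norm (qfac (2 * N)) * norm (inv_qfac (int N + d k)) * norm (inv_qfac (int N - d k))
       * (norm q powi tri (d k) * norm z powi (d k))"
      by (simp add: a_def jtp_coeff_def norm_mult norm_power_int)
    also have "\<dots> \<le> M k"
      unfolding M_def using C1 C2 C2' C1' by (intro mult_right_mono mult_mono) auto
    finally show ?thesis .
  qed
  have tan: "eventually (\<lambda>N. summable (\<lambda>k. norm (a k N))) sequentially \<and> summable (\<lambda>k. norm (b k)) \<and>
      ((\<lambda>N. \<Sum>k. a k N) \<longlonglongrightarrow> suminf b)"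
    by (rule tannerys_theorem[OF lim _ M]) (use bound in \<open>auto intro!: always_eventually\<close>)
  have "(\<Sum>k. a k N) = (\<Prod>k<N. 1 - z * q ^ k) * (\<Prod>k<N. 1 - q / z * q ^ k)" for N
  proof -
    have "((\<lambda>k. a k N) has_sum ((\<Prod>k<N. 1 - z * q ^ k) * (\<Prod>k<N. 1 - q / z * q ^ k))) UNIV"
      unfolding a_def using has_sum_reindex_bij_betw[OF bd, of "\<lambda>n. jtp_coeff N n * z powi n"]
        finite_jacobi_triple[OF z] by simp
    then show ?thesis by (intro sums_unique[symmetric] has_sum_imp_sums)
  qed
  moreover have "(\<lambda>N. (\<Prod>k<N. 1 - z * q ^ k) * (\<Prod>k<N. 1 - q / z * q ^ k)) \<longlonglongrightarrow> theta q z"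
    unfolding theta_def by (intro tendsto_intros qpoch_LIMSEQ)
  ultimately have "(\<lambda>N. \<Sum>k. a k N) \<longlonglongrightarrow> theta q z" by simp
  then have "suminf b = theta q z"
    using tan LIMSEQ_unique by blast
  moreover have nb: "summable (\<lambda>k. norm (b k))" using tan by blast
  have "(b has_sum suminf b) UNIV"
    by (rule norm_summable_imp_has_sum[OF nb summable_sums[OF summable_norm_cancel[OF nb]]])
  ultimately have "((\<lambda>k. \<phi> * b k) has_sum (\<phi> * theta q z)) UNIV"
    by (intro has_sum_cmult_right) simp
  then have "((\<lambda>k. (-1) powi (d k) * q powi tri (d k) * z powi (d k)) has_sum (\<phi> * theta q z)) UNIV"
    using \<phi>0 by (simp add: b_def)
  then show ?thesis
    using has_sum_reindex_bij_betw[OF bd, of "\<lambda>n. (-1) powi n * q powi tri n * z powi n"] by (simp add: \<phi>_def)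
qed

end

section \<open>The septic case\<close>

text \<open>The relation defines a conic, parametrized by the ratio \<open>t\<close> of
  \<open>z\<close> to \<open>x\<close>. Solving for \<open>y\<close> gives
  \<open>y = t * x / (1 + t)\<close>, hence the scale \<open>k = x - y\<close>, which clears the
  denominator.\<close>

lemma septic_conic_parametrization:
  fixes x y z :: complex
  assumes "x \<noteq> 0" "y \<noteq> 0" "z \<noteq> 0" "x * z = x * y + y * z"
  obtains t k where "x = (1 + t) * k" "y = t * k" "z = t * (1 + t) * k" "t \<noteq> 0" "1 + t \<noteq> 0" "k \<noteq> 0"
proof -
  define t where "t = z / x"
  define k where "k = x - y"
  have t: "t * x = z" using assms by (simp add: t_def)
  have y: "y = t * k"
  proof -
    have "x * y = x * (t * k)" using t assms(4) by (simp add: k_def algebra_simps flip: t)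
    then show ?thesis using assms(1) by simp
  qed
  have x: "x = (1 + t) * k" using y by (simp add: k_def algebra_simps)
  show ?thesis
    by (rule that[of t k]) (use x y t assms in auto)
qed

text \<open>Subtracting the cubic equations of two points and dividing by their difference gives a
  quadratic relation. Two such relations differ by a multiple of \<open>p1 + p2 + p3\<close>, so sum
  and differences determine the points; the coefficients of the cubic follow.\<close>

lemma septic_weierstrass_system:
  fixes t k p1 p2 p3 E4 E6 :: complex
  assumes nz: "t \<noteq> 0" "1 + t \<noteq> 0" "k \<noteq> 0"
    and d12: "p1 - p2 = t\<^sup>2 * (1 + t) * k\<^sup>2" and d13: "p1 - p3 = t * (1 + t)\<^sup>2 * k\<^sup>2"
    and w1: "(t\<^sup>2 * (1 + t) ^ 3 * k ^ 3)\<^sup>2 = 4 * p1 ^ 3 - E4 / 12 * p1 + E6 / 216"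
    and w2: "(t ^ 3 * (1 + t) * k ^ 3)\<^sup>2 = 4 * p2 ^ 3 - E4 / 12 * p2 + E6 / 216"
    and w3: "(t * (1 + t)\<^sup>2 * k ^ 3)\<^sup>2 = 4 * p3 ^ 3 - E4 / 12 * p3 + E6 / 216"
  shows "12 * p1 = k\<^sup>2 * (1 + 6*t + 15*t^2 + 10*t^3 + t^4)"
    and "12 * p2 = k\<^sup>2 * (1 + 6*t + 3*t^2 - 2*t^3 + t^4)"
    and "12 * p3 = k\<^sup>2 * (1 - 6*t - 9*t^2 - 2*t^3 + t^4)"
    and "E4 = k ^ 4 * (1 + 12*t + 42*t^2 + 56*t^3 + 35*t^4 - 14*t^6 - 4*t^7 + t^8)"
    and "E6 = k ^ 6 * (1 + 18*t + 117*t^2 + 354*t^3 + 570*t^4 + 486*t^5 + 273*t^6 + 222*t^7 + 174*t^8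
       + 46*t^9 - 15*t^10 - 6*t^11 + t^12)"
proof -
  have cancel: "B = C" if "A * B = A * C" "A \<noteq> 0" for A B C :: complex using that by simp
  have diff': "4 * a ^ 3 - g * a + h - (4 * b ^ 3 - g * b + h) = (a - b) * (4 * (a\<^sup>2 + a * b + b\<^sup>2) - g)"
    for a b g h :: complex
    by (simp add: algebra_simps power2_eq_square power3_eq_cube)
  note diff = diff'[of _ "E4 / 12" "E6 / 216"]
  have B12: "4 * (p1\<^sup>2 + p1 * p2 + p2\<^sup>2) - E4 / 12 = k ^ 4 * (t\<^sup>2 * (1 + t) ^ 5 - t ^ 4 * (1 + t))"
  proof (rule cancel)
    show "(t\<^sup>2 * (1 + t) * k\<^sup>2) * (4 * (p1\<^sup>2 + p1 * p2 + p2\<^sup>2) - E4 / 12)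
        = (t\<^sup>2 * (1 + t) * k\<^sup>2) * (k ^ 4 * (t\<^sup>2 * (1 + t) ^ 5 - t ^ 4 * (1 + t)))"
      unfolding d12[symmetric] diff[symmetric] w1[symmetric] w2[symmetric] unfolding d12
      by (simp add: algebra_simps power_mult_distrib power_numeral_reduce)
  qed (use nz in simp)
  have B13: "4 * (p1\<^sup>2 + p1 * p3 + p3\<^sup>2) - E4 / 12 = k ^ 4 * (t ^ 3 * (1 + t) ^ 4 - t * (1 + t)\<^sup>2)"
  proof (rule cancel)
    show "(t * (1 + t)\<^sup>2 * k\<^sup>2) * (4 * (p1\<^sup>2 + p1 * p3 + p3\<^sup>2) - E4 / 12)
        = (t * (1 + t)\<^sup>2 * k\<^sup>2) * (k ^ 4 * (t ^ 3 * (1 + t) ^ 4 - t * (1 + t)\<^sup>2))"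
      unfolding d13[symmetric] diff[symmetric] w1[symmetric] w3[symmetric] unfolding d13
      by (simp add: algebra_simps power_mult_distrib power_numeral_reduce)
  qed (use nz in simp)
  have d23: "p2 - p3 = t * (1 + t) * k\<^sup>2"
  proof -
    have "p2 - p3 = (p1 - p3) - (p1 - p2)" by simp
    then show ?thesis unfolding d12 d13 by (simp add: algebra_simps power2_eq_square)
  qed
  have s: "4 * (p1 + p2 + p3) = k\<^sup>2 * ((1 + t)\<^sup>2 + t\<^sup>2 + t\<^sup>2 * (1 + t)\<^sup>2)"
  proof (rule cancel)
    have "(p2 - p3) * (4 * (p1 + p2 + p3)) =
       (4 * (p1\<^sup>2 + p1 * p2 + p2\<^sup>2) - E4 / 12) - (4 * (p1\<^sup>2 + p1 * p3 + p3\<^sup>2) - E4 / 12)"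
      by (simp add: algebra_simps power2_eq_square)
    then show "t * (1 + t) * k\<^sup>2 * (4 * (p1 + p2 + p3)) =
       t * (1 + t) * k\<^sup>2 * (k\<^sup>2 * ((1 + t)\<^sup>2 + t\<^sup>2 + t\<^sup>2 * (1 + t)\<^sup>2))"
      unfolding d23 B12 B13 by (simp add: algebra_simps power_numeral_reduce)
  qed (use nz in simp)
  have "12 * p1 = 4 * (p1 + p2 + p3) + 4 * (p1 - p2) + 4 * (p1 - p3)" by simp
  then show p1: "12 * p1 = k\<^sup>2 * (1 + 6*t + 15*t^2 + 10*t^3 + t^4)"
    unfolding s d12 d13 by (simp add: algebra_simps power_numeral_reduce)
  have "12 * p2 = 12 * p1 - 12 * (p1 - p2)" by simp
  then show p2: "12 * p2 = k\<^sup>2 * (1 + 6*t + 3*t^2 - 2*t^3 + t^4)"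
    unfolding p1 d12 by (simp add: algebra_simps power_numeral_reduce)
  have "12 * p3 = 12 * p1 - 12 * (p1 - p3)" by simp
  then show "12 * p3 = k\<^sup>2 * (1 - 6*t - 9*t^2 - 2*t^3 + t^4)"
    unfolding p1 d13 by (simp add: algebra_simps power_numeral_reduce)
  have "3 * E4 = (12 * p1)\<^sup>2 + (12 * p1) * (12 * p2) + (12 * p2)\<^sup>2
      - 36 * (4 * (p1\<^sup>2 + p1 * p2 + p2\<^sup>2) - E4 / 12)"
    by (simp add: algebra_simps power2_eq_square)
  also have "\<dots> = 3 * (k ^ 4 * (1 + 12*t + 42*t^2 + 56*t^3 + 35*t^4 - 14*t^6 - 4*t^7 + t^8))"
    unfolding p1 p2 B12 by (simp add: algebra_simps power_numeral_reduce)
  finally show E4: "E4 = k ^ 4 * (1 + 12*t + 42*t^2 + 56*t^3 + 35*t^4 - 14*t^6 - 4*t^7 + t^8)"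
    by (rule cancel) simp
  \<comment> \<open>The equation of the first point times 432 = 2 * 216, so that only
    \<open>12 * p1\<close> and integer coefficients occur.\<close>
  have "2 * E6 = 432 * (t\<^sup>2 * (1 + t) ^ 3 * k ^ 3)\<^sup>2 - (12 * p1) ^ 3 + 3 * E4 * (12 * p1)"
    unfolding w1 by (simp add: algebra_simps power3_eq_cube)
  also have "\<dots> = 2 * (k ^ 6 * (1 + 18*t + 117*t^2 + 354*t^3 + 570*t^4 + 486*t^5 + 273*t^6 + 222*t^7 + 174*t^8
       + 46*t^9 - 15*t^10 - 6*t^11 + t^12))"
    unfolding p1 E4 by (simp add: algebra_simps power_mult_distrib power_numeral_reduce)
  finally show "E6 = k ^ 6 * (1 + 18*t + 117*t^2 + 354*t^3 + 570*t^4 + 486*t^5 + 273*t^6 + 222*t^7 + 174*t^8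
       + 46*t^9 - 15*t^10 - 6*t^11 + t^12)"
    by (rule cancel) simp
qed

text \<open>The bracketed expressions are the second and fourth derivatives of \<open>P\<close> at
  the three points, already written through the differential equations; \<open>E4\<close> and
  \<open>E6\<close> here belong to the nome q^7.\<close>

lemma septic_eisenstein_polynomials:
  fixes x y z p1 p2 p3 E4 E6 :: complex
  assumes nz: "x \<noteq> 0" "y \<noteq> 0" "z \<noteq> 0"
    and d: "p1 - p2 = y * z" "p1 - p3 = x * z" "p2 - p3 = x * y"
    and w: "(x * z\<^sup>2)\<^sup>2 = 4 * p1 ^ 3 - E4 / 12 * p1 + E6 / 216"
      "(y\<^sup>2 * z)\<^sup>2 = 4 * p2 ^ 3 - E4 / 12 * p2 + E6 / 216"
      "(x\<^sup>2 * y)\<^sup>2 = 4 * p3 ^ 3 - E4 / 12 * p3 + E6 / 216"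
  shows "E4 + 240 * ((6 * p1\<^sup>2 - E4 / 24) + (6 * p2\<^sup>2 - E4 / 24) + (6 * p3\<^sup>2 - E4 / 24)) =
       x^4 - 116*x^3*y + 116*x*y^3 + y^4 - 116*x^3*z + 848*x*y*z^2 + 848*x^2*y*z
       - 848*x*y^2*z - 116*y^3*z + 116*x*z^3 + 116*y*z^3 + z^4" (is ?E4q)
    and "E4 = x^4 + 4*x^3*y - 4*x*y^3 + y^4 + 4*x^3*z + 8*x*y*z^2 + 8*x^2*y*z
       - 8*x*y^2*z + 4*y^3*z - 4*x*z^3 - 4*y*z^3 + z^4" (is ?E4)
    and "E6 - 504 * ((12 * (x * z\<^sup>2)\<^sup>2 + 12 * p1 * (6 * p1\<^sup>2 - E4 / 24))
         + (12 * (y\<^sup>2 * z)\<^sup>2 + 12 * p2 * (6 * p2\<^sup>2 - E4 / 24))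
         + (12 * (x\<^sup>2 * y)\<^sup>2 + 12 * p3 * (6 * p3\<^sup>2 - E4 / 24))) =
       x^6 + 258*x^5*y - 5904*x^4*y^2 - 5904*x^2*y^4 - 258*x*y^5 + y^6 + 258*x^5*z
       + 7310*x^3*y^2*z + 7310*x^2*y^3*z + 258*y^5*z - 5904*x^4*z^2 + 7310*x^3*y*z^2
       - 8751*x^2*y^2*z^2 - 7310*x*y^3*z^2 - 5904*y^4*z^2 - 7310*x^2*y*z^3
       - 7310*x*y^2*z^3 - 5904*x^2*z^4 - 5904*y^2*z^4 - 258*x*z^5 - 258*y*z^5 + z^6" (is ?E6q)
    and "E6 = x^6 + 6*x^5*y + 18*x^4*y^2 + 18*x^2*y^4 - 6*x*y^5 + y^6 + 6*x^5*z + 2*x^3*y^2*z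
       + 2*x^2*y^3*z + 6*y^5*z + 18*x^4*z^2 + 2*x^3*y*z^2 - 57*x^2*y^2*z^2 - 2*x*y^3*z^2
       + 18*y^4*z^2 - 2*x^2*y*z^3 - 2*x*y^2*z^3 + 18*x^2*z^4 + 18*y^2*z^4 - 6*x*z^5
       - 6*y*z^5 + z^6" (is ?E6)
proof -
  have "x * z = x * y + y * z" using d by (simp add: algebra_simps flip: d)
  then obtain t k where xyz: "x = (1 + t) * k" "y = t * k" "z = t * (1 + t) * k"
    and tk: "t \<noteq> 0" "1 + t \<noteq> 0" "k \<noteq> 0"
    using septic_conic_parametrization[OF nz] by metis
  have "p1 - p2 = t\<^sup>2 * (1 + t) * k\<^sup>2" "p1 - p3 = t * (1 + t)\<^sup>2 * k\<^sup>2"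
    unfolding d xyz by (simp_all add: power2_eq_square mult_ac)
  moreover have "x * z\<^sup>2 = t\<^sup>2 * (1 + t) ^ 3 * k ^ 3" "y\<^sup>2 * z = t ^ 3 * (1 + t) * k ^ 3"
    "x\<^sup>2 * y = t * (1 + t)\<^sup>2 * k ^ 3"
    unfolding xyz by (simp_all add: power2_eq_square power3_eq_cube mult_ac)
  note m = this
  ultimately have p1: "12 * p1 = k\<^sup>2 * (1 + 6*t + 15*t^2 + 10*t^3 + t^4)"
    and p2: "12 * p2 = k\<^sup>2 * (1 + 6*t + 3*t^2 - 2*t^3 + t^4)"
    and p3: "12 * p3 = k\<^sup>2 * (1 - 6*t - 9*t^2 - 2*t^3 + t^4)"
    and E4: "E4 = k ^ 4 * (1 + 12*t + 42*t^2 + 56*t^3 + 35*t^4 - 14*t^6 - 4*t^7 + t^8)"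
    and E6: "E6 = k ^ 6 * (1 + 18*t + 117*t^2 + 354*t^3 + 570*t^4 + 486*t^5 + 273*t^6 + 222*t^7 + 174*t^8
       + 46*t^9 - 15*t^10 - 6*t^11 + t^12)"
    using septic_weierstrass_system[OF tk _ _ w[unfolded m]] by blast+
  show ?E4
    unfolding E4 xyz by (simp add: algebra_simps power_mult_distrib power_numeral_reduce)
  show ?E6
    unfolding E6 xyz by (simp add: algebra_simps power_mult_distrib power_numeral_reduce)
  \<comment> \<open>Rescaling to \<open>12 * p1\<close>, \<open>12 * p2\<close>,
    \<open>12 * p3\<close>, whose values are polynomials with integer coefficients.\<close>
  have "E4 + 240 * ((6 * p1\<^sup>2 - E4 / 24) + (6 * p2\<^sup>2 - E4 / 24) + (6 * p3\<^sup>2 - E4 / 24))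
      = 10 * ((12 * p1)\<^sup>2 + (12 * p2)\<^sup>2 + (12 * p3)\<^sup>2) - 29 * E4"
    by (simp add: algebra_simps power2_eq_square)
  also have "\<dots> = k ^ 4 * (1 - 228*t + 42*t^2 + 1736*t^3 + 3395*t^4 + 3360*t^5 + 1666*t^6 + 236*t^7 + t^8)"
    unfolding p1 p2 p3 E4 by (simp add: algebra_simps power_mult_distrib power_numeral_reduce)
  finally show ?E4q
    unfolding xyz by (simp add: algebra_simps power_mult_distrib power_numeral_reduce)
  have "E6 - 504 * ((12 * (x * z\<^sup>2)\<^sup>2 + 12 * p1 * (6 * p1\<^sup>2 - E4 / 24))
         + (12 * (y\<^sup>2 * z)\<^sup>2 + 12 * p2 * (6 * p2\<^sup>2 - E4 / 24))
         + (12 * (x\<^sup>2 * y)\<^sup>2 + 12 * p3 * (6 * p3\<^sup>2 - E4 / 24)))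
      = E6 - 6048 * ((x * z\<^sup>2)\<^sup>2 + (y\<^sup>2 * z)\<^sup>2 + (x\<^sup>2 * y)\<^sup>2)
        - 21 * ((12 * p1) ^ 3 + (12 * p2) ^ 3 + (12 * p3) ^ 3) + 21 * E4 * (12 * p1 + 12 * p2 + 12 * p3)"
    by (simp add: algebra_simps power2_eq_square power3_eq_cube)
  also have "\<dots> = k ^ 6 * (1 + 522*t - 8955*t^2 - 37950*t^3 - 70998*t^4 - 131562*t^5 - 253239*t^6 - 316290*t^7
      - 218058*t^8 - 80090*t^9 - 14631*t^10 - 510*t^11 + t^12)"
    unfolding p1 p2 p3 E4 E6 m by (simp add: algebra_simps power_mult_distrib power_numeral_reduce)
  finally show ?E6q
    unfolding xyz by (simp add: algebra_simps power_mult_distrib power_numeral_reduce)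
qed

section \<open>Eisenstein series as Lambert series\<close>

context punctured_disc
begin

lemma eisenstein_E_eq:
  assumes "k > 0"
  shows "eisenstein_E (Suc k) q = 1 + 2 / riemann_zeta (1 - of_nat (Suc k)) * lambert q k q"
proof -
  have "(\<Sum>n. of_nat (Suc n) ^ k / (1 - q ^ Suc n) * q ^ Suc n) = lambert q k q - of_nat 0 ^ k / (1 - q ^ 0) * q ^ 0"
    unfolding lambert_def by (rule suminf_split_head) (rule summable_lambert[OF q1])
  then show ?thesis by (simp add: eisenstein_E_def)
qed

lemma eisenstein_E_4: "eisenstein_E 4 q = 1 + 240 * lambert q 3 q"
proof -
  have "(1 - of_nat (Suc 3) :: complex) = - 3" by simp
  then show ?thesis using eisenstein_E_eq[of 3] riemann_zeta_neg_3 by simp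
qed

lemma eisenstein_E_6: "eisenstein_E 6 q = 1 - 504 * lambert q 5 q"
proof -
  have "(1 - of_nat (Suc 5) :: complex) = - 5" by simp
  then show ?thesis using eisenstein_E_eq[of 5] riemann_zeta_neg_5 by simp
qed

text \<open>The left-hand side is the fourth derivative of \<open>P\<close>: apply z d/dz twice to
  \<open>6 * (P z)\<^sup>2 - E4 / 24\<close>.\<close>

lemma lambert_5_eq:
  assumes z: "norm q < norm z" "norm z < 1"
  shows "lambert q 5 z + lambert q 5 (q / z) = 12 * (wp1 q z)\<^sup>2 + 12 * P z * wp2 q z"
proof -
  define R where "R = {z :: complex. norm q < norm z \<and> norm z < 1}"
  have oR: "open R" unfolding R_def
    by (intro open_Collect_conj open_Collect_less continuous_intros)
  have R: "z \<in> annulus q" "z \<noteq> 1" "z \<noteq> 0" "norm z < 1" "norm (q / z) < 1" if "z \<in> R" for z :: complex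
    using inner_annulusD[of z] that by (auto simp: R_def)
  have 4: "lambert q 4 w - lambert q 4 (q / w) = 12 * P w * wp1 q w" if w: "w \<in> R" for w
  proof -
    have "((\<lambda>z. lambert q 3 z + lambert q 3 (q / z)) has_field_derivative
        (lambert q 4 w - lambert q 4 (q / w)) / w) (at w)"
      using R[OF w] q0 by (auto intro!: derivative_eq_intros simp: eval_nat_numeral field_simps)
    moreover have "((\<lambda>z. lambert q 3 z + lambert q 3 (q / z)) has_field_derivative
        (12 * P w * wp1 q w) / w) (at w)"
    proof (rule has_field_derivative_transform_within_open[OF _ oR w])
      show "((\<lambda>z. 6 * (P z)\<^sup>2 - E4 / 24) has_field_derivative (12 * P w * wp1 q w) / w) (at w)"
        using R[OF w] by (auto intro!: derivative_eq_intros DERIV_P)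
      show "6 * (P z)\<^sup>2 - E4 / 24 = lambert q 3 z + lambert q 3 (q / z)" if "z \<in> R" for z
        using wp2_eq[of z] wp_eq_lambert(3)[of z] R[OF that] that by (simp add: R_def)
    qed
    ultimately have "(lambert q 4 w - lambert q 4 (q / w)) / w = (12 * P w * wp1 q w) / w"
      by (rule DERIV_unique)
    then show ?thesis using R[OF w] by simp
  qed
  have w: "z \<in> R" using z by (simp add: R_def)
  have "((\<lambda>z. lambert q 4 z - lambert q 4 (q / z)) has_field_derivative
      (lambert q 5 z + lambert q 5 (q / z)) / z) (at z)"
    using R[OF w] q0 by (auto intro!: derivative_eq_intros simp: eval_nat_numeral field_simps)
  moreover have "((\<lambda>z. lambert q 4 z - lambert q 4 (q / z)) has_field_derivative
      (12 * (wp1 q z)\<^sup>2 + 12 * P z * wp2 q z) / z) (at z)"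
  proof (rule has_field_derivative_transform_within_open[OF _ oR w])
    show "((\<lambda>z. 12 * P z * wp1 q z) has_field_derivative (12 * (wp1 q z)\<^sup>2 + 12 * P z * wp2 q z) / z) (at z)"
      using R[OF w] by (auto intro!: derivative_eq_intros DERIV_P DERIV_wp1 simp: field_simps power2_eq_square)
  qed (simp add: 4)
  ultimately have "(lambert q 5 z + lambert q 5 (q / z)) / z = (12 * (wp1 q z)\<^sup>2 + 12 * P z * wp2 q z) / z"
    by (rule DERIV_unique)
  then show ?thesis using R[OF w] by simp
qed

end

text \<open>Termwise, 1/(1 - q^n) is a geometric sum of \<open>N\<close> powers of q^n divided by 1
  - q^(N n). The summand \<open>i = N\<close> is the Lambert series of the nome q^N at its own
  nome.\<close>

lemma lambert_multisection:
  assumes q: "norm q < 1" "q \<noteq> 0" and N: "N > 0"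
  shows "lambert q k q = (\<Sum>i = 1..N. lambert (q ^ N) k (q ^ i))"
proof -
  interpret Q: punctured_disc "q ^ N"
    using q N by unfold_locales (auto simp: norm_power power_less_one_iff)
  interpret q: punctured_disc q
    using q by unfold_locales auto
  have "(\<lambda>n. \<Sum>i = 1..N. of_nat n ^ k / (1 - (q ^ N) ^ n) * (q ^ i) ^ n) sums (\<Sum>i = 1..N. lambert (q ^ N) k (q ^ i))"
    unfolding lambert_def using q
    by (intro sums_sum summable_sums Q.summable_lambert) (auto simp: norm_power power_less_one_iff)
  moreover have "(\<Sum>i = 1..N. of_nat n ^ k / (1 - (q ^ N) ^ n) * (q ^ i) ^ n) = of_nat n ^ k / (1 - q ^ n) * q ^ n" for n
  proof (cases "n = 0")
    case False
    have nz: "1 - q ^ n \<noteq> 0" "1 - (q ^ N) ^ n \<noteq> 0"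
      using q.one_minus_power_ne_0 Q.one_minus_power_ne_0 False by auto
    have "(\<Sum>i = 1..N. (q ^ i) ^ n) = (\<Sum>i<N. q ^ n * (q ^ n) ^ i)"
      by (rule sum.reindex_bij_witness[of _ Suc "\<lambda>i. i - 1"])
         (auto simp: power_mult[symmetric] mult.commute power_add[symmetric] algebra_simps)
    also have "\<dots> = q ^ n * ((1 - (q ^ n) ^ N) / (1 - q ^ n))"
      using nz by (subst sum_distrib_left[symmetric], subst sum_gp_strict) auto
    also have "(q ^ n) ^ N = (q ^ N) ^ n" by (simp add: mult.commute flip: power_mult)
    finally have "(\<Sum>i = 1..N. (q ^ i) ^ n) = q ^ n * ((1 - (q ^ N) ^ n) / (1 - q ^ n))" .
    then show ?thesis
      using nz unfolding sum_distrib_left[symmetric] by simp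
  qed simp
  ultimately show ?thesis unfolding lambert_def by (simp add: sums_iff)
qed

section \<open>Fractional powers of the nome\<close>

lemma qpow_56: "qpow \<tau> (real m / 56) = qpow \<tau> (1 / 56) ^ m"
  unfolding qpow_def exp_of_nat_mult[symmetric] by (simp add: field_simps)

lemma nome_eq_qpow: "nome \<tau> = qpow \<tau> (1 / 56) ^ 56"
  unfolding qpow_56[symmetric] by (simp add: nome_def qpow_def)

text \<open>Completing the square backwards: the quadratic exponent becomes a constant, 7 times a
  triangular number and a linear term, as the triple product of nome q^7 requires. For m = 5, 3, 1
  the argument is q^6, q^5, q^4.\<close>

lemma qpow_theta_exponent:
  assumes "2 * k = 7 + m"
  shows "qpow \<tau> ((14 * of_int n + real m)\<^sup>2 / 56)
     = qpow \<tau> (1 / 56) ^ (m\<^sup>2) * ((nome \<tau> ^ 7) powi tri n * (nome \<tau> ^ k) powi n)"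
proof -
  have "(2::real) * of_int (tri n) = of_int n * (of_int n - 1)"
    using arg_cong[OF two_tri[of n], of "real_of_int"] by simp
  then have nn: "(of_int n)\<^sup>2 = of_int n + 2 * real_of_int (tri n)"
    by (simp add: power2_eq_square algebra_simps)
  have m: "real m = 2 * real k - 7" using arg_cong[OF assms, of real] by simp
  have "(14 * of_int n + real m)\<^sup>2 / 56 = (real m)\<^sup>2 / 56 + 7 / 2 * (of_int n)\<^sup>2 + real m * of_int n / 2"
    by (simp add: power2_eq_square field_simps)
  also have "\<dots> = (real m)\<^sup>2 / 56 + (7 * of_int (tri n) + (7 + real m) / 2 * of_int n)"
    unfolding nn by (simp add: algebra_simps)
  also have "(7 + real m) / 2 = real k" using m by simp
  finally have e: "(14 * of_int n + real m)\<^sup>2 / 56 = real (m\<^sup>2) / 56 + 7 * of_int (tri n) + real k * of_int n"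
    by simp
  have add: "qpow \<tau> (r + s) = qpow \<tau> r * qpow \<tau> s" for r s
    by (simp add: qpow_def algebra_simps exp_add)
  have pw: "(nome \<tau> ^ j) powi n = qpow \<tau> (real j * of_int n)" for j n
    unfolding nome_def qpow_def exp_of_nat_mult[symmetric] exp_power_int[symmetric]
    by (simp add: mult_ac exp_power_int)
  show ?thesis unfolding e add qpow_56 pw by (simp add: pw[of 7, simplified])
qed

theorem theorem4p5:
  fixes \<tau> q x y z :: complex
  assumes "Im \<tau> > 0"
    and "q = nome \<tau>"
    and "x = septic_x \<tau>" and "y = septic_y \<tau>" and "z = septic_z \<tau>"
  shows
    "eisenstein_E 4 q =
       x^4 - 116*x^3*y + 116*x*y^3 + y^4 - 116*x^3*z + 848*x*y*z^2 + 848*x^2*y*z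
       - 848*x*y^2*z - 116*y^3*z + 116*x*z^3 + 116*y*z^3 + z^4 \<and>
     eisenstein_E 4 (q^7) =
       x^4 + 4*x^3*y - 4*x*y^3 + y^4 + 4*x^3*z + 8*x*y*z^2 + 8*x^2*y*z
       - 8*x*y^2*z + 4*y^3*z - 4*x*z^3 - 4*y*z^3 + z^4 \<and>
     eisenstein_E 6 q =
       x^6 + 258*x^5*y - 5904*x^4*y^2 - 5904*x^2*y^4 - 258*x*y^5 + y^6 + 258*x^5*z
       + 7310*x^3*y^2*z + 7310*x^2*y^3*z + 258*y^5*z - 5904*x^4*z^2 + 7310*x^3*y*z^2
       - 8751*x^2*y^2*z^2 - 7310*x*y^3*z^2 - 5904*y^4*z^2 - 7310*x^2*y*z^3
       - 7310*x*y^2*z^3 - 5904*x^2*z^4 - 5904*y^2*z^4 - 258*x*z^5 - 258*y*z^5 + z^6 \<and>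
     eisenstein_E 6 (q^7) =
       x^6 + 6*x^5*y + 18*x^4*y^2 + 18*x^2*y^4 - 6*x*y^5 + y^6 + 6*x^5*z + 2*x^3*y^2*z
       + 2*x^2*y^3*z + 6*y^5*z + 18*x^4*z^2 + 2*x^3*y*z^2 - 57*x^2*y^2*z^2 - 2*x*y^3*z^2
       + 18*y^4*z^2 - 2*x^2*y*z^3 - 2*x*y^2*z^3 + 18*x^2*z^4 + 18*y^2*z^4 - 6*x*z^5
       - 6*y*z^5 + z^6"
proof -
  have q_nz: "q \<noteq> 0" by (simp add: assms(2) nome_def)
  have q_lt: "norm q < 1" using assms(1) by (simp add: assms(2) nome_def)
  interpret q: punctured_disc q using q_nz q_lt by unfold_locales
  \<comment> \<open>From here on the unqualified \<open>P\<close>, \<open>E4\<close>,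
    \<open>E6\<close> and locale facts refer to the nome q^7; the prefix \<open>q\<close> marks
    those of the nome q.\<close>
  interpret punctured_disc "q ^ 7"
    using q_nz q_lt by unfold_locales (auto simp: norm_power power_less_one_iff)
  define e where "e = qpow \<tau> (1 / 56)"
  define \<phi> where "\<phi> = qpoch_inf (q ^ 7) (q ^ 7)"
  define t where "t = (\<lambda>i. theta (q ^ 7) (q ^ i))"
  have e0: "e \<noteq> 0" by (simp add: e_def qpow_def)
  have qe: "q = e ^ 56" by (simp add: assms(2) e_def nome_eq_qpow)
  have \<phi>0: "\<phi> \<noteq> 0" unfolding \<phi>_def by (rule qpoch_nonzero) (rule q1)
  have range: "norm (q ^ 7) < norm (q ^ i)" "norm (q ^ i) < 1" if "i \<in> {1, 2, 3}" for i
    using that q_nz q_lt by (auto simp: norm_power power_less_one_iff intro!: power_strict_decreasing)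
  have ann: "q ^ i \<in> annulus (q ^ 7)" "q ^ i \<noteq> 1" if "i \<in> {1, 2, 3}" for i
  proof -
    have "norm (q ^ 7) * norm (q ^ i) \<le> 1 * norm (q ^ i)"
      using q_lt by (intro mult_right_mono) (auto simp: norm_power power_le_one)
    then show "q ^ i \<in> annulus (q ^ 7)"
      using range[OF that] by (simp add: annulus_def norm_mult)
    show "q ^ i \<noteq> 1" using range[OF that] by auto
  qed
  have t0: "t i \<noteq> 0" if "i \<in> {1, 2, 3}" for i
    unfolding t_def using theta_nonzero[OF ann[OF that]] .
  \<comment> \<open>The reflection of theta brings the arguments q^4, q^5, q^6 back to q^3, q^2,
    q.\<close>
  have t7: "t (7 - i) = t i" if "i \<le> 7" for i
    using theta_reflect[of "q ^ i"] that q_nz by (simp add: t_def power_diff)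
  have theta_sum: "(\<Sum>\<^sub>\<infinity>n::int. (-1) powi n * qpow \<tau> ((14 * of_int n + real m)\<^sup>2 / 56)) = e ^ (m\<^sup>2) * (\<phi> * t k)"
    if "2 * k = 7 + m" for k m
  proof (rule infsumI)
    have "((\<lambda>n. e ^ (m\<^sup>2) * ((-1) powi n * (q ^ 7) powi tri n * (q ^ k) powi n)) has_sum e ^ (m\<^sup>2) * (\<phi> * t k)) UNIV"
      unfolding \<phi>_def t_def using q_nz by (intro has_sum_cmult_right jacobi_triple_product) simp
    then show "((\<lambda>n. (-1) powi n * qpow \<tau> ((14 * of_int n + real m)\<^sup>2 / 56)) has_sum e ^ (m\<^sup>2) * (\<phi> * t k)) UNIV"
      unfolding qpow_theta_exponent[OF that] by (simp add: e_def assms(2) mult_ac)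
  qed
  have a: "theta_a \<tau> = - (e ^ 25 * (\<phi> * t 1))"
    using theta_sum[of 6 5] t7[of 1] by (simp add: theta_a_def)
  have b: "theta_b \<tau> = e ^ 9 * (\<phi> * t 2)"
    using theta_sum[of 5 3] t7[of 2] by (simp add: theta_b_def)
  have c: "theta_c \<tau> = e * (\<phi> * t 3)"
    using theta_sum[of 4 1] t7[of 3] by (simp add: theta_c_def)
  have e49: "qpow \<tau> (7 / 8) = e ^ 49"
    using qpow_56[of \<tau> 49] by (simp add: e_def)
  \<comment> \<open>\<open>A\<close>, \<open>B\<close>, \<open>C\<close> are powers of
    \<open>e\<close>. The exponents are 49 + 9 = 2 + 56 for x, 49 + 25 = 18 + 56 for y and 49 + 1 =
    50 for z, so \<open>Q\<close> is q, q and 1: no fractional power survives.\<close>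
  have quot: "A * \<phi> ^ 3 * (B * (\<phi> * s) / (C * (\<phi> * r))\<^sup>2) = Q * \<phi>\<^sup>2 * s / r\<^sup>2"
    if "A * B = C\<^sup>2 * Q" "C \<noteq> 0" for A B C Q r s
  proof -
    have "A * \<phi> ^ 3 * (B * (\<phi> * s) / (C * (\<phi> * r))\<^sup>2) = (A * B) * (\<phi> ^ 3 * (\<phi> * s)) / (C\<^sup>2 * (\<phi>\<^sup>2 * r\<^sup>2))"
      by (simp add: power_mult_distrib mult_ac)
    also have "\<dots> = (C\<^sup>2 * \<phi>\<^sup>2) * (Q * \<phi>\<^sup>2 * s) / ((C\<^sup>2 * \<phi>\<^sup>2) * r\<^sup>2)"
      unfolding that(1) by (simp add: eval_nat_numeral mult_ac)
    also have "\<dots> = Q * \<phi>\<^sup>2 * s / r\<^sup>2"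
      by (rule mult_divide_mult_cancel_left) (use that(2) \<phi>0 in simp)
    finally show ?thesis .
  qed
  have x: "x = q * \<phi>\<^sup>2 * t 2 / (t 3)\<^sup>2"
    unfolding assms(3) septic_x_def b c e49 assms(2)[symmetric] \<phi>_def[symmetric]
    by (rule quot) (use e0 in \<open>simp_all add: qe flip: power_add\<close>)
  have "y = e ^ 49 * \<phi> ^ 3 * (e ^ 25 * (\<phi> * t 1) / (e ^ 9 * (\<phi> * t 2))\<^sup>2)"
    unfolding assms(4) septic_y_def a b e49 assms(2)[symmetric] \<phi>_def[symmetric] by simp
  also have "\<dots> = q * \<phi>\<^sup>2 * t 1 / (t 2)\<^sup>2"
    by (rule quot) (use e0 in \<open>simp_all add: qe flip: power_add power_mult\<close>)
  finally have y: "y = q * \<phi>\<^sup>2 * t 1 / (t 2)\<^sup>2" .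
  have "z = e ^ 49 * \<phi> ^ 3 * (e * (\<phi> * t 3) / (e ^ 25 * (\<phi> * t 1))\<^sup>2)"
    unfolding assms(5) septic_z_def a c e49 assms(2)[symmetric] \<phi>_def[symmetric] by simp
  also have "\<dots> = 1 * \<phi>\<^sup>2 * t 3 / (t 1)\<^sup>2"
    by (rule quot) (use e0 in \<open>simp_all flip: power_add power_mult power_Suc2\<close>)
  finally have z: "z = \<phi>\<^sup>2 * t 3 / (t 1)\<^sup>2" by simp
  define t1 t2 t3 where "t1 = t 1" and "t2 = t 2" and "t3 = t 3"
  note t_defs = t1_def t2_def t3_def
  have T: "t1 \<noteq> 0" "t2 \<noteq> 0" "t3 \<noteq> 0"
    using t0[of 1] t0[of 2] t0[of 3] unfolding t_defs by blast+
  have t456: "t 4 = t3" "t 5 = t2" "t 6 = t1"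
    using t7[of 3] t7[of 2] t7[of 1] by (simp_all add: t_defs)
  note xyz = x[folded t_defs] y[folded t_defs] z[folded t_defs]
  have nz: "x \<noteq> 0" "y \<noteq> 0" "z \<noteq> 0" using T q_nz \<phi>0 by (simp_all add: xyz)
  \<comment> \<open>With \<open>i < m\<close> the quotient of the two arguments is a natural power
    of q, so \<open>t\<close> applies; the differences needed are the negatives.\<close>
  have diff: "P (q ^ m) - P (q ^ i) = - (q ^ i) * \<phi> ^ 4 * t (m + i) * t (m - i) / ((t m)\<^sup>2 * (t i)\<^sup>2)"
    if "i \<in> {1, 2, 3}" "m \<in> {1, 2, 3}" "i < m" for i m
  proof -
    have "q ^ m * q ^ i = q ^ (m + i)" "q ^ m / q ^ i = q ^ (m - i)"
      using q_nz that by (simp_all add: power_add power_diff)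
    then show ?thesis
      using wp0_diff_eq[OF ann[OF that(2)] ann[OF that(1)]] by (simp add: P_def \<phi>_def t_def)
  qed
  have d: "P q - P (q ^ 2) = y * z" "P q - P (q ^ 3) = x * z" "P (q ^ 2) - P (q ^ 3) = x * y"
  proof -
    have "P (q ^ 2) - P q = - q * \<phi> ^ 4 * t3 * t1 / (t2\<^sup>2 * t1\<^sup>2)"
      using diff[of 1 2] by (simp add: t_defs numeral_3_eq_3)
    also have "\<dots> = - (y * z)" using T by (simp add: xyz power2_eq_square power4_eq_xxxx)
    finally show "P q - P (q ^ 2) = y * z" by (simp add: algebra_simps)
    have "P (q ^ 3) - P q = - q * \<phi> ^ 4 * t3 * t2 / (t3\<^sup>2 * t1\<^sup>2)"
      using diff[of 1 3] by (simp add: t456) (simp add: t_defs)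
    also have "\<dots> = - (x * z)" using T by (simp add: xyz power2_eq_square power4_eq_xxxx)
    finally show "P q - P (q ^ 3) = x * z" by (simp add: algebra_simps)
    have "P (q ^ 3) - P (q ^ 2) = - q\<^sup>2 * \<phi> ^ 4 * t2 * t1 / (t3\<^sup>2 * t2\<^sup>2)"
      using diff[of 2 3] by (simp add: t456) (simp add: t_defs)
    also have "\<dots> = - (x * y)" using T by (simp add: xyz power2_eq_square power4_eq_xxxx)
    finally show "P (q ^ 2) - P (q ^ 3) = x * y" by (simp add: algebra_simps)
  qed
  have wp1_i: "wp1 (q ^ 7) (q ^ i) = q ^ i * \<phi> ^ 6 * t (2 * i) / t i ^ 4" if "i \<in> {1, 2, 3}" for i
    using wp1_eq[OF ann[OF that]] by (simp add: \<phi>_def t_def mult.commute flip: power_mult)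
  have w: "wp1 (q ^ 7) q = x * z\<^sup>2" "wp1 (q ^ 7) (q ^ 2) = y\<^sup>2 * z" "wp1 (q ^ 7) (q ^ 3) = x\<^sup>2 * y"
  proof -
    have "wp1 (q ^ 7) q = q * \<phi> ^ 6 * t2 / t1 ^ 4" using wp1_i[of 1] by (simp add: t_defs)
    also have "\<dots> = x * z\<^sup>2" using T by (simp add: xyz eval_nat_numeral mult_ac)
    finally show "wp1 (q ^ 7) q = x * z\<^sup>2" .
    have "wp1 (q ^ 7) (q ^ 2) = q\<^sup>2 * \<phi> ^ 6 * t3 / t2 ^ 4"
      using wp1_i[of 2] by (simp add: t456) (simp add: t_defs)
    also have "\<dots> = y\<^sup>2 * z" using T by (simp add: xyz eval_nat_numeral mult_ac)
    finally show "wp1 (q ^ 7) (q ^ 2) = y\<^sup>2 * z" .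
    have "wp1 (q ^ 7) (q ^ 3) = q ^ 3 * \<phi> ^ 6 * t1 / t3 ^ 4"
      using wp1_i[of 3] by (simp add: t456) (simp add: t_defs)
    also have "\<dots> = x\<^sup>2 * y" using T by (simp add: xyz eval_nat_numeral mult_ac)
    finally show "wp1 (q ^ 7) (q ^ 3) = x\<^sup>2 * y" .
  qed
  note ann' = ann[of 1, simplified] ann[of 2, simplified] ann[of 3, simplified]
  note range' = range[of 1, simplified] range[of 2, simplified] range[of 3, simplified]
  note main = septic_eisenstein_polynomials[OF nz d, of E4 E6,
      OF wp1_square_eq[OF ann'(1,2), unfolded w] wp1_square_eq[OF ann'(3,4), unfolded w]
         wp1_square_eq[OF ann'(5,6), unfolded w]]
  \<comment> \<open>The residues i and 7 - i are paired because q^(7-i) is q^7 / q^i, the second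
    argument in the Lambert form of the derivatives of \<open>P\<close>.\<close>
  have split: "lambert q k q = lambert (q ^ 7) k (q ^ 7)
     + ((lambert (q ^ 7) k q + lambert (q ^ 7) k (q ^ 7 / q))
      + (lambert (q ^ 7) k (q ^ 2) + lambert (q ^ 7) k (q ^ 7 / q ^ 2))
      + (lambert (q ^ 7) k (q ^ 3) + lambert (q ^ 7) k (q ^ 7 / q ^ 3)))" for k
  proof -
    have "q ^ 7 / q = q ^ 6" "q ^ 7 / q ^ 2 = q ^ 5" "q ^ 7 / q ^ 3 = q ^ 4"
      using q_nz by (simp_all add: eval_nat_numeral)
    moreover have "{1..7} = {1, 2, 3, 4, 5, 6, 7 :: nat}" by auto
    ultimately show ?thesis
      using lambert_multisection[OF q_lt q_nz, of 7 k] by simp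
  qed
  have e4: "eisenstein_E 4 q = E4 + 240 * ((6 * (P q)\<^sup>2 - E4 / 24) + (6 * (P (q ^ 2))\<^sup>2 - E4 / 24)
      + (6 * (P (q ^ 3))\<^sup>2 - E4 / 24))"
    unfolding q.eisenstein_E_4 split[of 3] wp_eq_lambert(3)[OF range'(1,2), symmetric]
      wp_eq_lambert(3)[OF range'(3,4), symmetric] wp_eq_lambert(3)[OF range'(5,6), symmetric]
      wp2_eq[OF ann'(1,2)] wp2_eq[OF ann'(3,4)] wp2_eq[OF ann'(5,6)]
    by (simp add: E4_def)
  have e6: "eisenstein_E 6 q = E6 - 504 * ((12 * (x * z\<^sup>2)\<^sup>2 + 12 * P q * (6 * (P q)\<^sup>2 - E4 / 24))
         + (12 * (y\<^sup>2 * z)\<^sup>2 + 12 * P (q ^ 2) * (6 * (P (q ^ 2))\<^sup>2 - E4 / 24))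
         + (12 * (x\<^sup>2 * y)\<^sup>2 + 12 * P (q ^ 3) * (6 * (P (q ^ 3))\<^sup>2 - E4 / 24)))"
    unfolding q.eisenstein_E_6 split[of 5] lambert_5_eq[OF range'(1,2)]
      lambert_5_eq[OF range'(3,4)] lambert_5_eq[OF range'(5,6)]
      wp2_eq[OF ann'(1,2)] wp2_eq[OF ann'(3,4)] wp2_eq[OF ann'(5,6)] w
    by (simp add: E6_def)
  have e7: "eisenstein_E 4 (q ^ 7) = E4" "eisenstein_E 6 (q ^ 7) = E6"
    by (simp_all add: eisenstein_E_4 eisenstein_E_6 E4_def E6_def)
  show ?thesis
    unfolding e4 e6 e7 using main by blast
qed

end
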